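(* Let $V:[-1,1]\times[t_0,t_1]\to so(3)$ be a variation through Lie quadratics of the nonzero constant $V_0=D$, as specified in the context, with associated data $d=\|D\|$, $F_0,F_1,F_2$, $c_0,c_1,c_2\in\mathbb{R}$, $A_0,A_1,B\in F_0^\perp$, and second order approximate quadratic $\hat V_2$ (depending on $\delta$). Write $A_1=a_{11}F_1+a_{12}F_2$. Assume $B\neq \mathbf 0$ and write $B=\beta(\cos\gamma\,F_1+\sin\gamma\,F_2)$ with $\beta>0$, $\gamma\in[0,2\pi)$. Set $\rho:=-2c_2/(d^2\beta)$. Let $x_\delta:[t_0,t_1]\to SO(3)$ be a Riemannian cubic whose Lie quadratic is the nearly constant $V_\delta$, where $\delta\in(0,1)$ is small. For $t\in[t_0,t_1]$ define $$\hat\phi(t):=\delta(\rho^2+1)^{1/2}\left((t-t_0)\beta+\frac{a_{11}(\cos(\gamma-d(t-t_0))-\cos\gamma)+a_{12}(\sin(\gamma-d(t-t_0))-\sin\gamma)}{d^2}\right),$$ $$\hat y(t):=R_{\hat\phi(t)}\,T(\hat V_2^{(2)})(t),\qquad \hat x(t):=x_\delta(t_0)\,\hat y(t_0)^{\mathbf T}\,\hat y(t).$$ Then for every integer $j\ge 0$ and all $t\in[t_0,t_1]$, $$x_\delta^{(j)}(t)=\hat x^{(j)}(t)+O(\delta^2),$$ where the asymptotic constants depend on $a_{11},a_{12},\beta,c_2,d,t_0,t_1$ and $j$.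
   Context: Superscript $(j)$ denotes the $j$-th derivative in $t$; for a function of $(h,t)$, $V^{(i,j)}$ denotes $i$ derivatives in $h$ and $j$ in $t$. Throughout $t_0<t_1$. ${}^{\mathbf T}$ denotes transpose. Lie algebra and metric. Euclidean space $E^3$ is a Lie algebra with the cross product; the isomorphism $\mathrm{ad}:E^3\to so(3)$, $\mathrm{ad}(v)(w)=v\times w$, identifies $E^3$ with the skew-symmetric $3\times 3$ matrices $so(3)$, and $so(3)$ carries the inner product $\langle\,,\rangle$ making $\mathrm{ad}$ an isometry. $SO(3)$ has the corresponding bi-invariant Riemannian metric. Riemannian cubics and Lie quadratics. A smooth curve $x:[t_0,t_1]\to SO(3)$ is a Riemannian cubic when it is a critical point of $\int_{t_0}^{t_1}\|\nabla_t x^{(1)}\|^2dt$ with $x,x^{(1)}$ prescribed at $t_0,t_1$, in the sense that it satisfies the Euler-Lagrange equation $\nabla_t^3x^{(1)}+R(\nabla_tx^{(1)},x^{(1)})x^{(1)}=\mathbf 0$, where $\nabla$ is the Levi-Civita covariant derivative and $R$ the Riemannian curvature. Its left Lie reduction is $t\mapsto x(t)^{-1}x^{(1)}(t)\in so(3)$. A curve $x$ is a Riemannian cubic if and only if its left Lie reduction $U$ is a Lie quadratic, meaning that $U^{(2)}=[U^{(1)},U]+C$ for some constant $C\in so(3)$ (equivalently $U^{(3)}=[U^{(2)},U]$). Then $U$ is called the Lie quadratic of $x$. Variation. $V:[-1,1]\times[t_0,t_1]\to so(3)$ is $C^\infty$; $V_h:=V(h,\cdot)$ is a Lie quadratic for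 every $h\in[-1,1]$; $V_0$ is a nonzero constant $D$; and $h\mapsto V(h,t_0)$ is an affine function of uniform norm $\le 1$. Notation. $d:=\|D\|$, $F_0:=D/d$, and $F_1,F_2\in so(3)$ are such that $F_0,F_1,F_2$ is orthonormal with $[F_0,F_1]=F_2$, $[F_2,F_0]=F_1$. $F_0^\perp$ is the orthogonal complement of $F_0$ in $so(3)$. $\tilde e(t):=\exp(-d(t-t_0)\,\mathrm{ad}(F_0))$, a linear endomorphism of $so(3)$, where here $\mathrm{ad}(F_0)=[F_0,\cdot]$. The constants $c_0,c_1,c_2\in\mathbb{R}$ and $A_0,A_1,B\in F_0^\perp$ are those determined by $$V^{(1,0)}(0,t)=\big(c_0+c_1(t-t_0)+c_2(t-t_0)^2\big)F_0+A_0+(t-t_0)A_1+\tilde e(t)(B).$$ Second order approximate quadratic: for $\delta\in(0,1)$, $\hat V_2(t):=V_0(t)+\delta V^{(1,0)}(0,t)+\frac{\delta^2}{2}V^{(2,0)}(0,t)$. Rotation $R_r$: $R_r:=\begin{pmatrix}\cos r&\sin r&0\\-\sin r&\cos r&0\\0&0&1\end{pmatrix}$. For linearly independent $X_1,X_2\in E^3$, $S(X_1,X_2)\in SO(3)$ is the matrix whose rows are, in order, $$\frac{\|X_1\|^2X_2-\langle X_1,X_2\rangle X_1}{\|X_1\|\sqrt{\|X_1\|^2\|X_2\|^2-\langle X_1,X_2\rangle^2}},\qquad \frac{X_1\times X_2}{\sqrt{\|X_1\|^2\|X_2\|^2-\langle X_1,X_2\rangle^2}},\qquad \frac{X_1}{\|X_1\|}.$$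 For a curve $W:[t_0,t_1]\to E^3\cong so(3)$ with $W(t),W^{(1)}(t)$ everywhere linearly independent, $T(W)(t):=S(W(t),W^{(1)}(t))$. Elements of $so(3)$ are regarded as vectors in $E^3$ via $\mathrm{ad}^{-1}$ when forming $T$.
   Formalization: The asymptotic constants depend, besides the listed quantities, on a bound M for the h-derivatives of order at most 3 of V, V^(0,1), V^(0,2); every variation has such a bound, and constants depending only on the listed quantities are impossible. *)

theory Defs
  imports "HOL-Analysis.Analysis"
begin

text \<open>Derivatives are taken within the domain \<open>S\<close>, hence are one-sided at the end points of an
  interval.\<close>

definition vderiv :: "real set \<Rightarrow> (real \<Rightarrow> 'a::real_normed_vector) \<Rightarrow> real \<Rightarrow> 'a" where
  "vderiv S f = (\<lambda>t. vector_derivative f (at t within S))"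

definition nderiv :: "real set \<Rightarrow> nat \<Rightarrow> (real \<Rightarrow> 'a::real_normed_vector) \<Rightarrow> real \<Rightarrow> 'a" where
  "nderiv S j f = (vderiv S ^^ j) f"

definition smooth_curve_on :: "real set \<Rightarrow> (real \<Rightarrow> 'a::real_normed_vector) \<Rightarrow> bool" where
  "smooth_curve_on S f \<longleftrightarrow> (\<forall>j. nderiv S j f differentiable_on S)"

primrec Ck_on :: "nat \<Rightarrow> (real \<times> real) set \<Rightarrow> (real \<times> real \<Rightarrow> 'a::real_normed_vector) \<Rightarrow> bool" where
  "Ck_on 0 S f \<longleftrightarrow> continuous_on S f"
| "Ck_on (Suc k) S f \<longleftrightarrow>
     (\<exists>fh ft. (\<forall>p\<in>S. (f has_derivative (\<lambda>u. fst u *\<^sub>R fh p + snd u *\<^sub>R ft p)) (at p within S))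
              \<and> Ck_on k S fh \<and> Ck_on k S ft)"

definition smooth2_on :: "(real \<times> real) set \<Rightarrow> (real \<Rightarrow> real \<Rightarrow> 'a::real_normed_vector) \<Rightarrow> bool" where
  "smooth2_on S V \<longleftrightarrow> (\<forall>k. Ck_on k S (\<lambda>p. V (fst p) (snd p)))"

definition mixed_deriv ::
    "real \<Rightarrow> real \<Rightarrow> nat \<Rightarrow> nat \<Rightarrow> (real \<Rightarrow> real \<Rightarrow> 'a::real_normed_vector) \<Rightarrow> real \<Rightarrow> real \<Rightarrow> 'a" where
  "mixed_deriv t0 t1 i j V h t = nderiv {-1..1} i (\<lambda>k. nderiv {t0..t1} j (V k) t) h"

text \<open>Elements of \<open>so(3)\<close> are represented by vectors of \<open>E\<^sup>3\<close> through the isometric Lie algebra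
  isomorphism \<open>ad\<close>: the bracket is the cross product, inner product and norm are the
  Euclidean ones, and \<open>ad\<close> is applied whenever the skew-symmetric matrix itself is needed.
  The inner product of matrices that makes \<open>ad\<close> an isometry is half of the Frobenius one.\<close>

definition ad :: "real^3 \<Rightarrow> real^3^3" where
  "ad v = matrix (cross3 v)"

lemma ad_mult_vec: "ad v *v w = cross3 v w"
  using bilinear_cross by (simp add: ad_def matrix_works bilinear_def)

lemma ad_components:
  "ad v = vector [vector [0, - v$3, v$2], vector [v$3, 0, - v$1], vector [- v$2, v$1, 0]]"
  by (simp add: ad_def matrix_def vec_eq_iff forall_3 cross3_def axis_def)

lemma ad_bracket: "ad (cross3 v w) = ad v ** ad w - ad w ** ad v"
  by (simp add: ad_components vec_eq_iff forall_3 matrix_matrix_mult_def sum_3 cross3_def)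

lemma inner_ad: "ad v \<bullet> ad w = 2 * (v \<bullet> w)"
  by (simp add: ad_components inner_vec_def sum_3)

lemma range_ad: "range ad = {A. transpose A = - A}"
proof (intro equalityI subsetI)
  fix A :: "real^3^3"
  assume "A \<in> {A. transpose A = - A}"
  then have tr: "transpose A = - A" by simp
  have *: "A$i$j = - A$j$i" for i j
  proof -
    have "A$i$j = transpose A $ j $ i" by (simp add: transpose_def)
    also have "\<dots> = - A$j$i" by (simp add: tr)
    finally show ?thesis .
  qed
  have "A$1$1 = 0" "A$2$2 = 0" "A$3$3 = 0"
    using *[of 1 1] *[of 2 2] *[of 3 3] by simp_all
  then have "A = ad (vector [A$3$2, A$1$3, A$2$1])"
    using *[of 1 2] *[of 2 3] *[of 3 1]
    unfolding ad_components vec_eq_iff forall_3 vector_3 by (intro conjI) (assumption | simp)+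
  then show "A \<in> range ad" by blast
qed (auto simp: ad_components vec_eq_iff forall_3 transpose_def)

definition lin_exp :: "('a::real_normed_vector \<Rightarrow> 'a) \<Rightarrow> 'a \<Rightarrow> 'a" where
  "lin_exp L v = (\<Sum>n. (1 / fact n) *\<^sub>R (L ^^ n) v)"

definition lie_quadratic :: "real \<Rightarrow> real \<Rightarrow> (real \<Rightarrow> real^3) \<Rightarrow> bool" where
  "lie_quadratic t0 t1 U \<longleftrightarrow> smooth_curve_on {t0..t1} U \<and>
     (\<exists>C. \<forall>t\<in>{t0..t1}.
        nderiv {t0..t1} 2 U t = cross3 (nderiv {t0..t1} 1 U t) (U t) + C)"

text \<open>\<open>SO(3)\<close> is embedded in the \<open>3 \<times> 3\<close> matrices, with tangent space
  \<open>{p ** A | A skew-symmetric}\<close> at \<open>p\<close>. The bi-invariant metric is half of the restriction of the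
  Frobenius inner product, so its Levi-Civita derivative is the tangential part of
  the derivative in the ambient space. For \<open>p \<in> SO(3)\<close>, \<open>tan_proj p\<close> is the
  Frobenius-orthogonal projection onto the tangent space at \<open>p\<close>.\<close>

definition tan_proj :: "real^3^3 \<Rightarrow> real^3^3 \<Rightarrow> real^3^3" where
  "tan_proj p Z = (1/2) *\<^sub>R (Z - p ** transpose Z ** p)"

lemma inner_matrix_trace: "(A::real^3^3) \<bullet> B = trace (transpose A ** B)"
  by (simp add: inner_vec_def trace_def transpose_def matrix_matrix_mult_def sum_3)

lemma tan_proj_tangent:
  assumes "rotation_matrix p" shows "tan_proj p Z \<in> range (\<lambda>v. p ** ad v)"
proof -
  define A where "A = (1/2) *\<^sub>R (transpose p ** Z - transpose Z ** p)"
  have "transpose A = - A"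
    by (simp add: A_def vec_eq_iff forall_3 transpose_def matrix_matrix_mult_def sum_3 algebra_simps)
  then obtain v where v: "A = ad v" using range_ad by (metis (mono_tags) mem_Collect_eq rangeE)
  have "p ** transpose p = mat 1"
    using assms by (simp add: rotation_matrix_def orthogonal_matrix_def)
  then have "p ** (transpose p ** Z) = Z" by (simp add: matrix_mul_assoc)
  moreover have "p ** A = (1/2) *\<^sub>R (p ** (transpose p ** Z) - p ** transpose Z ** p)"
    by (simp add: A_def vec_eq_iff forall_3 matrix_matrix_mult_def sum_3 algebra_simps)
  ultimately have "tan_proj p Z = p ** ad v" by (simp add: tan_proj_def v)
  then show ?thesis by blast
qed

lemma tan_proj_orthogonal:
  assumes "rotation_matrix p" shows "(Z - tan_proj p Z) \<bullet> (p ** ad v) = 0"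
proof -
  have pp: "transpose p ** p = mat 1"
    using assms by (simp add: rotation_matrix_def orthogonal_matrix_def)
  define B where "B = transpose p ** Z"
  have inv: "(p ** X) \<bullet> (p ** Y) = X \<bullet> Y" for X Y :: "real^3^3"
  proof -
    have "transpose (p ** X) ** (p ** Y) = transpose X ** (transpose p ** p) ** Y"
      by (simp only: matrix_transpose_mul matrix_mul_assoc)
    then show ?thesis by (simp add: inner_matrix_trace pp)
  qed
  have Z: "Z = p ** B"
    using assms
    by (simp add: B_def matrix_mul_assoc rotation_matrix_def orthogonal_matrix_def)
  have "p ** transpose (p ** B) ** p = p ** transpose B ** (transpose p ** p)"
    by (simp only: matrix_transpose_mul matrix_mul_assoc)
  then have "tan_proj p (p ** B) = (1/2) *\<^sub>R (p ** B - p ** transpose B)"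
    by (simp add: tan_proj_def pp)
  then have "Z - tan_proj p Z = (1/2) *\<^sub>R (p ** B + p ** transpose B)"
    unfolding Z[symmetric] by (simp add: vec_eq_iff)
  also have "\<dots> = p ** ((1/2) *\<^sub>R (B + transpose B))"
    by (simp add: vec_eq_iff forall_3 matrix_matrix_mult_def sum_3 algebra_simps)
  finally have "(Z - tan_proj p Z) \<bullet> (p ** ad v) = ((1/2) *\<^sub>R (B + transpose B)) \<bullet> ad v"
    using inv by simp
  also have "\<dots> = 0"
    by (simp add: ad_components inner_vec_def sum_3 transpose_def algebra_simps)
  finally show ?thesis .
qed

definition cov_deriv :: "real set \<Rightarrow> (real \<Rightarrow> real^3^3) \<Rightarrow> (real \<Rightarrow> real^3^3) \<Rightarrow> real \<Rightarrow> real^3^3" where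
  "cov_deriv S x Z = (\<lambda>t. tan_proj (x t) (vderiv S Z t))"

text \<open>Vector fields on \<open>SO(3)\<close> are given by extensions to the ambient space. At points of \<open>SO(3)\<close>
  the derivatives below are in directions tangent to \<open>SO(3)\<close>, so the choice of
  extension is immaterial.\<close>

definition nabla :: "(real^3^3 \<Rightarrow> real^3^3) \<Rightarrow> (real^3^3 \<Rightarrow> real^3^3) \<Rightarrow> real^3^3 \<Rightarrow> real^3^3" where
  "nabla X Y = (\<lambda>p. tan_proj p (frechet_derivative Y (at p) (X p)))"

definition field_bracket ::
    "(real^3^3 \<Rightarrow> real^3^3) \<Rightarrow> (real^3^3 \<Rightarrow> real^3^3) \<Rightarrow> real^3^3 \<Rightarrow> real^3^3" where
  "field_bracket X Y =
     (\<lambda>p. frechet_derivative Y (at p) (X p) - frechet_derivative X (at p) (Y p))"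

definition left_inv_field :: "real^3^3 \<Rightarrow> real^3^3 \<Rightarrow> real^3^3 \<Rightarrow> real^3^3" where
  "left_inv_field p u = (\<lambda>q. q ** (matrix_inv p ** u))"

text \<open>The curvature \<open>R(X,Y)Z = \<nabla>\<^sub>X\<nabla>\<^sub>YZ - \<nabla>\<^sub>Y\<nabla>\<^sub>XZ - \<nabla>\<^bsub>[X,Y]\<^esub>Z\<close>, a tensor, evaluated on
  tangent vectors by means of their left-invariant extensions.\<close>

definition curvature :: "real^3^3 \<Rightarrow> real^3^3 \<Rightarrow> real^3^3 \<Rightarrow> real^3^3 \<Rightarrow> real^3^3" where
  "curvature p u v w =
     (let X = left_inv_field p u; Y = left_inv_field p v; Z = left_inv_field p w
      in nabla X (nabla Y Z) p - nabla Y (nabla X Z) p - nabla (field_bracket X Y) Z p)"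

definition riemannian_cubic :: "real \<Rightarrow> real \<Rightarrow> (real \<Rightarrow> real^3^3) \<Rightarrow> bool" where
  "riemannian_cubic t0 t1 x \<longleftrightarrow>
     smooth_curve_on {t0..t1} x \<and> (\<forall>t\<in>{t0..t1}. rotation_matrix (x t)) \<and>
     (\<forall>t\<in>{t0..t1}.
        (cov_deriv {t0..t1} x ^^ 3) (vderiv {t0..t1} x) t
        + curvature (x t) (cov_deriv {t0..t1} x (vderiv {t0..t1} x) t)
            (vderiv {t0..t1} x t) (vderiv {t0..t1} x t) = 0)"

definition left_reduction :: "real \<Rightarrow> real \<Rightarrow> (real \<Rightarrow> real^3^3) \<Rightarrow> real \<Rightarrow> real^3^3" where
  "left_reduction t0 t1 x t = matrix_inv (x t) ** vderiv {t0..t1} x t"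

definition has_lie_quadratic ::
    "real \<Rightarrow> real \<Rightarrow> (real \<Rightarrow> real^3^3) \<Rightarrow> (real \<Rightarrow> real^3) \<Rightarrow> bool" where
  "has_lie_quadratic t0 t1 x U \<longleftrightarrow> (\<forall>t\<in>{t0..t1}. left_reduction t0 t1 x t = ad (U t))"

definition lie_quadratic_variation ::
    "real \<Rightarrow> real \<Rightarrow> (real \<Rightarrow> real \<Rightarrow> real^3) \<Rightarrow> real^3 \<Rightarrow> bool" where
  "lie_quadratic_variation t0 t1 V D \<longleftrightarrow>
     smooth2_on ({-1..1} \<times> {t0..t1}) V \<and>
     (\<forall>h\<in>{-1..1}. lie_quadratic t0 t1 (V h)) \<and>
     D \<noteq> 0 \<and> (\<forall>t\<in>{t0..t1}. V 0 t = D) \<and>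
     (\<exists>p q. \<forall>h\<in>{-1..1}. V h t0 = p + h *\<^sub>R q) \<and>
     (\<forall>h\<in>{-1..1}. norm (V h t0) \<le> 1)"

definition e_tilde :: "real \<Rightarrow> real \<Rightarrow> real^3 \<Rightarrow> real \<Rightarrow> real^3 \<Rightarrow> real^3" where
  "e_tilde t0 d F0 t = lin_exp (\<lambda>w. (- (d * (t - t0))) *\<^sub>R cross3 F0 w)"

definition adapted_frame :: "real^3 \<Rightarrow> real^3 \<Rightarrow> real^3 \<Rightarrow> real^3 \<Rightarrow> bool" where
  "adapted_frame D F0 F1 F2 \<longleftrightarrow>
     F0 = D /\<^sub>R norm D \<and>
     norm F0 = 1 \<and> norm F1 = 1 \<and> norm F2 = 1 \<and>
     F0 \<bullet> F1 = 0 \<and> F0 \<bullet> F2 = 0 \<and> F1 \<bullet> F2 = 0 \<and>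
     cross3 F0 F1 = F2 \<and> cross3 F2 F0 = F1"

definition first_order_data ::
    "real \<Rightarrow> real \<Rightarrow> (real \<Rightarrow> real \<Rightarrow> real^3) \<Rightarrow> real \<Rightarrow> real^3 \<Rightarrow> real \<Rightarrow> real \<Rightarrow> real
     \<Rightarrow> real^3 \<Rightarrow> real^3 \<Rightarrow> real^3 \<Rightarrow> bool" where
  "first_order_data t0 t1 V d F0 c0 c1 c2 A0 A1 B \<longleftrightarrow>
     F0 \<bullet> A0 = 0 \<and> F0 \<bullet> A1 = 0 \<and> F0 \<bullet> B = 0 \<and>
     (\<forall>t\<in>{t0..t1}. mixed_deriv t0 t1 1 0 V 0 t =
        (c0 + c1 * (t - t0) + c2 * (t - t0)^2) *\<^sub>R F0 + A0 + (t - t0) *\<^sub>R A1 + e_tilde t0 d F0 t B)"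

definition V_hat2 :: "real \<Rightarrow> real \<Rightarrow> (real \<Rightarrow> real \<Rightarrow> real^3) \<Rightarrow> real \<Rightarrow> real \<Rightarrow> real^3" where
  "V_hat2 t0 t1 V \<delta> t =
     V 0 t + \<delta> *\<^sub>R mixed_deriv t0 t1 1 0 V 0 t + (\<delta>^2 / 2) *\<^sub>R mixed_deriv t0 t1 2 0 V 0 t"

definition R_rot :: "real \<Rightarrow> real^3^3" where
  "R_rot r = vector [vector [cos r, sin r, 0], vector [- sin r, cos r, 0], vector [0, 0, 1]]"

definition S_mat :: "real^3 \<Rightarrow> real^3 \<Rightarrow> real^3^3" where
  "S_mat X1 X2 = (let g = sqrt ((norm X1)^2 * (norm X2)^2 - (X1 \<bullet> X2)^2) in
     vector [((norm X1)^2 *\<^sub>R X2 - (X1 \<bullet> X2) *\<^sub>R X1) /\<^sub>R (norm X1 * g),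
             cross3 X1 X2 /\<^sub>R g,
             X1 /\<^sub>R norm X1])"

definition T_curve :: "real \<Rightarrow> real \<Rightarrow> (real \<Rightarrow> real^3) \<Rightarrow> real \<Rightarrow> real^3^3" where
  "T_curve t0 t1 W t = S_mat (W t) (vderiv {t0..t1} W t)"

definition phi_hat ::
    "real \<Rightarrow> real \<Rightarrow> real \<Rightarrow> real \<Rightarrow> real \<Rightarrow> real \<Rightarrow> real \<Rightarrow> real \<Rightarrow> real \<Rightarrow> real" where
  "phi_hat t0 d c2 a11 a12 \<beta> \<gamma> \<delta> t = (let \<rho> = - 2 * c2 / (d^2 * \<beta>) in
     \<delta> * sqrt (\<rho>^2 + 1) *
       ((t - t0) * \<beta> +
        (a11 * (cos (\<gamma> - d * (t - t0)) - cos \<gamma>) + a12 * (sin (\<gamma> - d * (t - t0)) - sin \<gamma>)) / d^2))"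

definition y_hat ::
    "real \<Rightarrow> real \<Rightarrow> (real \<Rightarrow> real \<Rightarrow> real^3) \<Rightarrow> real \<Rightarrow> real \<Rightarrow> real \<Rightarrow> real \<Rightarrow> real \<Rightarrow> real \<Rightarrow> real
     \<Rightarrow> real \<Rightarrow> real^3^3" where
  "y_hat t0 t1 V d c2 a11 a12 \<beta> \<gamma> \<delta> t =
     R_rot (phi_hat t0 d c2 a11 a12 \<beta> \<gamma> \<delta> t)
     ** T_curve t0 t1 (nderiv {t0..t1} 2 (V_hat2 t0 t1 V \<delta>)) t"

definition x_hat ::
    "real \<Rightarrow> real \<Rightarrow> (real \<Rightarrow> real \<Rightarrow> real^3) \<Rightarrow> real \<Rightarrow> real \<Rightarrow> real \<Rightarrow> real \<Rightarrow> real \<Rightarrow> real \<Rightarrow> real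
     \<Rightarrow> real^3^3 \<Rightarrow> real \<Rightarrow> real^3^3" where
  "x_hat t0 t1 V d c2 a11 a12 \<beta> \<gamma> \<delta> p t =
     p ** transpose (y_hat t0 t1 V d c2 a11 a12 \<beta> \<gamma> \<delta> t0)
       ** y_hat t0 t1 V d c2 a11 a12 \<beta> \<gamma> \<delta> t"

text \<open>The constants of an \<open>O(\<delta>\<^sup>2)\<close> estimate, uniform over variations, involve the higher
  \<open>h\<close>-derivatives of \<open>V\<close>, which the data of \<open>V\<^sup>(\<^sup>1\<^sup>,\<^sup>0\<^sup>)(0,t)\<close> do not control. The bound \<open>M\<close>
  measures them and is no restriction on \<open>V\<close>: see \<open>variation_bound_exists\<close>. Two
  \<open>t\<close>-derivatives suffice because \<open>V\<^sup>(\<^sup>3\<^sup>) = [V\<^sup>(\<^sup>2\<^sup>), V]\<close>.\<close>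

definition variation_bound ::
    "real \<Rightarrow> real \<Rightarrow> (real \<Rightarrow> real \<Rightarrow> real^3) \<Rightarrow> real \<Rightarrow> bool" where
  "variation_bound t0 t1 V M \<longleftrightarrow>
     (\<forall>i\<le>3. \<forall>k\<le>2. \<forall>h\<in>{-1..1}. \<forall>t\<in>{t0..t1}. norm (mixed_deriv t0 t1 i k V h t) \<le> M)"

lemma vderiv_cong:
  assumes "\<And>s. s \<in> S \<Longrightarrow> f s = g s" "t \<in> S"
  shows "vderiv S f t = vderiv S g t"
proof -
  have "(f has_vector_derivative D) (at t within S) \<longleftrightarrow> (g has_vector_derivative D) (at t within S)" for D
    by (rule iffI; erule has_vector_derivative_transform[rotated 2]) (use assms in auto)
  then show ?thesis by (simp add: vderiv_def vector_derivative_def)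
qed

lemma Ck_on_vderiv:
  assumes "a0 < a1" "b0 < b1" "Ck_on (Suc k) ({a0..a1} \<times> {b0..b1}) f"
  shows "\<exists>g. Ck_on k ({a0..a1} \<times> {b0..b1}) g \<and>
           (\<forall>h\<in>{a0..a1}. \<forall>t\<in>{b0..b1}. vderiv {b0..b1} (\<lambda>s. f (h, s)) t = g (h, t))"
    and "\<exists>g. Ck_on k ({a0..a1} \<times> {b0..b1}) g \<and>
           (\<forall>h\<in>{a0..a1}. \<forall>t\<in>{b0..b1}. vderiv {a0..a1} (\<lambda>s. f (s, t)) h = g (h, t))"
proof -
  let ?S = "{a0..a1} \<times> {b0..b1}"
  obtain fh ft where d: "\<And>p. p \<in> ?S \<Longrightarrow>
      (f has_derivative (\<lambda>u. fst u *\<^sub>R fh p + snd u *\<^sub>R ft p)) (at p within ?S)"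
    and C: "Ck_on k ?S fh" "Ck_on k ?S ft"
    using assms(3) by auto
  have "vderiv {b0..b1} (\<lambda>s. f (h, s)) t = ft (h, t)"
    if ht: "h \<in> {a0..a1}" "t \<in> {b0..b1}" for h t
  proof -
    have "(f has_derivative (\<lambda>u. fst u *\<^sub>R fh (h, t) + snd u *\<^sub>R ft (h, t)))
            (at (h, t) within (\<lambda>s. (h, s)) ` {b0..b1})"
      by (rule has_derivative_subset[OF d]) (use ht in auto)
    moreover have "((\<lambda>s. (h, s)) has_derivative (\<lambda>s. (0, s))) (at t within {b0..b1})"
      by (auto intro!: derivative_eq_intros)
    ultimately have "((\<lambda>s. f (h, s)) has_vector_derivative ft (h, t)) (at t within {b0..b1})"
      using has_derivative_in_compose[of "\<lambda>s. (h, s)" "\<lambda>s. (0, s)" t "{b0..b1}" f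
          "\<lambda>u. fst u *\<^sub>R fh (h, t) + snd u *\<^sub>R ft (h, t)"]
      by (simp add: has_vector_derivative_def)
    then show ?thesis
      using vector_derivative_within_cbox[of b0 b1 t] assms(2) ht by (simp add: vderiv_def)
  qed
  then show "\<exists>g. Ck_on k ?S g \<and>
      (\<forall>h\<in>{a0..a1}. \<forall>t\<in>{b0..b1}. vderiv {b0..b1} (\<lambda>s. f (h, s)) t = g (h, t))"
    using C by blast
  have "vderiv {a0..a1} (\<lambda>s. f (s, t)) h = fh (h, t)"
    if ht: "h \<in> {a0..a1}" "t \<in> {b0..b1}" for h t
  proof -
    have "(f has_derivative (\<lambda>u. fst u *\<^sub>R fh (h, t) + snd u *\<^sub>R ft (h, t)))
            (at (h, t) within (\<lambda>s. (s, t)) ` {a0..a1})"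
      by (rule has_derivative_subset[OF d]) (use ht in auto)
    moreover have "((\<lambda>s. (s, t)) has_derivative (\<lambda>s. (s, 0))) (at h within {a0..a1})"
      by (auto intro!: derivative_eq_intros)
    ultimately have "((\<lambda>s. f (s, t)) has_vector_derivative fh (h, t)) (at h within {a0..a1})"
      using has_derivative_in_compose[of "\<lambda>s. (s, t)" "\<lambda>s. (s, 0)" h "{a0..a1}" f
          "\<lambda>u. fst u *\<^sub>R fh (h, t) + snd u *\<^sub>R ft (h, t)"]
      by (simp add: has_vector_derivative_def)
    then show ?thesis
      using vector_derivative_within_cbox[of a0 a1 h] assms(1) ht by (simp add: vderiv_def)
  qed
  then show "\<exists>g. Ck_on k ?S g \<and>
      (\<forall>h\<in>{a0..a1}. \<forall>t\<in>{b0..b1}. vderiv {a0..a1} (\<lambda>s. f (s, t)) h = g (h, t))"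
    using C by blast
qed

lemma Ck_on_mixed_deriv:
  assumes "t0 < t1" "Ck_on (k + i + j) ({-1..1} \<times> {t0..t1}) (\<lambda>p. V (fst p) (snd p))"
  shows "\<exists>g. Ck_on k ({-1..1} \<times> {t0..t1}) g \<and>
           (\<forall>h\<in>{-1..1}. \<forall>t\<in>{t0..t1}. mixed_deriv t0 t1 i j V h t = g (h, t))"
proof -
  have t: "\<exists>g. Ck_on m ({-1..1} \<times> {t0..t1}) g \<and>
      (\<forall>h\<in>{-1..1}. \<forall>t\<in>{t0..t1}. nderiv {t0..t1} j (V h) t = g (h, t))"
    if "Ck_on (m + j) ({-1..1} \<times> {t0..t1}) (\<lambda>p. V (fst p) (snd p))" for m
    using that
  proof (induction j arbitrary: m)
    case 0
    then show ?case by (auto simp: nderiv_def)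
  next
    case (Suc j)
    have "Ck_on (Suc m + j) ({-1..1} \<times> {t0..t1}) (\<lambda>p. V (fst p) (snd p))"
      using Suc.prems by (simp only: add_Suc_right add_Suc)
    then obtain g where g: "Ck_on (Suc m) ({-1..1} \<times> {t0..t1}) g"
      "\<And>h t. h \<in> {-1..1} \<Longrightarrow> t \<in> {t0..t1} \<Longrightarrow> nderiv {t0..t1} j (V h) t = g (h, t)"
      using Suc.IH by blast
    have "nderiv {t0..t1} (Suc j) (V h) t = vderiv {t0..t1} (\<lambda>s. g (h, s)) t"
      if "h \<in> {-1..1}" "t \<in> {t0..t1}" for h t
      using vderiv_cong[of "{t0..t1}" "nderiv {t0..t1} j (V h)" "\<lambda>s. g (h, s)" t] g(2) that
      by (simp add: nderiv_def)
    then show ?case using Ck_on_vderiv(1)[OF _ assms(1) g(1)] by simp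
  qed
  show ?thesis
    using assms(2)
  proof (induction i arbitrary: k)
    case 0
    then show ?case using t[of k] by (simp add: mixed_deriv_def nderiv_def[of _ 0])
  next
    case (Suc i)
    have "Ck_on (Suc k + i + j) ({-1..1} \<times> {t0..t1}) (\<lambda>p. V (fst p) (snd p))"
      using Suc.prems by (simp only: add_Suc_right add_Suc)
    then obtain g where g: "Ck_on (Suc k) ({-1..1} \<times> {t0..t1}) g"
      "\<And>h t. h \<in> {-1..1} \<Longrightarrow> t \<in> {t0..t1} \<Longrightarrow> mixed_deriv t0 t1 i j V h t = g (h, t)"
      using Suc.IH by blast
    have "mixed_deriv t0 t1 (Suc i) j V h t = vderiv {-1..1} (\<lambda>s. g (s, t)) h"
      if "h \<in> {-1..1}" "t \<in> {t0..t1}" for h t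
      using vderiv_cong[of "{-1..1}" "\<lambda>s. mixed_deriv t0 t1 i j V s t" "\<lambda>s. g (s, t)" h] g(2) that
      by (simp add: mixed_deriv_def nderiv_def[of _ "Suc i"] nderiv_def[of _ i])
    then show ?case using Ck_on_vderiv(2)[OF _ assms(1) g(1)] by simp
  qed
qed

lemma variation_bound_exists:
  assumes "t0 < t1" "smooth2_on ({-1..1} \<times> {t0..t1}) V"
  shows "\<exists>M. variation_bound t0 t1 V M"
proof -
  have "\<exists>M. \<forall>h\<in>{-1..1}. \<forall>t\<in>{t0..t1}. norm (mixed_deriv t0 t1 i k V h t) \<le> M" for i k
  proof -
    obtain g where g: "Ck_on 0 ({-1..1} \<times> {t0..t1}) g"
      "\<And>h t. h \<in> {-1..1} \<Longrightarrow> t \<in> {t0..t1} \<Longrightarrow> mixed_deriv t0 t1 i k V h t = g (h, t)"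
      using Ck_on_mixed_deriv[OF assms(1), of 0 i k V] assms(2) unfolding smooth2_on_def by blast
    then have "bounded (g ` ({-1..1} \<times> {t0..t1}))"
      by (intro compact_imp_bounded compact_continuous_image compact_Times) auto
    then obtain M where "\<forall>p\<in>{-1..1} \<times> {t0..t1}. norm (g p) \<le> M"
      by (auto simp: bounded_iff)
    then show ?thesis using g(2) by (intro exI[of _ M]) auto
  qed
  then obtain b where
    b: "\<And>i k. \<forall>h\<in>{-1..1}. \<forall>t\<in>{t0..t1}. norm (mixed_deriv t0 t1 i k V h t) \<le> b i k"
    by metis
  define M where "M = Max ((\<lambda>(i, k). b i k) ` ({..3} \<times> {..2}))"
  have "b i k \<le> M" if "i \<le> 3" "k \<le> 2" for i k
    unfolding M_def using that by (intro Max_ge) force+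
  then show ?thesis
    unfolding variation_bound_def using b by (meson order_trans)
qed

end

(* Let W be the second derivative of the Lie quadratic V_delta, so that W' = W x V and |W| is
   constant. The rows of T(W) form a moving frame r1, r2, r3 along W whose derivatives are
     r1' = r1 x V + s r2,   r2' = r2 x V - s r1,   r3' = r3 x V,
   where s = |W| <V', W'> / |W'|^2. A rotation in the r1-r2 plane by the angle -int s therefore turns T(W)
   into a solution of y' = y ad(V), the equation of the cubic itself. To leading order in delta,
   s is explicit and equals minus the derivative of phi_hat. Since T is homogeneous of degree zero
   and both W and V_hat_2'' have size delta, the O(delta^3) difference between them changes T by
   O(delta^2) only. Hence y_hat' = y_hat ad(V) + O(delta^2), and integrating x_hat x^T gives the claim.

   All estimates are made in C^infinity at once: "sm n f" says that all t-derivatives of a family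
   of curves are O(delta^n), uniformly over the admissible variations. The uniform constants are
   handled by a filter on the set of all admissible data. *)

theory Submission
  imports Defs
begin

section \<open>Vectors and matrices in dimension three\<close>

text \<open>Division by \<delta> shapes the proof. Since \<open>V 0\<close> is constant, the first
  and second t-derivatives of \<open>V \<delta>\<close> are only of size \<delta>, and a frame can
  be built from them uniformly only after rescaling, to \<open>v\<close> and \<open>w\<close>.
  Rescaling costs one order, which is why the Taylor polynomial in h must reach degree two. To
  leading order the squared norms of \<open>w\<close> and of its derivative are
  \<open>4 * c2^2 + d^4 * \<beta>^2\<close> and \<open>d^6 * \<beta>^2\<close>; they are positive
  because B is nonzero, so normalisation stays uniformly smooth. The rotation speed keeps one factor
  \<delta>, so its other factor is needed to first order only. The first h-derivative of V
  determines it there, which makes the angle explicit. The bound M stops at two t-derivatives. All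
  higher ones come from differential equations: V, its h-derivatives, the Taylor remainders, the
  cubic and even inverse square roots have derivatives expressible through quantities of the same
  regularity, so pointwise bounds propagate.\<close>

lemma bounded_bilinear_cross3: "bounded_bilinear cross3"
  using bilinear_cross bilinear_conv_bounded_bilinear by blast

lemma bounded_bilinear_matrix_mult3: "bounded_bilinear ((**) :: real^3^3 \<Rightarrow> real^3^3 \<Rightarrow> real^3^3)"
proof -
  have "bilinear ((**) :: real^3^3 \<Rightarrow> real^3^3 \<Rightarrow> real^3^3)"
    unfolding bilinear_def linear_iff
    by (auto simp: vec_eq_iff matrix_matrix_mult_def sum_3 algebra_simps)
  then show ?thesis using bilinear_conv_bounded_bilinear by blast
qed

lemma bounded_linear_transpose3: "bounded_linear (transpose :: real^3^3 \<Rightarrow> real^3^3)"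
proof -
  have "linear (transpose :: real^3^3 \<Rightarrow> real^3^3)"
    unfolding linear_iff by (auto simp: vec_eq_iff transpose_def)
  then show ?thesis using linear_conv_bounded_linear by blast
qed

lemma bounded_linear_ad: "bounded_linear ad"
proof -
  have "linear ad"
    unfolding linear_iff by (auto simp: vec_eq_iff forall_3 ad_components)
  then show ?thesis using linear_conv_bounded_linear by blast
qed

text \<open>Normalising \<open>f\<close> means scaling it by \<open>rsqrt (f \<bullet> f)\<close>,
  so only this scalar function has to be controlled. Its derivative is a multiple of its own cube,
  the form that a bootstrap over all derivatives needs.\<close>

definition rsqrt :: "real \<Rightarrow> real" where "rsqrt x = inverse (sqrt x)"

lemma rsqrt_deriv:
  assumes "x > 0" shows "(rsqrt has_real_derivative - (1/2) * rsqrt x ^ 3) (at x)"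
proof -
  have "sqrt x * sqrt x = x" "sqrt x > 0" using assms by auto
  then show ?thesis
    unfolding rsqrt_def using assms
    by (auto intro!: derivative_eq_intros simp: power3_eq_cube field_simps)
qed

text \<open>With \<open>a\<close>, \<open>b\<close> the square roots,
  \<open>x - y = (a - b) * (a + b)\<close>. Bounding \<open>a + b\<close> below by \<open>m\<close>
  instead of \<open>2 * m\<close> only doubles the constant.\<close>

lemma rsqrt_lipschitz:
  assumes "0 < c" "c \<le> x" "c \<le> y"
  shows "\<bar>rsqrt x - rsqrt y\<bar> \<le> rsqrt c ^ 3 * \<bar>x - y\<bar>"
proof -
  define a where "a = sqrt x" define b where "b = sqrt y" define m where "m = sqrt c"
  have m: "m > 0" "m \<le> a" "m \<le> b" using assms by (auto simp: a_def b_def m_def)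
  have xy: "x = a^2" "y = b^2" using assms by (auto simp: a_def b_def)
  have "x - y = (a - b) * (a + b)" by (simp add: xy power2_eq_square algebra_simps)
  then have "\<bar>x - y\<bar> = \<bar>a - b\<bar> * (a + b)" using m by (simp add: abs_mult)
  moreover have "\<bar>a - b\<bar> * (a + b) \<ge> \<bar>a - b\<bar> * m" using m by (intro mult_left_mono) auto
  ultimately have "\<bar>a - b\<bar> * m \<le> \<bar>x - y\<bar>" by simp
  then have 1: "\<bar>a - b\<bar> \<le> \<bar>x - y\<bar> / m" using m by (simp add: field_simps)
  have "\<bar>rsqrt x - rsqrt y\<bar> = \<bar>a - b\<bar> * (inverse a * inverse b)"
  proof -
    have "rsqrt x - rsqrt y = (b - a) * (inverse a * inverse b)"
      unfolding rsqrt_def a_def[symmetric] b_def[symmetric] using m by (simp add: field_simps)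
    then show ?thesis using m by (simp add: abs_mult)
  qed
  also have "\<dots> \<le> (\<bar>x - y\<bar> / m) * (inverse m * inverse m)"
    using m 1 by (intro mult_mono) (auto simp: le_imp_inverse_le)
  finally show ?thesis
    by (simp add: rsqrt_def m_def[symmetric] power3_eq_cube field_simps)
qed

lemma rsqrt_bound: "0 < c \<Longrightarrow> c \<le> x \<Longrightarrow> 0 < rsqrt x \<and> rsqrt x \<le> rsqrt c"
  by (auto simp: rsqrt_def intro!: le_imp_inverse_le)

text \<open>Placing a vector in a fixed row is bounded linear. With \<open>vector3_sum\<close>, the
  rules for sums and linear maps then carry over to matrices given by their rows.\<close>

lemma bounded_linear_row:
  "bounded_linear (\<lambda>a::real^3. vector [a, 0, 0] :: real^3^3)"
  "bounded_linear (\<lambda>a::real^3. vector [0, a, 0] :: real^3^3)"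
  "bounded_linear (\<lambda>a::real^3. vector [0, 0, a] :: real^3^3)"
  unfolding linear_conv_bounded_linear[symmetric] linear_iff
  by (auto simp: vec_eq_iff forall_3)

lemma vector3_sum: "(vector [a, b, c] :: real^3^3) = vector [a,0,0] + (vector [0,b,0] + vector [0,0,c])"
  by (simp add: vec_eq_iff forall_3)

lemma has_vector_derivative_cross3:
  assumes "(f has_vector_derivative f') (at t within S)" "(g has_vector_derivative g') (at t within S)"
  shows "((\<lambda>t. cross3 (f t) (g t)) has_vector_derivative (cross3 (f t) g' + cross3 f' (g t))) (at t within S)"
  using bounded_bilinear.has_vector_derivative[OF bounded_bilinear_cross3 assms] .

text \<open>The plane spanned by \<open>F1\<close> and \<open>F2\<close> is identified with the complex numbers, where
  \<open>- \<theta> ad F0\<close> is multiplication by \<open>- \<i> \<theta>\<close>.\<close>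

lemma e_tilde_rotation:
  assumes "cross3 F0 F1 = F2" "cross3 F2 F0 = F1"
  shows "e_tilde t0 d F0 t (\<beta> *\<^sub>R (cos \<gamma> *\<^sub>R F1 + sin \<gamma> *\<^sub>R F2)) =
    \<beta> *\<^sub>R (cos (\<gamma> - d * (t - t0)) *\<^sub>R F1 + sin (\<gamma> - d * (t - t0)) *\<^sub>R F2)"
proof -
  define \<theta> where "\<theta> = d * (t - t0)"
  define \<phi> where "\<phi> z = Re z *\<^sub>R F1 + Im z *\<^sub>R F2" for z
  define L where "L = (\<lambda>w. (- \<theta>) *\<^sub>R cross3 F0 w)"
  define z where "z = complex_of_real \<beta> * cis \<gamma>"
  have bl: "bounded_linear \<phi>"
    unfolding \<phi>_def by (intro bounded_linear_intros bounded_linear_Re bounded_linear_Im)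
  have F02: "cross3 F0 F2 = - F1" using assms(2) cross_skew by metis
  have L: "L (\<phi> z) = \<phi> ((- \<i> * complex_of_real \<theta>) * z)" for z
    by (simp add: L_def \<phi>_def cross_add_right cross_mult_right assms F02 algebra_simps)
  have Ln: "(L ^^ n) (\<phi> z) = \<phi> ((- \<i> * complex_of_real \<theta>) ^ n * z)" for n z
    by (induction n) (simp_all add: L mult.assoc)
  have "(\<lambda>n. ((- \<i> * complex_of_real \<theta>) ^ n /\<^sub>R fact n) * z) sums (exp (- \<i> * complex_of_real \<theta>) * z)"
    by (intro sums_mult2 exp_converges)
  then have "(\<lambda>n. \<phi> (((- \<i> * complex_of_real \<theta>) ^ n /\<^sub>R fact n) * z)) sums \<phi> (exp (- \<i> * complex_of_real \<theta>) * z)"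
    by (rule bounded_linear.sums[OF bl])
  moreover have "\<phi> (((- \<i> * complex_of_real \<theta>) ^ n /\<^sub>R fact n) * z) = (1 / fact n) *\<^sub>R (L ^^ n) (\<phi> z)" for n
    using linear_scale[OF bounded_linear.linear[OF bl], of "1 / fact n" "(- \<i> * complex_of_real \<theta>) ^ n * z"]
    by (simp add: Ln scaleR_conv_of_real field_simps)
  ultimately have "lin_exp L (\<phi> z) = \<phi> (exp (- \<i> * complex_of_real \<theta>) * z)"
    unfolding lin_exp_def by (simp add: sums_iff)
  moreover have "exp (- \<i> * complex_of_real \<theta>) * z = \<beta> * cis (\<gamma> - \<theta>)"
    by (simp add: z_def cis_conv_exp exp_add[symmetric] algebra_simps)
  moreover have "\<phi> z = \<beta> *\<^sub>R (cos \<gamma> *\<^sub>R F1 + sin \<gamma> *\<^sub>R F2)"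
    by (simp add: \<phi>_def z_def algebra_simps)
  moreover have "\<phi> (\<beta> * cis (\<gamma> - \<theta>)) = \<beta> *\<^sub>R (cos (\<gamma> - \<theta>) *\<^sub>R F1 + sin (\<gamma> - \<theta>) *\<^sub>R F2)"
    by (simp add: \<phi>_def algebra_simps)
  ultimately show ?thesis by (simp add: e_tilde_def L_def \<theta>_def)
qed

text \<open>\<open>cross3 w v\<close> is orthogonal to \<open>w\<close>, and for nonzero
  \<open>w\<close> and \<open>p\<close> that plane is spanned by \<open>p\<close> and
  \<open>cross3 w p\<close>. The coefficient of \<open>cross3 w p\<close> becomes the rotation speed
  of the frame in \<open>der_r1\<close>.\<close>

lemma cross3_decomp:
  assumes "w \<bullet> p = 0"
  shows "(p \<bullet> p) *\<^sub>R cross3 w v = (p \<bullet> cross3 w v) *\<^sub>R p + (v \<bullet> p) *\<^sub>R cross3 w p"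
proof -
  have "cross3 p (cross3 (cross3 w v) p) = (p \<bullet> p) *\<^sub>R cross3 w v - (p \<bullet> cross3 w v) *\<^sub>R p"
    by (simp add: Lagrange)
  moreover have "cross3 (cross3 w v) p = - (v \<bullet> p) *\<^sub>R w"
  proof -
    have "cross3 (cross3 w v) p = (w \<bullet> p) *\<^sub>R v - (v \<bullet> p) *\<^sub>R w"
      by (simp add: cross3_def inner_vec_def vec_eq_iff forall_3 sum_3 algebra_simps)
    then show ?thesis using assms by simp
  qed
  moreover have "cross3 p (- (v \<bullet> p) *\<^sub>R w) = (v \<bullet> p) *\<^sub>R cross3 w p"
    by (simp add: cross3_def vec_eq_iff forall_3 algebra_simps)
  ultimately show ?thesis by (metis add.commute diff_eq_eq)
qed

lemma cross3_unit:
  assumes "a \<bullet> a = 1" "a \<bullet> b = 0"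
  shows "cross3 a (cross3 a b) = - b" "cross3 (cross3 a b) a = b"
proof -
  show "cross3 a (cross3 a b) = - b" using assms by (simp add: Lagrange)
  then show "cross3 (cross3 a b) a = b" by (metis cross_skew minus_minus)
qed

text \<open>The Jacobi identity: crossing with \<open>X\<close> is a derivation of the cross
  product. So if two vectors solve \<open>r' = cross3 r X\<close>, their cross product does
  too.\<close>

lemma cross3_derivation:
  "cross3 a (cross3 b X) + cross3 (cross3 a X) b = cross3 (cross3 a b) X"
  by (simp add: cross3_def vec_eq_iff forall_3 algebra_simps)

lemma rsqrt_sq: "s > 0 \<Longrightarrow> rsqrt s * rsqrt s * s = 1"
  by (simp add: rsqrt_def field_simps)

lemma rsqrt_mult: "rsqrt (a * b) = rsqrt a * rsqrt b"
  by (simp add: rsqrt_def real_sqrt_mult)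

lemma sqrt_eq_rsqrt: "s \<ge> 0 \<Longrightarrow> s * rsqrt s = sqrt s"
  by (cases "s = 0") (simp_all add: rsqrt_def field_simps)

lemma R_rot_rows:
  "R_rot \<phi> ** vector [a, b, c] = vector [cos \<phi> *\<^sub>R a + sin \<phi> *\<^sub>R b, cos \<phi> *\<^sub>R b - sin \<phi> *\<^sub>R a, c]"
  by (simp add: R_rot_def vec_eq_iff forall_3 matrix_matrix_mult_def sum_3)

text \<open>Thus \<open>y' = y ** ad X\<close> says that every row of \<open>y\<close> solves
  \<open>r' = cross3 r X\<close>.\<close>

lemma rows_mult_ad:
  "(vector [a, b, c] :: real^3^3) ** ad X = vector [cross3 a X, cross3 b X, cross3 c X]"
  by (simp add: ad_components vec_eq_iff forall_3 matrix_matrix_mult_def sum_3 cross3_def algebra_simps)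

lemma transpose_ad: "transpose (ad X) = - ad X"
  using range_ad by auto

lemma rotation_transpose:
  assumes "rotation_matrix p" shows "transpose p ** p = mat 1" "p ** transpose p = mat 1"
  using assms by (auto simp: rotation_matrix_def orthogonal_matrix_def)

lemma invertible_matrix_inv: "invertible A \<Longrightarrow> A ** matrix_inv A = mat 1"
  unfolding invertible_def matrix_inv_def by (rule conjunct1[OF someI_ex])

text \<open>The Frobenius norm of a rotation is \<open>sqrt 3\<close>, rounded up to 2.\<close>

lemma norm_rotation: assumes "rotation_matrix (p :: real^3^3)" shows "norm p \<le> 2"
proof -
  have "(norm p)\<^sup>2 = 3"
    unfolding power2_norm_eq_inner inner_matrix_trace rotation_transpose(1)[OF assms]
    by (simp add: trace_def mat_def sum_3)
  then show ?thesis using power2_le_imp_le[of "norm p" 2] by simp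
qed

text \<open>The radicand is the squared norm of \<open>cross3 X1 X2\<close>, and the numerator of
  the first row is a double cross product. All rows therefore come from two normalised vectors, and
  estimates for normalisation suffice.\<close>

lemma S_mat_eq:
  assumes "norm (cross3 X1 X2) > 0"
  defines "q3 \<equiv> X1 /\<^sub>R norm X1" and "q2 \<equiv> cross3 X1 X2 /\<^sub>R norm (cross3 X1 X2)"
  shows "S_mat X1 X2 = vector [cross3 q2 q3, q2, q3]"
proof -
  have g: "sqrt ((norm X1)\<^sup>2 * (norm X2)\<^sup>2 - (X1 \<bullet> X2)\<^sup>2) = norm (cross3 X1 X2)"
    using norm_cross[of X1 X2] by (metis norm_ge_zero real_sqrt_unique)
  have "cross3 (cross3 X1 X2) X1 = (norm X1)\<^sup>2 *\<^sub>R X2 - (X1 \<bullet> X2) *\<^sub>R X1"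
    unfolding power2_norm_eq_inner
    by (simp add: cross3_def inner_vec_def vec_eq_iff forall_3 sum_3 algebra_simps)
  then have "((norm X1)\<^sup>2 *\<^sub>R X2 - (X1 \<bullet> X2) *\<^sub>R X1) /\<^sub>R (norm X1 * norm (cross3 X1 X2)) = cross3 q2 q3"
    by (simp add: q2_def q3_def cross_mult_left cross_mult_right)
  then show ?thesis unfolding S_mat_def g Let_def q2_def q3_def by simp
qed

lemma S_mat_scale:
  assumes "c > 0" shows "S_mat (c *\<^sub>R X1) (c *\<^sub>R X2) = S_mat X1 X2"
proof -
  have g: "sqrt ((norm (c *\<^sub>R X1))\<^sup>2 * (norm (c *\<^sub>R X2))\<^sup>2 - (c *\<^sub>R X1 \<bullet> c *\<^sub>R X2)\<^sup>2)
      = c\<^sup>2 * sqrt ((norm X1)\<^sup>2 * (norm X2)\<^sup>2 - (X1 \<bullet> X2)\<^sup>2)"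
  proof -
    have "(norm (c *\<^sub>R X1))\<^sup>2 * (norm (c *\<^sub>R X2))\<^sup>2 - (c *\<^sub>R X1 \<bullet> c *\<^sub>R X2)\<^sup>2
        = (c\<^sup>2)\<^sup>2 * ((norm X1)\<^sup>2 * (norm X2)\<^sup>2 - (X1 \<bullet> X2)\<^sup>2)"
      by (simp add: power2_eq_square algebra_simps)
    then show ?thesis by (simp only: real_sqrt_mult real_sqrt_abs) simp
  qed
  have c: "(norm (c *\<^sub>R X1))\<^sup>2 *\<^sub>R c *\<^sub>R X2 - (c *\<^sub>R X1 \<bullet> c *\<^sub>R X2) *\<^sub>R c *\<^sub>R X1
      = c ^ 3 *\<^sub>R ((norm X1)\<^sup>2 *\<^sub>R X2 - (X1 \<bullet> X2) *\<^sub>R X1)"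
    by (simp add: power2_eq_square power3_eq_cube algebra_simps)
  show ?thesis
    unfolding S_mat_def g c Let_def using assms
    by (simp add: cross_mult_left cross_mult_right power2_eq_square power3_eq_cube field_simps)
qed

section \<open>Families of curves of order \<open>\<delta>\<^sup>n\<close>\<close>

lemma nderiv_Suc: "nderiv S (Suc j) f = vderiv S (nderiv S j f)"
  by (simp add: nderiv_def)

lemma vderiv_eqI:
  "a < b \<Longrightarrow> t \<in> {a..b} \<Longrightarrow> (f has_vector_derivative f') (at t within {a..b}) \<Longrightarrow>
    vderiv {a..b} f t = f'"
  using vector_derivative_within_cbox[of a b t f f'] by (simp add: vderiv_def)

text \<open>An index stands for one complete set of data. A constant obtained along \<open>F\<close>
  does not depend on the index, which is the uniformity wanted; the interval is common to all
  indices.\<close>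

locale small_family =
  fixes F :: "'i filter" and \<delta> :: "'i \<Rightarrow> real" and t0 t1 :: real
  assumes t01: "t0 < t1" and lim: "filterlim \<delta> (at_right 0) F"
begin

definition bnd :: "nat \<Rightarrow> ('i \<Rightarrow> real \<Rightarrow> 'a::real_normed_vector) \<Rightarrow> bool" where
  "bnd n f \<longleftrightarrow> (\<exists>C. \<forall>\<^sub>F i in F. \<forall>t\<in>{t0..t1}. norm (f i t) \<le> C * \<delta> i ^ n)"

definition der :: "('i \<Rightarrow> real \<Rightarrow> 'a::real_normed_vector) \<Rightarrow> ('i \<Rightarrow> real \<Rightarrow> 'a) \<Rightarrow> bool" where
  "der f f' \<longleftrightarrow> (\<forall>\<^sub>F i in F. \<forall>t\<in>{t0..t1}. (f i has_vector_derivative f' i t) (at t within {t0..t1}))"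

definition agree :: "('i \<Rightarrow> real \<Rightarrow> 'a) \<Rightarrow> ('i \<Rightarrow> real \<Rightarrow> 'a) \<Rightarrow> bool" where
  "agree f g \<longleftrightarrow> (\<forall>\<^sub>F i in F. \<forall>t\<in>{t0..t1}. f i t = g i t)"

text \<open>Finitely many derivatives at a time, so that level k for the right side of a
  differential equation gives level k+1 for the solution. By \<open>der_unique\<close> the
  quantified derivative is determined up to \<open>agree\<close>.\<close>

primrec ordk :: "nat \<Rightarrow> nat \<Rightarrow> ('i \<Rightarrow> real \<Rightarrow> 'a::real_normed_vector) \<Rightarrow> bool" where
  "ordk 0 n f \<longleftrightarrow> bnd n f"
| "ordk (Suc k) n f \<longleftrightarrow> bnd n f \<and> (\<exists>f'. der f f' \<and> ordk k n f')"

definition sm :: "nat \<Rightarrow> ('i \<Rightarrow> real \<Rightarrow> 'a::real_normed_vector) \<Rightarrow> bool" where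
  "sm n f \<longleftrightarrow> (\<forall>k. ordk k n f)"

lemma small: "e > 0 \<Longrightarrow> \<forall>\<^sub>F i in F. 0 < \<delta> i \<and> \<delta> i < e"
  using lim eventually_at_right_real[of 0 e] unfolding filterlim_iff by (auto elim!: allE)

lemma pos: "\<forall>\<^sub>F i in F. 0 < \<delta> i"
  using small[of 1] by (auto elim: eventually_mono)

lemma bndI: "\<forall>\<^sub>F i in F. \<forall>t\<in>{t0..t1}. norm (f i t) \<le> C * \<delta> i ^ n \<Longrightarrow> bnd n f"
  unfolding bnd_def by blast

lemma bndE:
  assumes "bnd n f"
  obtains C where "C > 0" "\<forall>\<^sub>F i in F. \<forall>t\<in>{t0..t1}. norm (f i t) \<le> C * \<delta> i ^ n"
proof -
  obtain C where C: "\<forall>\<^sub>F i in F. \<forall>t\<in>{t0..t1}. norm (f i t) \<le> C * \<delta> i ^ n"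
    using assms by (auto simp: bnd_def)
  have "\<forall>\<^sub>F i in F. \<forall>t\<in>{t0..t1}. norm (f i t) \<le> (\<bar>C\<bar> + 1) * \<delta> i ^ n"
    using C pos
  proof eventually_elim
    case (elim i)
    have "C * \<delta> i ^ n \<le> (\<bar>C\<bar> + 1) * \<delta> i ^ n"
      using elim by (intro mult_right_mono) auto
    then show ?case using elim(1) by (meson order_trans)
  qed
  then show ?thesis using that[of "\<bar>C\<bar> + 1"] by simp
qed

lemma agree_refl: "agree f f" by (simp add: agree_def)
lemma agree_sym: "agree f g \<Longrightarrow> agree g f" by (simp add: agree_def eq_commute)

lemma agreeI: "(\<And>i t. f i t = g i t) \<Longrightarrow> agree f g" by (simp add: agree_def)

lemma bnd_cong: "agree f g \<Longrightarrow> bnd n f \<Longrightarrow> bnd n g"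
proof -
  assume ag: "agree f g" and "bnd n f"
  then obtain C where C: "\<forall>\<^sub>F i in F. \<forall>t\<in>{t0..t1}. norm (f i t) \<le> C * \<delta> i ^ n"
    by (auto simp: bnd_def)
  have "\<forall>\<^sub>F i in F. \<forall>t\<in>{t0..t1}. norm (g i t) \<le> C * \<delta> i ^ n"
    using C ag unfolding agree_def by eventually_elim auto
  then show ?thesis by (rule bndI)
qed

lemma der_cong:
  assumes "agree f g" "agree f' g'" "der f f'"
  shows "der g g'"
  using assms unfolding agree_def der_def
proof eventually_elim
  case (elim i)
  show ?case
  proof
    fix t assume t: "t \<in> {t0..t1}"
    have "(f i has_vector_derivative g' i t) (at t within {t0..t1})"
      using elim t by metis
    then show "(g i has_vector_derivative g' i t) (at t within {t0..t1})"
      by (rule has_vector_derivative_transform[rotated 2]) (use elim t in auto)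
  qed
qed

lemma ordk_cong: "agree f g \<Longrightarrow> ordk k n f \<Longrightarrow> ordk k n g"
  by (cases k) (auto intro: bnd_cong der_cong[OF _ agree_refl])

lemma sm_cong: "agree f g \<Longrightarrow> sm n f \<Longrightarrow> sm n g"
  unfolding sm_def by (blast intro: ordk_cong)

lemma der_unique:
  assumes "der f f'" "der f f''" shows "agree f' f''"
  using assms unfolding agree_def der_def
  by eventually_elim (metis t01 atLeastAtMost_iff box_real(2) vector_derivative_unique_within_closed_interval)

lemma sm_bnd: "sm n f \<Longrightarrow> bnd n f"
  unfolding sm_def using ordk.simps(1) by blast

lemma sm_der:
  assumes "sm n f" "der f f'" shows "sm n f'"
  unfolding sm_def
proof
  fix k
  have "ordk (Suc k) n f" using assms by (simp only: sm_def)
  then obtain g where g: "der f g" "ordk k n g" by auto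
  then show "ordk k n f'" using der_unique[OF g(1) assms(2)] ordk_cong by blast
qed

lemma sm_obtain_der: assumes "sm n f" obtains f' where "der f f'" "sm n f'"
proof -
  have "ordk (Suc 0) n f" using assms by (simp only: sm_def)
  then obtain g where g: "der f g" by auto
  then show ?thesis using that sm_der[OF assms] by blast
qed

lemma smI: "bnd n f \<Longrightarrow> der f f' \<Longrightarrow> sm n f' \<Longrightarrow> sm n f"
  unfolding sm_def
proof
  fix k assume "bnd n f" "der f f'" "\<forall>k. ordk k n f'"
  then show "ordk k n f" by (cases k) auto
qed

lemma ordk_SucD: "ordk (Suc k) n f \<Longrightarrow> ordk k n f"
  by (induction k arbitrary: f) auto

text \<open>A bootstrap: if the derivative of a family is as regular as the family itself, then
  pointwise bounds propagate to all derivatives.\<close>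

lemma sm_ode:
  assumes "bnd n f" "der f f'" "\<And>k. ordk k n f \<Longrightarrow> ordk k n f'"
  shows "sm n f"
  unfolding sm_def
proof
  fix k show "ordk k n f" by (induction k) (use assms in auto)
qed

lemma bnd_mono: "m \<le> n \<Longrightarrow> bnd n f \<Longrightarrow> bnd m f"
proof -
  assume mn: "m \<le> n" "bnd n f"
  obtain C where C: "C > 0" "\<forall>\<^sub>F i in F. \<forall>t\<in>{t0..t1}. norm (f i t) \<le> C * \<delta> i ^ n"
    using bndE[OF mn(2)] .
  show ?thesis
  proof (rule bndI[where C=C])
    show "\<forall>\<^sub>F i in F. \<forall>t\<in>{t0..t1}. norm (f i t) \<le> C * \<delta> i ^ m"
      using C(2) small[of 1, simplified]
    proof eventually_elim
      case (elim i)
      have "C * \<delta> i ^ n \<le> C * \<delta> i ^ m"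
        using elim C mn(1) by (intro mult_left_mono power_decreasing) auto
      then show ?case using elim(1) by (meson order_trans)
    qed
  qed
qed

lemma ordk_mono: "m \<le> n \<Longrightarrow> ordk k n f \<Longrightarrow> ordk k m f"
  by (induction k arbitrary: f) (auto intro: bnd_mono)

lemma sm_mono: "m \<le> n \<Longrightarrow> sm n f \<Longrightarrow> sm m f"
  by (auto simp: sm_def intro: ordk_mono)

section \<open>Differentiation rules and the algebra of orders\<close>

lemma der_linear: "bounded_linear L \<Longrightarrow> der f f' \<Longrightarrow> der (\<lambda>i t. L (f i t)) (\<lambda>i t. L (f' i t))"
  unfolding der_def
  by (auto elim!: eventually_mono intro: bounded_linear.has_vector_derivative)

lemma der_add: "der f f' \<Longrightarrow> der g g' \<Longrightarrow> der (\<lambda>i t. f i t + g i t) (\<lambda>i t. f' i t + g' i t)"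
  unfolding der_def
  by (erule (1) eventually_elim2) (auto intro!: has_vector_derivative_add)

lemma der_diff: "der f f' \<Longrightarrow> der g g' \<Longrightarrow> der (\<lambda>i t. f i t - g i t) (\<lambda>i t. f' i t - g' i t)"
  unfolding der_def
  by (erule (1) eventually_elim2) (auto intro!: has_vector_derivative_diff)

lemma der_bilinear:
  "bounded_bilinear B \<Longrightarrow> der f f' \<Longrightarrow> der g g' \<Longrightarrow>
    der (\<lambda>i t. B (f i t) (g i t)) (\<lambda>i t. B (f i t) (g' i t) + B (f' i t) (g i t))"
  unfolding der_def
  by (erule (1) eventually_elim2) (auto intro!: bounded_bilinear.has_vector_derivative)

lemma der_const: "der (\<lambda>i t. c i) (\<lambda>i t. 0)"
  by (simp add: der_def)

lemma bnd_linear: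
  assumes "bounded_linear L" "bnd n f" shows "bnd n (\<lambda>i t. L (f i t))"
proof -
  obtain C where C: "C > 0" "\<forall>\<^sub>F i in F. \<forall>t\<in>{t0..t1}. norm (f i t) \<le> C * \<delta> i ^ n"
    using bndE[OF assms(2)] .
  obtain K where K: "K > 0" "\<And>x. norm (L x) \<le> norm x * K"
    using bounded_linear.pos_bounded[OF assms(1)] by blast
  have "\<forall>\<^sub>F i in F. \<forall>t\<in>{t0..t1}. norm (L (f i t)) \<le> (C * K) * \<delta> i ^ n"
    using C(2)
  proof eventually_elim
    case (elim i)
    show ?case
    proof
      fix t assume "t \<in> {t0..t1}"
      then have "norm (f i t) * K \<le> (C * \<delta> i ^ n) * K" using elim K by (intro mult_right_mono) auto
      then show "norm (L (f i t)) \<le> (C * K) * \<delta> i ^ n"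
        using K(2)[of "f i t"] by (simp add: mult_ac)
    qed
  qed
  then show ?thesis by (rule bndI)
qed

lemma bnd_add:
  assumes "bnd n f" "bnd n g" shows "bnd n (\<lambda>i t. f i t + g i t)"
proof -
  obtain C where C: "C > 0" "\<forall>\<^sub>F i in F. \<forall>t\<in>{t0..t1}. norm (f i t) \<le> C * \<delta> i ^ n"
    using bndE[OF assms(1)] .
  obtain K where K: "K > 0" "\<forall>\<^sub>F i in F. \<forall>t\<in>{t0..t1}. norm (g i t) \<le> K * \<delta> i ^ n"
    using bndE[OF assms(2)] .
  have "\<forall>\<^sub>F i in F. \<forall>t\<in>{t0..t1}. norm (f i t + g i t) \<le> (C + K) * \<delta> i ^ n"
    using C(2) K(2)
    by eventually_elim (auto simp: distrib_right intro: norm_triangle_le add_mono)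
  then show ?thesis by (rule bndI)
qed

lemma bnd_bilinear:
  assumes "bounded_bilinear B" "bnd m f" "bnd n g" shows "bnd (m + n) (\<lambda>i t. B (f i t) (g i t))"
proof -
  obtain C where C: "C > 0" "\<forall>\<^sub>F i in F. \<forall>t\<in>{t0..t1}. norm (f i t) \<le> C * \<delta> i ^ m"
    using bndE[OF assms(2)] .
  obtain K where K: "K > 0" "\<forall>\<^sub>F i in F. \<forall>t\<in>{t0..t1}. norm (g i t) \<le> K * \<delta> i ^ n"
    using bndE[OF assms(3)] .
  obtain L where L: "L > 0" "\<And>x y. norm (B x y) \<le> norm x * norm y * L"
    using bounded_bilinear.pos_bounded[OF assms(1)] by blast
  have "\<forall>\<^sub>F i in F. \<forall>t\<in>{t0..t1}. norm (B (f i t) (g i t)) \<le> (C * K * L) * \<delta> i ^ (m + n)"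
    using C(2) K(2) pos
  proof eventually_elim
    case (elim i)
    show ?case
    proof
      fix t assume t: "t \<in> {t0..t1}"
      have "norm (f i t) * norm (g i t) * L \<le> (C * \<delta> i ^ m) * (K * \<delta> i ^ n) * L"
        using elim t L C K by (intro mult_right_mono mult_mono) auto
      then show "norm (B (f i t) (g i t)) \<le> (C * K * L) * \<delta> i ^ (m + n)"
        using L(2)[of "f i t" "g i t"] by (simp add: mult_ac power_add)
    qed
  qed
  then show ?thesis by (rule bndI)
qed

lemma ordk_linear:
  "bounded_linear L \<Longrightarrow> ordk k n f \<Longrightarrow> ordk k n (\<lambda>i t. L (f i t))"
  by (induction k arbitrary: f) (auto intro: bnd_linear der_linear)

lemma ordk_add:
  "ordk k n f \<Longrightarrow> ordk k n g \<Longrightarrow> ordk k n (\<lambda>i t. f i t + g i t)"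
  by (induction k arbitrary: f g) (auto intro: bnd_add der_add)

lemma ordk_diff:
  "ordk k n f \<Longrightarrow> ordk k n g \<Longrightarrow> ordk k n (\<lambda>i t. f i t - g i t)"
  using ordk_add[of k n f "\<lambda>i t. - g i t"]
    ordk_linear[of "\<lambda>x. - x" k n g] by (simp add: bounded_linear_minus bounded_linear_ident)

lemma ordk_bilinear:
  assumes "bounded_bilinear B"
  shows "ordk k m f \<Longrightarrow> ordk k n g \<Longrightarrow> ordk k (m + n) (\<lambda>i t. B (f i t) (g i t))"
proof (induction k arbitrary: f g)
  case 0 then show ?case using bnd_bilinear[OF assms] by simp
next
  case (Suc k)
  from Suc.prems obtain f' g' where *: "der f f'" "ordk k m f'" "der g g'" "ordk k n g'"
    "bnd m f" "bnd n g" by auto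
  have "ordk k m f" "ordk k n g" using Suc.prems ordk_SucD by auto
  then have "ordk k (m + n) (\<lambda>i t. B (f i t) (g' i t) + B (f' i t) (g i t))"
    using * Suc.IH by (intro ordk_add) auto
  then show ?case
    using * bnd_bilinear[OF assms] der_bilinear[OF assms *(1,3)] by auto
qed

lemma sm_linear: "bounded_linear L \<Longrightarrow> sm n f \<Longrightarrow> sm n (\<lambda>i t. L (f i t))"
  by (auto simp: sm_def intro: ordk_linear)
lemma sm_add: "sm n f \<Longrightarrow> sm n g \<Longrightarrow> sm n (\<lambda>i t. f i t + g i t)"
  by (auto simp: sm_def intro: ordk_add)
lemma sm_diff: "sm n f \<Longrightarrow> sm n g \<Longrightarrow> sm n (\<lambda>i t. f i t - g i t)"
  by (auto simp: sm_def intro: ordk_diff)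
lemma sm_bilinear:
  "bounded_bilinear B \<Longrightarrow> sm m f \<Longrightarrow> sm n g \<Longrightarrow> sm (m + n) (\<lambda>i t. B (f i t) (g i t))"
  by (auto simp: sm_def intro: ordk_bilinear)

text \<open>The zero family is its own derivative, so the bootstrap applies to it.\<close>

lemma sm_zero: "sm n (\<lambda>i t. 0)"
proof (rule sm_ode)
  show "bnd n (\<lambda>i t. 0)" by (rule bndI[of _ 0]) simp
qed (rule der_const)

lemma sm_const: "bnd n (\<lambda>i t. c i) \<Longrightarrow> sm n (\<lambda>i t. c i)"
  by (rule smI[OF _ der_const sm_zero])

lemma sm_const': "sm 0 (\<lambda>i t. c)"
  by (rule sm_const, rule bndI[of _ "norm c"]) simp

lemma sm_scale: "sm n (\<lambda>i t. \<delta> i ^ n)"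
  by (rule sm_const, rule bndI[of _ 1]) (use pos in \<open>auto elim: eventually_mono\<close>)

lemma sm_delta: "sm (Suc 0) (\<lambda>i t. \<delta> i)"
  using sm_scale[of 1] by simp

text \<open>\<delta> does not depend on t, so dividing by it commutes with t-differentiation and
  costs exactly one order at every level.\<close>

lemma sm_unscale:
  fixes f :: "'i \<Rightarrow> real \<Rightarrow> 'a::real_normed_vector"
  assumes "sm (Suc n) f" shows "sm n (\<lambda>i t. f i t /\<^sub>R \<delta> i)"
proof -
    have *: "bnd (Suc n) f \<Longrightarrow> bnd n (\<lambda>i t. f i t /\<^sub>R \<delta> i)" for f :: "'i \<Rightarrow> real \<Rightarrow> 'a"
    proof -
      assume "bnd (Suc n) f"
      then obtain C where C: "C > 0" "\<forall>\<^sub>F i in F. \<forall>t\<in>{t0..t1}. norm (f i t) \<le> C * \<delta> i ^ Suc n"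
        by (rule bndE)
      have "\<forall>\<^sub>F i in F. \<forall>t\<in>{t0..t1}. norm (f i t /\<^sub>R \<delta> i) \<le> C * \<delta> i ^ n"
        using C(2) pos by eventually_elim (auto simp: field_simps)
      then show ?thesis by (rule bndI)
    qed
  have "ordk k (Suc n) f \<Longrightarrow> ordk k n (\<lambda>i t. f i t /\<^sub>R \<delta> i)" for k and f :: "'i \<Rightarrow> real \<Rightarrow> 'a"
  proof (induction k arbitrary: f)
    case 0 then show ?case using * by simp
  next
    case (Suc k)
    then obtain f' where f': "der f f'" "ordk k (Suc n) f'" "bnd (Suc n) f" by auto
    have "der (\<lambda>i t. f i t /\<^sub>R \<delta> i) (\<lambda>i t. f' i t /\<^sub>R \<delta> i)"
      using f'(1) unfolding der_def
      by (auto elim!: eventually_mono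
          intro: bounded_linear.has_vector_derivative[OF bounded_linear_scaleR_right])
    then show ?case using f' Suc.IH * by auto
  qed
  then show ?thesis using assms by (simp add: sm_def)
qed

lemma sm_nderiv:
  assumes "sm n f" shows "sm n (\<lambda>i. nderiv {t0..t1} j (f i))"
proof (induction j)
  case 0 then show ?case using assms by (simp add: nderiv_def)
next
  case (Suc j)
  obtain g where g: "der (\<lambda>i. nderiv {t0..t1} j (f i)) g" "sm n g"
    using sm_obtain_der[OF Suc] .
  have "agree g (\<lambda>i. nderiv {t0..t1} (Suc j) (f i))"
    using g(1) unfolding der_def agree_def
    by eventually_elim
      (use t01 in \<open>auto simp: nderiv_Suc vderiv_eqI\<close>)
  then show ?case using g sm_cong by blast
qed

text \<open>\<open>nderiv\<close> is a total function and splits over differences only where the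
  derivatives exist; the \<open>sm\<close> assumptions supply existence at every level.\<close>

lemma nderiv_diff_eventually:
  assumes "sm m f" "sm n g"
  shows "agree (\<lambda>i. nderiv {t0..t1} j (\<lambda>t. f i t - g i t))
      (\<lambda>i t. nderiv {t0..t1} j (f i) t - nderiv {t0..t1} j (g i) t)"
proof (induction j)
  case 0 then show ?case by (simp add: agree_def nderiv_def)
next
  case (Suc j)
  obtain f' where f': "der (\<lambda>i. nderiv {t0..t1} j (f i)) f'"
    using sm_obtain_der[OF sm_nderiv[OF assms(1)]] .
  obtain g' where g': "der (\<lambda>i. nderiv {t0..t1} j (g i)) g'"
    using sm_obtain_der[OF sm_nderiv[OF assms(2)]] .
  have d: "der (\<lambda>i. nderiv {t0..t1} j (\<lambda>t. f i t - g i t)) (\<lambda>i t. f' i t - g' i t)"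
    by (rule der_cong[OF agree_sym[OF Suc] agree_refl der_diff[OF f' g']])
  show ?case
    using f' g' d unfolding der_def agree_def
    by eventually_elim (auto simp: nderiv_Suc, smt (verit) vderiv_eqI t01 atLeastAtMost_iff)
qed

text \<open>The mean value inequality bounds the family itself, at the cost of a factor
  \<open>t1 - t0\<close>; its higher derivatives are those of \<open>f'\<close>.\<close>

lemma sm_int:
  assumes "der f f'" "sm n f'" "\<forall>\<^sub>F i in F. f i t0 = 0"
  shows "sm n f"
proof (rule smI[OF _ assms(1,2)])
  obtain C where C: "C > 0" "\<forall>\<^sub>F i in F. \<forall>t\<in>{t0..t1}. norm (f' i t) \<le> C * \<delta> i ^ n"
    using bndE[OF sm_bnd[OF assms(2)]] .
  have "\<forall>\<^sub>F i in F. \<forall>t\<in>{t0..t1}. norm (f i t) \<le> (C * (t1 - t0)) * \<delta> i ^ n"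
    using C(2) assms(1,3) pos unfolding der_def
  proof eventually_elim
    case (elim i)
    show ?case
    proof
      fix t assume t: "t \<in> {t0..t1}"
      have "norm (f i t - f i t0) \<le> (C * \<delta> i ^ n) * norm (t - t0)"
      proof (rule differentiable_bound[of "{t0..t1}"])
        fix s assume s: "s \<in> {t0..t1}"
        show "(f i has_derivative (\<lambda>h. h *\<^sub>R f' i s)) (at s within {t0..t1})"
          using elim s by (simp add: has_vector_derivative_def)
        show "onorm (\<lambda>h. h *\<^sub>R f' i s) \<le> C * \<delta> i ^ n"
        proof (rule onorm_le)
          fix h :: real show "norm (h *\<^sub>R f' i s) \<le> (C * \<delta> i ^ n) * norm h"
            using elim s by (simp add: mult.commute mult_left_mono)
        qed
      qed (use t t01 in auto)
      also have "\<dots> \<le> (C * \<delta> i ^ n) * (t1 - t0)"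
        using t elim C by (intro mult_left_mono) auto
      finally show "norm (f i t) \<le> (C * (t1 - t0)) * \<delta> i ^ n"
        using elim by (simp add: mult_ac)
    qed
  qed
  then show "bnd n f" by (rule bndI)
qed

lemmas sm_mult = sm_bilinear[OF bounded_bilinear_mult]
lemmas sm_scaleR = sm_bilinear[OF bounded_bilinear_scaleR]
lemmas sm_inner = sm_bilinear[OF bounded_bilinear_inner]
lemmas sm_cross = sm_bilinear[OF bounded_bilinear_cross3]
lemmas sm_mat = sm_bilinear[OF bounded_bilinear_matrix_mult3]

lemmas sm_order0_intros = sm_add sm_diff
  sm_mult[where m=0 and n=0, simplified] sm_scaleR[where m=0 and n=0, simplified]
  sm_inner[where m=0 and n=0, simplified] sm_cross[where m=0 and n=0, simplified]
  sm_mat[where m=0 and n=0, simplified] sm_const'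

lemma sm_order0: "sm n f \<Longrightarrow> sm 0 f" by (rule sm_mono[of 0 n]) simp

lemma smD: "sm n f \<Longrightarrow> ordk k n f" by (simp add: sm_def)

lemma ordk_cross_l: "ordk k n f \<Longrightarrow> sm 0 g \<Longrightarrow> ordk k n (\<lambda>i t. cross3 (f i t) (g i t))"
  using ordk_bilinear[OF bounded_bilinear_cross3, of k n f 0 g] by (simp add: sm_def)
lemma ordk_cross_r: "sm 0 f \<Longrightarrow> ordk k n g \<Longrightarrow> ordk k n (\<lambda>i t. cross3 (f i t) (g i t))"
  using ordk_bilinear[OF bounded_bilinear_cross3, of k 0 f n g] by (simp add: sm_def)

lemma der_scale: "der f f' \<Longrightarrow> der (\<lambda>i t. c i *\<^sub>R f i t) (\<lambda>i t. c i *\<^sub>R f' i t)"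
  unfolding der_def
  by (auto elim!: eventually_mono intro: bounded_linear.has_vector_derivative[OF bounded_linear_scaleR_right])

lemma sm_half_delta: "sm 1 (\<lambda>i t. \<delta> i / 2)"
  using sm_linear[OF bounded_linear_divide sm_delta, of 2] by simp

section \<open>Closeness of two families to a given order\<close>

definition close :: "nat \<Rightarrow> ('i \<Rightarrow> real \<Rightarrow> 'a::real_normed_vector) \<Rightarrow> ('i \<Rightarrow> real \<Rightarrow> 'a) \<Rightarrow> bool" where
  "close n f g \<longleftrightarrow> sm 0 f \<and> sm 0 g \<and> sm n (\<lambda>i t. f i t - g i t)"

lemma closeD: "close n f g \<Longrightarrow> sm 0 f" "close n f g \<Longrightarrow> sm 0 g"
  "close n f g \<Longrightarrow> sm n (\<lambda>i t. f i t - g i t)"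
  by (auto simp: close_def)

lemma closeI: "sm 0 g \<Longrightarrow> sm n (\<lambda>i t. f i t - g i t) \<Longrightarrow> close n f g"
  using sm_add[of 0 "\<lambda>i t. f i t - g i t" g] sm_mono[of 0 n "\<lambda>i t. f i t - g i t"]
  by (simp add: close_def)

lemma close_refl: "sm 0 f \<Longrightarrow> close n f f"
  by (simp add: close_def sm_zero)

lemma close_cong: "agree f f' \<Longrightarrow> agree g g' \<Longrightarrow> close n f g \<Longrightarrow> close n f' g'"
  unfolding close_def
proof (intro conjI; (elim conjE)?)
  assume a: "agree f f'" "agree g g'" and s: "sm n (\<lambda>i t. f i t - g i t)"
  have "agree (\<lambda>i t. f i t - g i t) (\<lambda>i t. f' i t - g' i t)"
    using a unfolding agree_def by eventually_elim auto
  then show "sm n (\<lambda>i t. f' i t - g' i t)" using s sm_cong by blast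
qed (auto intro: sm_cong)

lemma close_mono: "m \<le> n \<Longrightarrow> close n f g \<Longrightarrow> close m f g"
  by (auto simp: close_def intro: sm_mono)

lemma close_linear: "bounded_linear L \<Longrightarrow> close n f g \<Longrightarrow> close n (\<lambda>i t. L (f i t)) (\<lambda>i t. L (g i t))"
  unfolding close_def
  using sm_linear[of L n "\<lambda>i t. f i t - g i t"]
  by (auto intro: sm_linear simp: linear_diff[OF bounded_linear.linear])

lemma close_add:
  "close n f g \<Longrightarrow> close n f' g' \<Longrightarrow> close n (\<lambda>i t. f i t + f' i t) (\<lambda>i t. g i t + g' i t)"
  unfolding close_def
  using sm_add[of n "\<lambda>i t. f i t - g i t" "\<lambda>i t. f' i t - g' i t"]
  by (simp only: sm_add add_diff_add simp_thms)

text \<open>The difference of the products splits as \<open>B (f - g) f' + B g (f' - g')\<close>.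
  Hence \<open>close\<close> demands order 0 of both families besides a small difference.\<close>

lemma close_bilinear:
  assumes B: "bounded_bilinear B" and "close n f g" "close n f' g'"
  shows "close n (\<lambda>i t. B (f i t) (f' i t)) (\<lambda>i t. B (g i t) (g' i t))"
proof -
  note s = assms(2,3)[unfolded close_def]
  interpret bounded_bilinear B by fact
  have "sm n (\<lambda>i t. B (f i t - g i t) (f' i t) + B (g i t) (f' i t - g' i t))"
    using s sm_bilinear[OF B, of n "\<lambda>i t. f i t - g i t" 0 f']
      sm_bilinear[OF B, of 0 g n "\<lambda>i t. f' i t - g' i t"] by (auto intro: sm_add)
  moreover have "B (f i t - g i t) (f' i t) + B (g i t) (f' i t - g' i t) = B (f i t) (f' i t) - B (g i t) (g' i t)"
    for i t by (simp add: diff_left diff_right)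
  ultimately show ?thesis
    using s sm_bilinear[OF B, of 0 f 0 f'] sm_bilinear[OF B, of 0 g 0 g'] by (simp add: close_def)
qed

lemmas close_mult = close_bilinear[OF bounded_bilinear_mult]
lemmas close_scaleR = close_bilinear[OF bounded_bilinear_scaleR]
lemmas close_inner = close_bilinear[OF bounded_bilinear_inner]
lemmas close_cross = close_bilinear[OF bounded_bilinear_cross3]

lemma close_der:
  assumes "close n f g" "der f f'" "der g g'" shows "close n f' g'"
  using assms der_diff[OF assms(2,3)] unfolding close_def by (auto intro: sm_der)

section \<open>Lower bounds, inverse square roots and normalisation\<close>

definition low :: "('i \<Rightarrow> real \<Rightarrow> real) \<Rightarrow> bool" where
  "low f \<longleftrightarrow> (\<exists>c>0. \<forall>\<^sub>F i in F. \<forall>t\<in>{t0..t1}. c \<le> f i t)"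

text \<open>A difference of order at least one is eventually below half of the lower bound of
  \<open>g\<close>; the \<open>Suc\<close> rules out order 0.\<close>

lemma low_close:
  assumes "close (Suc n) f g" "low g" shows "low f"
proof -
  obtain c where c: "c > 0" "\<forall>\<^sub>F i in F. \<forall>t\<in>{t0..t1}. c \<le> g i t"
    using assms(2) by (auto simp: low_def)
  have c1: "close 1 f g" using assms(1) by (rule close_mono[rotated]) simp
  obtain C where C: "C > 0" "\<forall>\<^sub>F i in F. \<forall>t\<in>{t0..t1}. norm (f i t - g i t) \<le> C * \<delta> i ^ 1"
    using bndE[OF sm_bnd[OF closeD(3)[OF c1]]] .
  have "\<forall>\<^sub>F i in F. 0 < \<delta> i \<and> \<delta> i < c / (2 * C)" using c C by (intro small) auto
  then have "\<forall>\<^sub>F i in F. \<forall>t\<in>{t0..t1}. c / 2 \<le> f i t"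
    using c(2) C(2)
  proof eventually_elim
    case (elim i)
    have "C * \<delta> i \<le> c / 2" using elim(1) C(1) by (simp add: field_simps)
    then show ?case using elim(2,3) by (smt (verit, best) power_one_right real_norm_def field_sum_of_halves)
  qed
  then show ?thesis unfolding low_def using c by (intro exI[of _ "c/2"]) auto
qed

text \<open>The cube is written as a nested product so that the multiplication rules for
  \<open>ordk\<close> match it.\<close>

lemma der_rsqrt:
  assumes "der s s'" "low s"
  shows "der (\<lambda>i t. rsqrt (s i t)) (\<lambda>i t. - (1/2) * ((rsqrt (s i t) * (rsqrt (s i t) * rsqrt (s i t))) * s' i t))"
proof -
  obtain c where c: "c > 0" "\<forall>\<^sub>F i in F. \<forall>t\<in>{t0..t1}. c \<le> s i t"
    using assms(2) by (auto simp: low_def)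
  show ?thesis
    using c(2) assms(1) unfolding der_def
  proof eventually_elim
    case (elim i)
    show ?case
    proof
      fix t assume t: "t \<in> {t0..t1}"
      have "((\<lambda>t. rsqrt (s i t)) has_real_derivative (- (1/2) * rsqrt (s i t) ^ 3) * s' i t) (at t within {t0..t1})"
        by (rule DERIV_chain2[OF rsqrt_deriv])
          (use elim c t in \<open>auto simp: has_real_derivative_iff_has_vector_derivative intro: less_le_trans\<close>)
      then show "((\<lambda>t. rsqrt (s i t)) has_vector_derivative
          - (1/2) * ((rsqrt (s i t) * (rsqrt (s i t) * rsqrt (s i t))) * s' i t)) (at t within {t0..t1})"
        by (simp add: has_real_derivative_iff_has_vector_derivative power3_eq_cube mult_ac)
    qed
  qed
qed

lemma ordk_mult0: "ordk k m f \<Longrightarrow> ordk k 0 g \<Longrightarrow> ordk k m (\<lambda>i t. f i t * g i t :: real)"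
  using ordk_bilinear[OF bounded_bilinear_mult, of k m f 0 g] by simp
lemma ordk_0mult: "ordk k 0 f \<Longrightarrow> ordk k m g \<Longrightarrow> ordk k m (\<lambda>i t. f i t * g i t :: real)"
  using ordk_bilinear[OF bounded_bilinear_mult, of k 0 f m g] by simp

lemma sm_rsqrt:
  assumes "sm 0 s" "low s" shows "sm 0 (\<lambda>i t. rsqrt (s i t))"
proof -
  obtain s' where s': "der s s'" "sm 0 s'" using sm_obtain_der[OF assms(1)] .
  obtain c where c: "c > 0" "\<forall>\<^sub>F i in F. \<forall>t\<in>{t0..t1}. c \<le> s i t"
    using assms(2) by (auto simp: low_def)
  have "\<forall>\<^sub>F i in F. \<forall>t\<in>{t0..t1}. norm (rsqrt (s i t)) \<le> rsqrt c * \<delta> i ^ 0"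
    using c(2) by eventually_elim (use c rsqrt_bound in fastforce)
  then have b: "bnd 0 (\<lambda>i t. rsqrt (s i t))" by (rule bndI)
  show ?thesis
    by (rule sm_ode[OF b der_rsqrt[OF s'(1) assms(2)]])
      (intro ordk_mult0 ordk_0mult ordk_linear[OF bounded_linear_mult_right]; use s'(2) in \<open>simp add: sm_def\<close>)
qed

text \<open>The base estimate is \<open>rsqrt_lipschitz\<close>. With \<open>p\<close>,
  \<open>q\<close> the two inverse roots, the derivative of \<open>p - q\<close> is -1/2 times
  \<open>(p^3 - q^3) * s' + q^3 * (s' - u')\<close>. Factoring \<open>p - q\<close> out of the
  difference of cubes leaves a linear equation for \<open>p - q\<close> with an inhomogeneity of
  order n, and the bootstrap applies.\<close>

lemma close_rsqrt:
  assumes "close n s u" "low s" "low u" shows "close n (\<lambda>i t. rsqrt (s i t)) (\<lambda>i t. rsqrt (u i t))"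
proof -
  have s0: "sm 0 s" "sm 0 u" using assms closeD by auto
  obtain s' where s': "der s s'" "sm 0 s'" using sm_obtain_der[OF s0(1)] .
  obtain u' where u': "der u u'" "sm 0 u'" using sm_obtain_der[OF s0(2)] .
  have r: "sm 0 (\<lambda>i t. rsqrt (s i t))" "sm 0 (\<lambda>i t. rsqrt (u i t))"
    using sm_rsqrt s0 assms by auto
  have su: "sm n (\<lambda>i t. s' i t - u' i t)" using close_der[OF assms(1) s'(1) u'(1)] closeD by blast
  obtain c e where c: "c > 0" "\<forall>\<^sub>F i in F. \<forall>t\<in>{t0..t1}. c \<le> s i t" "e > 0" "\<forall>\<^sub>F i in F. \<forall>t\<in>{t0..t1}. e \<le> u i t"
    using assms(2,3) unfolding low_def by blast
  define m where "m = min c e"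
  have m: "m > 0" "m \<le> c" "m \<le> e" using c by (auto simp: m_def)
  obtain C where C: "C > 0" "\<forall>\<^sub>F i in F. \<forall>t\<in>{t0..t1}. norm (s i t - u i t) \<le> C * \<delta> i ^ n"
    using bndE[OF sm_bnd[OF closeD(3)[OF assms(1)]]] .
  have "\<forall>\<^sub>F i in F. \<forall>t\<in>{t0..t1}. norm (rsqrt (s i t) - rsqrt (u i t)) \<le> (rsqrt m ^ 3 * C) * \<delta> i ^ n"
    using c(2,4) C(2)
  proof eventually_elim
    case (elim i)
    show ?case
    proof
      fix t assume t: "t \<in> {t0..t1}"
      have "\<bar>rsqrt (s i t) - rsqrt (u i t)\<bar> \<le> rsqrt m ^ 3 * \<bar>s i t - u i t\<bar>"
        using m elim t by (intro rsqrt_lipschitz) force+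
      also have "\<dots> \<le> rsqrt m ^ 3 * (C * \<delta> i ^ n)"
        using elim t rsqrt_bound[of m m] m by (intro mult_left_mono) auto
      finally show "norm (rsqrt (s i t) - rsqrt (u i t)) \<le> (rsqrt m ^ 3 * C) * \<delta> i ^ n"
        by simp
    qed
  qed
  then have b: "bnd n (\<lambda>i t. rsqrt (s i t) - rsqrt (u i t))" by (rule bndI)
  let ?p = "\<lambda>i t. rsqrt (s i t)" and ?q = "\<lambda>i t. rsqrt (u i t)"
  have d: "der (\<lambda>i t. ?p i t - ?q i t)
     (\<lambda>i t. - (1/2) * (((?p i t - ?q i t) * (?p i t * ?p i t + (?p i t * ?q i t + ?q i t * ?q i t))) * s' i t
         + (?q i t * (?q i t * ?q i t)) * (s' i t - u' i t)))"
    by (rule der_cong[OF agree_refl _ der_diff[OF der_rsqrt[OF s'(1) assms(2)] der_rsqrt[OF u'(1) assms(3)]]])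
      (rule agreeI, simp add: algebra_simps)
  have "sm n (\<lambda>i t. ?p i t - ?q i t)"
    by (rule sm_ode[OF b d], intro ordk_linear[OF bounded_linear_mult_right] ordk_add,
       intro ordk_mult0 ordk_add)
      (use r s' su in \<open>auto simp: sm_def intro!: ordk_0mult\<close>)
  then show ?thesis using r by (simp add: close_def)
qed

definition nrm :: "('i \<Rightarrow> real \<Rightarrow> 'a::real_inner) \<Rightarrow> 'i \<Rightarrow> real \<Rightarrow> 'a" where
  "nrm f = (\<lambda>i t. rsqrt (f i t \<bullet> f i t) *\<^sub>R f i t)"

lemma nrm_eq: "nrm f i t = f i t /\<^sub>R norm (f i t)"
  by (simp add: nrm_def rsqrt_def norm_eq_sqrt_inner)

lemma close_nrm:
  assumes "close n f g" "low (\<lambda>i t. f i t \<bullet> f i t)" "low (\<lambda>i t. g i t \<bullet> g i t)"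
  shows "close n (nrm f) (nrm g)"
  unfolding nrm_def using assms by (intro close_scaleR close_rsqrt close_inner)

text \<open>Cosine and sine are bounded for every angle and differentiate into each other, so only
  the derivative of the angle is constrained and the induction treats both together.\<close>

lemma sm_cos_sin:
  fixes \<theta> :: "'i \<Rightarrow> real \<Rightarrow> real"
  assumes "der \<theta> \<theta>'" "sm 0 \<theta>'"
  shows "sm 0 (\<lambda>i t. cos (\<theta> i t))" "sm 0 (\<lambda>i t. sin (\<theta> i t))"
proof -
  have c: "((\<lambda>t. cos (f t)) has_vector_derivative (- f') * sin (f t)) (at t within T)"
    "((\<lambda>t. sin (f t)) has_vector_derivative f' * cos (f t)) (at t within T)"
    if "(f has_vector_derivative f') (at t within T)" for f :: "real \<Rightarrow> real" and f' t :: real and T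
    using DERIV_chain2[OF DERIV_cos, of f f' t T] DERIV_chain2[OF DERIV_sin, of f f' t T] that
    by (simp_all add: has_real_derivative_iff_has_vector_derivative mult.commute)
  have d1: "der (\<lambda>i t. cos (\<theta> i t)) (\<lambda>i t. (- \<theta>' i t) * sin (\<theta> i t))"
    using assms(1) unfolding der_def by eventually_elim (use c(1) in blast)
  have d2: "der (\<lambda>i t. sin (\<theta> i t)) (\<lambda>i t. \<theta>' i t * cos (\<theta> i t))"
    using assms(1) unfolding der_def by eventually_elim (use c(2) in blast)
  have b: "bnd 0 (\<lambda>i t. cos (\<theta> i t))" "bnd 0 (\<lambda>i t. sin (\<theta> i t))"
    by (rule bndI[of _ 1]; simp)+
  have t: "ordk k 0 \<theta>'" "ordk k 0 (\<lambda>i t. - \<theta>' i t)" for k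
    using assms(2) sm_linear[OF bounded_linear_minus[OF bounded_linear_ident], of 0 \<theta>'] by (auto simp: sm_def)
  have "ordk k 0 (\<lambda>i t. cos (\<theta> i t)) \<and> ordk k 0 (\<lambda>i t. sin (\<theta> i t))" for k
  proof (induction k)
    case (Suc k)
    then show ?case using d1 d2 b ordk_mult0[OF t(1)] ordk_mult0[OF t(2)] by auto
  qed (use b in auto)
  then show "sm 0 (\<lambda>i t. cos (\<theta> i t))" "sm 0 (\<lambda>i t. sin (\<theta> i t))" by (auto simp: sm_def)
qed

lemma close_rows:
  assumes "close n a a'" "close n b b'" "close n c c'"
  shows "close n (\<lambda>i t. vector [a i t, b i t, c i t] :: real^3^3) (\<lambda>i t. vector [a' i t, b' i t, c' i t])"
  using close_add[OF close_linear[OF bounded_linear_row(1) assms(1)]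
      close_add[OF close_linear[OF bounded_linear_row(2) assms(2)]
        close_linear[OF bounded_linear_row(3) assms(3)]]]
  by (simp only: vector3_sum[symmetric])

lemma low_pos: "low f \<Longrightarrow> \<forall>\<^sub>F i in F. \<forall>t\<in>{t0..t1}. 0 < f i t"
  unfolding low_def by (auto elim!: eventually_mono intro: less_le_trans)

lemma low_agree: "agree f g \<Longrightarrow> low f \<Longrightarrow> low g"
proof -
  assume ag: "agree f g" and "low f"
  then obtain c where c: "c > 0" "\<forall>\<^sub>F i in F. \<forall>t\<in>{t0..t1}. c \<le> f i t"
    by (auto simp: low_def)
  have "\<forall>\<^sub>F i in F. \<forall>t\<in>{t0..t1}. c \<le> g i t"
    using c(2) ag unfolding agree_def by eventually_elim auto
  then show ?thesis using c(1) by (auto simp: low_def)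
qed

lemma low_const: "c > 0 \<Longrightarrow> low (\<lambda>i t. c)"
  by (auto simp: low_def)

lemma low_mult: assumes "low f" "low g" shows "low (\<lambda>i t. f i t * g i t)"
proof -
  obtain c e where c: "c > 0" "\<forall>\<^sub>F i in F. \<forall>t\<in>{t0..t1}. c \<le> f i t" "e > 0" "\<forall>\<^sub>F i in F. \<forall>t\<in>{t0..t1}. e \<le> g i t"
    using assms unfolding low_def by blast
  have "\<forall>\<^sub>F i in F. \<forall>t\<in>{t0..t1}. c * e \<le> f i t * g i t"
    using c(2,4)
  proof eventually_elim
    case (elim i)
    then show ?case using c by (auto intro!: mult_mono intro: order_trans[OF less_imp_le])
  qed
  then show ?thesis using c unfolding low_def by (intro exI[of _ "c * e"]) auto
qed

lemma der_nrm:
  assumes "der f f'" "low (\<lambda>i t. f i t \<bullet> f i t)"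
  shows "der (nrm f) (\<lambda>i t. rsqrt (f i t \<bullet> f i t) *\<^sub>R f' i t
    - (rsqrt (f i t \<bullet> f i t) ^ 3 * (f i t \<bullet> f' i t)) *\<^sub>R f i t)"
  unfolding nrm_def
  by (rule der_cong[OF agree_refl _ der_bilinear[OF bounded_bilinear_scaleR
        der_rsqrt[OF der_bilinear[OF bounded_bilinear_inner assms(1) assms(1)] assms(2)] assms(1)]])
    (rule agreeI, simp add: inner_commute power3_eq_cube algebra_simps)

lemma der_rows:
  assumes "der a a'" "der b b'" "der c c'"
  shows "der (\<lambda>i t. vector [a i t, b i t, c i t] :: real^3^3) (\<lambda>i t. vector [a' i t, b' i t, c' i t])"
  using der_add[OF der_linear[OF bounded_linear_row(1) assms(1)]
      der_add[OF der_linear[OF bounded_linear_row(2) assms(2)]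
        der_linear[OF bounded_linear_row(3) assms(3)]]]
  by (simp only: vector3_sum[symmetric])

lemma sm_rows:
  assumes "sm n a" "sm n b" "sm n c"
  shows "sm n (\<lambda>i t. vector [a i t, b i t, c i t] :: real^3^3)"
  using sm_add[OF sm_linear[OF bounded_linear_row(1) assms(1)]
      sm_add[OF sm_linear[OF bounded_linear_row(2) assms(2)]
        sm_linear[OF bounded_linear_row(3) assms(3)]]]
  by (simp only: vector3_sum[symmetric])

lemma vderiv_agree: "der f f' \<Longrightarrow> agree (\<lambda>i. vderiv {t0..t1} (f i)) f'"
  unfolding der_def agree_def by (erule eventually_mono) (auto intro: vderiv_eqI[OF t01])

lemma agree_vderiv: "agree f g \<Longrightarrow> agree (\<lambda>i. vderiv {t0..t1} (f i)) (\<lambda>i. vderiv {t0..t1} (g i))"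
  unfolding agree_def by (erule eventually_mono) (auto intro: vderiv_cong)

lemma agree_trans: "agree f g \<Longrightarrow> agree g h \<Longrightarrow> agree f h"
  unfolding agree_def by (erule (1) eventually_elim2) simp

lemma nderiv_close:
  assumes "close n f g"
  obtains C where "\<forall>\<^sub>F i in F. \<forall>t\<in>{t0..t1}.
    norm (nderiv {t0..t1} j (f i) t - nderiv {t0..t1} j (g i) t) \<le> C * \<delta> i ^ n"
proof -
  obtain C where C: "C > 0" "\<forall>\<^sub>F i in F. \<forall>t\<in>{t0..t1}. norm (nderiv {t0..t1} j (\<lambda>t. f i t - g i t) t) \<le> C * \<delta> i ^ n"
    using bndE[OF sm_bnd[OF sm_nderiv[OF closeD(3)[OF assms], of j]]] .
  have "\<forall>\<^sub>F i in F. \<forall>t\<in>{t0..t1}.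
    norm (nderiv {t0..t1} j (f i) t - nderiv {t0..t1} j (g i) t) \<le> C * \<delta> i ^ n"
    using C(2) nderiv_diff_eventually[OF closeD(1)[OF assms] closeD(2)[OF assms], of j]
    unfolding agree_def by eventually_elim simp
  then show ?thesis using that by blast
qed

end

section \<open>Mixed partial derivatives\<close>

lemma Ck_on_partials:
  assumes "Ck_on (Suc k) (A \<times> B) g"
  obtains gh gt where "Ck_on k (A \<times> B) gh" "Ck_on k (A \<times> B) gt"
    "\<And>h t. h \<in> A \<Longrightarrow> t \<in> B \<Longrightarrow> ((\<lambda>h. g (h, t)) has_vector_derivative gh (h, t)) (at h within A)"
    "\<And>h t. h \<in> A \<Longrightarrow> t \<in> B \<Longrightarrow> ((\<lambda>t. g (h, t)) has_vector_derivative gt (h, t)) (at t within B)"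
proof -
  let ?S = "A \<times> B"
  obtain fh ft where d: "\<And>p. p \<in> ?S \<Longrightarrow>
      (g has_derivative (\<lambda>u. fst u *\<^sub>R fh p + snd u *\<^sub>R ft p)) (at p within ?S)"
    and C: "Ck_on k ?S fh" "Ck_on k ?S ft"
    using assms by auto
  have 1: "((\<lambda>s. g (h, s)) has_vector_derivative ft (h, t)) (at t within B)"
    if ht: "h \<in> A" "t \<in> B" for h t
  proof -
    have "(g has_derivative (\<lambda>u. fst u *\<^sub>R fh (h, t) + snd u *\<^sub>R ft (h, t)))
            (at (h, t) within (\<lambda>s. (h, s)) ` B)"
      by (rule has_derivative_subset[OF d]) (use ht in auto)
    moreover have "((\<lambda>s. (h, s)) has_derivative (\<lambda>s. (0, s))) (at t within B)"
      by (auto intro!: derivative_eq_intros)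
    ultimately show ?thesis
      using has_derivative_in_compose[of "\<lambda>s. (h, s)" "\<lambda>s. (0, s)" t B g
          "\<lambda>u. fst u *\<^sub>R fh (h, t) + snd u *\<^sub>R ft (h, t)"]
      by (simp add: has_vector_derivative_def)
  qed
  have 2: "((\<lambda>s. g (s, t)) has_vector_derivative fh (h, t)) (at h within A)"
    if ht: "h \<in> A" "t \<in> B" for h t
  proof -
    have "(g has_derivative (\<lambda>u. fst u *\<^sub>R fh (h, t) + snd u *\<^sub>R ft (h, t)))
            (at (h, t) within (\<lambda>s. (s, t)) ` A)"
      by (rule has_derivative_subset[OF d]) (use ht in auto)
    moreover have "((\<lambda>s. (s, t)) has_derivative (\<lambda>s. (s, 0))) (at h within A)"
      by (auto intro!: derivative_eq_intros)
    ultimately show ?thesis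
      using has_derivative_in_compose[of "\<lambda>s. (s, t)" "\<lambda>s. (s, 0)" h A g
          "\<lambda>u. fst u *\<^sub>R fh (h, t) + snd u *\<^sub>R ft (h, t)"]
      by (simp add: has_vector_derivative_def)
  qed
  show ?thesis using that C 1 2 by blast
qed

lemma Ck_on_continuous: "Ck_on k S g \<Longrightarrow> continuous_on S g"
proof (cases k)
  case (Suc m)
  assume "Ck_on k S g"
  then show ?thesis unfolding Suc
    by (auto simp: continuous_on_eq_continuous_within intro: has_derivative_continuous)
qed auto

text \<open>Clairaut's theorem on a closed rectangle, by differentiating
  \<open>g (h, t) = g (h, b0) + \<integral> gt (h, s) ds\<close> under the integral.\<close>

lemma partials_commute:
  fixes g :: "real \<times> real \<Rightarrow> 'a::banach"
  assumes ab: "a0 < a1" "b0 < b1"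
    and gh: "\<And>h t. h \<in> {a0..a1} \<Longrightarrow> t \<in> {b0..b1} \<Longrightarrow>
        ((\<lambda>h. g (h, t)) has_vector_derivative gh (h, t)) (at h within {a0..a1})"
    and gt: "\<And>h t. h \<in> {a0..a1} \<Longrightarrow> t \<in> {b0..b1} \<Longrightarrow>
        ((\<lambda>t. g (h, t)) has_vector_derivative gt (h, t)) (at t within {b0..b1})"
    and gth: "\<And>h t. h \<in> {a0..a1} \<Longrightarrow> t \<in> {b0..b1} \<Longrightarrow>
        ((\<lambda>h. gt (h, t)) has_vector_derivative gth (h, t)) (at h within {a0..a1})"
    and cont: "continuous_on ({a0..a1} \<times> {b0..b1}) gt" "continuous_on ({a0..a1} \<times> {b0..b1}) gth"
    and h: "h \<in> {a0..a1}" and t: "t \<in> {b0..b1}"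
  shows "((\<lambda>t. gh (h, t)) has_vector_derivative gth (h, t)) (at t within {b0..b1})"
proof -
  have slice: "continuous_on {b0..b1} (\<lambda>s. f (k, s))"
    if "continuous_on ({a0..a1} \<times> {b0..b1}) f" "k \<in> {a0..a1}" for f :: "real \<times> real \<Rightarrow> 'a" and k
    by (rule continuous_on_compose2[OF that(1)]) (use that(2) in \<open>auto intro!: continuous_intros\<close>)
  have eq: "gh (h, t) = gh (h, b0) + integral {b0..t} (\<lambda>s. gth (h, s))" if t: "t \<in> {b0..b1}" for t
  proof -
    have g_eq: "g (k, t) = g (k, b0) + integral {b0..t} (\<lambda>s. gt (k, s))" if k: "k \<in> {a0..a1}" for k
    proof -
      have "((\<lambda>s. gt (k, s)) has_integral (g (k, t) - g (k, b0))) {b0..t}"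
        by (rule fundamental_theorem_of_calculus)
          (use t k in \<open>auto intro!: has_vector_derivative_within_subset[OF gt]\<close>)
      then show ?thesis by (simp add: integral_unique)
    qed
    have "((\<lambda>k. integral (cbox b0 t) (\<lambda>s. gt (k, s))) has_vector_derivative
        integral (cbox b0 t) (\<lambda>s. gth (h, s))) (at h within {a0..a1})"
    proof (rule leibniz_rule_vector_derivative)
      fix k assume "k \<in> {a0..a1}"
      then show "(\<lambda>s. gt (k, s)) integrable_on cbox b0 t"
        using t by (auto intro!: integrable_continuous_real continuous_on_subset[OF slice[OF cont(1)]])
    next
      have "continuous_on ({a0..a1} \<times> cbox b0 t) gth"
        by (rule continuous_on_subset[OF cont(2)]) (use t in auto)
      then show "continuous_on ({a0..a1} \<times> cbox b0 t) (\<lambda>(x, t). gth (x, t))" by simp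
    qed (use t h gth in auto)
    then have "((\<lambda>k. g (k, b0) + integral {b0..t} (\<lambda>s. gt (k, s))) has_vector_derivative
        gh (h, b0) + integral {b0..t} (\<lambda>s. gth (h, s))) (at h within {a0..a1})"
      unfolding box_real using ab h by (intro has_vector_derivative_add gh) simp_all
    then have "((\<lambda>k. g (k, t)) has_vector_derivative
        gh (h, b0) + integral {b0..t} (\<lambda>s. gth (h, s))) (at h within {a0..a1})"
      by (rule has_vector_derivative_transform[OF h g_eq, rotated])
    from vderiv_eqI[OF ab(1) h this] vderiv_eqI[OF ab(1) h gh[OF h t]] show ?thesis by simp
  qed
  have "((\<lambda>t. gh (h, b0) + integral {b0..t} (\<lambda>s. gth (h, s))) has_vector_derivative 0 + gth (h, t))
      (at t within {b0..b1})"
    by (intro has_vector_derivative_add has_vector_derivative_const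
        integral_has_vector_derivative[OF slice[OF cont(2) h] t])
  then have "((\<lambda>t. gh (h, b0) + integral {b0..t} (\<lambda>s. gth (h, s))) has_vector_derivative gth (h, t))
      (at t within {b0..b1})" by simp
  then show ?thesis
    by (rule has_vector_derivative_transform[OF t eq, rotated])
qed

context
  fixes t0 t1 :: real and V :: "real \<Rightarrow> real \<Rightarrow> 'a::banach"
  assumes t01: "t0 < t1" and smooth: "smooth2_on ({-1..1} \<times> {t0..t1}) V"
begin

lemma mixed_Ck:
  obtains g where "Ck_on k ({-1..1} \<times> {t0..t1}) g"
    "\<And>h t. h \<in> {-1..1} \<Longrightarrow> t \<in> {t0..t1} \<Longrightarrow> mixed_deriv t0 t1 i j V h t = g (h, t)"
  using Ck_on_mixed_deriv[OF t01, of k i j V] smooth that unfolding smooth2_on_def by blast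

lemma mixed_deriv_h:
  assumes "h \<in> {-1..1}" "t \<in> {t0..t1}"
  shows "((\<lambda>h. mixed_deriv t0 t1 i j V h t) has_vector_derivative mixed_deriv t0 t1 (Suc i) j V h t)
      (at h within {-1..1})"
proof -
  obtain g where g: "Ck_on (Suc 0) ({-1..1} \<times> {t0..t1}) g"
    "\<And>h t. h \<in> {-1..1} \<Longrightarrow> t \<in> {t0..t1} \<Longrightarrow> mixed_deriv t0 t1 i j V h t = g (h, t)"
    using mixed_Ck[of "Suc 0" i j] by blast
  obtain gh gt where gh: "\<And>h t. h \<in> {-1..1} \<Longrightarrow> t \<in> {t0..t1} \<Longrightarrow>
      ((\<lambda>h. g (h, t)) has_vector_derivative gh (h, t)) (at h within {-1..1})"
    using Ck_on_partials[OF g(1)] by metis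
  have 1: "((\<lambda>h. mixed_deriv t0 t1 i j V h t) has_vector_derivative gh (h, t)) (at h within {-1..1})"
    by (rule has_vector_derivative_transform[OF _ _ gh[OF assms]]) (use assms g in auto)
  have "mixed_deriv t0 t1 (Suc i) j V h t = vderiv {-1..1} (\<lambda>h. mixed_deriv t0 t1 i j V h t) h"
    by (simp add: mixed_deriv_def nderiv_def)
  also have "\<dots> = gh (h, t)" using assms 1 by (intro vderiv_eqI) auto
  finally show ?thesis using 1 by simp
qed

text \<open>\<open>mixed_deriv\<close> takes the t-derivatives first. Adding one more t-derivative
  outside the h-derivatives means commuting it past them, one application of
  \<open>partials_commute\<close> per step of the induction on \<open>i\<close>.\<close>

lemma mixed_deriv_t:
  assumes "h \<in> {-1..1}" "t \<in> {t0..t1}"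
  shows "((\<lambda>t. mixed_deriv t0 t1 i j V h t) has_vector_derivative mixed_deriv t0 t1 i (Suc j) V h t)
      (at t within {t0..t1})"
  using assms
proof (induction i arbitrary: h t)
  case 0
  obtain g where g: "Ck_on (Suc 0) ({-1..1} \<times> {t0..t1}) g"
    "\<And>h t. h \<in> {-1..1} \<Longrightarrow> t \<in> {t0..t1} \<Longrightarrow> mixed_deriv t0 t1 0 j V h t = g (h, t)"
    using mixed_Ck[of "Suc 0" 0 j] by blast
  obtain gh gt where gt: "\<And>h t. h \<in> {-1..1} \<Longrightarrow> t \<in> {t0..t1} \<Longrightarrow>
      ((\<lambda>t. g (h, t)) has_vector_derivative gt (h, t)) (at t within {t0..t1})"
    using Ck_on_partials[OF g(1)] by metis
  have 1: "((\<lambda>t. mixed_deriv t0 t1 0 j V h t) has_vector_derivative gt (h, t)) (at t within {t0..t1})"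
    by (rule has_vector_derivative_transform[OF _ _ gt[OF 0]]) (use 0 g in auto)
  have "mixed_deriv t0 t1 0 (Suc j) V h t = vderiv {t0..t1} (\<lambda>t. mixed_deriv t0 t1 0 j V h t) t"
    by (simp add: mixed_deriv_def nderiv_def)
  also have "\<dots> = gt (h, t)" using 0 1 t01 by (intro vderiv_eqI) auto
  finally show ?case using 1 by simp
next
  case (Suc i)
  obtain g where g: "Ck_on 0 ({-1..1} \<times> {t0..t1}) g"
    "\<And>h t. h \<in> {-1..1} \<Longrightarrow> t \<in> {t0..t1} \<Longrightarrow> mixed_deriv t0 t1 i (Suc j) V h t = g (h, t)"
    using mixed_Ck[of 0 i "Suc j"] by blast
  obtain g' where g': "Ck_on 0 ({-1..1} \<times> {t0..t1}) g'"
    "\<And>h t. h \<in> {-1..1} \<Longrightarrow> t \<in> {t0..t1} \<Longrightarrow> mixed_deriv t0 t1 (Suc i) (Suc j) V h t = g' (h, t)"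
    using mixed_Ck[of 0 "Suc i" "Suc j"] by blast
  have "((\<lambda>t. (\<lambda>(h, t). mixed_deriv t0 t1 (Suc i) j V h t) (h, t)) has_vector_derivative
      (\<lambda>(h, t). mixed_deriv t0 t1 (Suc i) (Suc j) V h t) (h, t)) (at t within {t0..t1})"
  proof (rule partials_commute[where g = "\<lambda>(h, t). mixed_deriv t0 t1 i j V h t" and
        gt = "\<lambda>(h, t). mixed_deriv t0 t1 i (Suc j) V h t" and ?a0.0 = "-1" and ?a1.0 = 1])
    show "continuous_on ({- 1..1} \<times> {t0..t1}) (\<lambda>(h, t). mixed_deriv t0 t1 i (Suc j) V h t)"
      using Ck_on_continuous[OF g(1)] by (rule continuous_on_eq) (use g(2) in auto)
    show "continuous_on ({- 1..1} \<times> {t0..t1}) (\<lambda>(h, t). mixed_deriv t0 t1 (Suc i) (Suc j) V h t)"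
      using Ck_on_continuous[OF g'(1)] by (rule continuous_on_eq) (use g'(2) in auto)
  qed (use t01 Suc mixed_deriv_h in auto)
  then show ?case by simp
qed

end

text \<open>The mean value inequality on \<open>{0..h}\<close>, where \<open>s ^ n\<close> is at
  most \<open>h ^ n\<close>. The factor 1/(n+1) that exact integration would give is
  dropped.\<close>

lemma remainder_step:
  fixes f :: "real \<Rightarrow> 'a::real_normed_vector"
  assumes d: "\<And>h. h \<in> {0..1} \<Longrightarrow> (f has_vector_derivative f' h) (at h within {-1..1})"
    and b: "\<And>h. h \<in> {0..1} \<Longrightarrow> norm (f' h) \<le> M * h ^ n" and "f 0 = 0" "M \<ge> 0" "h \<in> {0..1}"
  shows "norm (f h) \<le> M * h ^ Suc n"
proof -
  have "norm (f h - f 0) \<le> (M * h ^ n) * norm (h - 0)"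
  proof (rule differentiable_bound[of "{0..h}"])
    fix s assume s: "s \<in> {0..h}"
    show "(f has_derivative (\<lambda>u. u *\<^sub>R f' s)) (at s within {0..h})"
      using d[of s] s assms(5)
      by (auto simp: has_vector_derivative_def intro: has_derivative_subset)
    show "onorm (\<lambda>u. u *\<^sub>R f' s) \<le> M * h ^ n"
    proof (rule onorm_le)
      fix u :: real
      have "norm (f' s) \<le> M * h ^ n"
        using b[of s] s assms(4,5) power_mono[of s h n] mult_left_mono[of "s ^ n" "h ^ n" M] by force
      then show "norm (u *\<^sub>R f' s) \<le> (M * h ^ n) * norm u"
        by (simp add: mult.commute mult_left_mono)
    qed
  qed (use assms(5) in auto)
  then show ?thesis using assms by (simp add: mult_ac)
qed

text \<open>Three mean value steps, beginning with the remainder of \<open>f2\<close>; this gives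
  the constant \<open>M\<close> in place of the sharp \<open>M / 6\<close>.\<close>

lemma taylor_bounds:
  fixes f :: "real \<Rightarrow> 'a::real_normed_vector"
  assumes d: "\<And>h. h \<in> {-1..1} \<Longrightarrow> (f has_vector_derivative f1 h) (at h within {-1..1})"
    "\<And>h. h \<in> {-1..1} \<Longrightarrow> (f1 has_vector_derivative f2 h) (at h within {-1..1})"
    "\<And>h. h \<in> {-1..1} \<Longrightarrow> (f2 has_vector_derivative f3 h) (at h within {-1..1})"
    and b: "\<And>h. h \<in> {-1..1} \<Longrightarrow> norm (f3 h) \<le> M" and h: "h \<in> {0..1}"
  shows "norm (f h - f 0 - h *\<^sub>R f1 0 - (h\<^sup>2 / 2) *\<^sub>R f2 0) \<le> M * h ^ 3"
proof -
  have M: "M \<ge> 0" using b[of 0, simplified] norm_ge_zero[of "f3 0"] by linarith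
  have 1: "norm (f2 h - f2 0) \<le> M * h ^ Suc 0" if "h \<in> {0..1}" for h
    by (rule remainder_step[OF _ _ _ M that, where f' = f3])
      (use b in \<open>auto intro!: derivative_eq_intros d\<close>)
  have 2: "norm (f1 h - f1 0 - h *\<^sub>R f2 0) \<le> M * h ^ Suc (Suc 0)" if "h \<in> {0..1}" for h
    by (rule remainder_step[OF _ _ _ M that, where f' = "\<lambda>h. f2 h - f2 0"])
      (use 1 in \<open>auto intro!: derivative_eq_intros d\<close>)
  have 3: "norm (f h - f 0 - h *\<^sub>R f1 0 - (h\<^sup>2 / 2) *\<^sub>R f2 0) \<le> M * h ^ Suc (Suc (Suc 0))"
    by (rule remainder_step[OF _ _ _ M h, where f' = "\<lambda>h. f1 h - f1 0 - h *\<^sub>R f2 0"])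
      (use 2 in \<open>auto intro!: derivative_eq_intros d\<close>)
  then show ?thesis by (simp add: numeral_3_eq_3)
qed

lemma mixed_deriv_0: "mixed_deriv t0 t1 0 j V h t = nderiv {t0..t1} j (V h) t"
  by (simp add: mixed_deriv_def nderiv_def)

lemma mixed_deriv_00: "mixed_deriv t0 t1 0 0 V h t = V h t"
  by (simp add: mixed_deriv_def nderiv_def)

text \<open>The t-derivative of the Lie quadratic equation removes its constant, and the cross
  product of the first derivative with itself vanishes. Differentiating the result in h gives the
  other two identities; the first two are therefore proved for every h before specialising.\<close>

lemma lie_quadratic_third_derivs:
  fixes V :: "real \<Rightarrow> real \<Rightarrow> real^3"
  assumes t01: "t0 < t1" and sm: "smooth2_on ({-1..1} \<times> {t0..t1}) V"
    and lq: "\<And>h. h \<in> {-1..1} \<Longrightarrow> lie_quadratic t0 t1 (V h)"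
    and h: "h \<in> {-1..1}" and t: "t \<in> {t0..t1}"
  defines "m \<equiv> \<lambda>i j. mixed_deriv t0 t1 i j V"
  shows "m 0 3 h t = cross3 (m 0 2 h t) (m 0 0 h t)"
    and "m 1 3 h t = cross3 (m 0 2 h t) (m 1 0 h t) + cross3 (m 1 2 h t) (m 0 0 h t)"
    and "m 2 3 h t = cross3 (m 0 2 h t) (m 2 0 h t) + 2 *\<^sub>R cross3 (m 1 2 h t) (m 1 0 h t)
      + cross3 (m 2 2 h t) (m 0 0 h t)"
proof -
  have d[unfolded m_def[symmetric]]: "((\<lambda>h. m i j h t) has_vector_derivative m (Suc i) j h t) (at h within {-1..1})"
    if "h \<in> {-1..1}" for i j h
    unfolding m_def by (rule mixed_deriv_h[OF t01 sm that t])
  have 0: "m 0 3 h t = cross3 (m 0 2 h t) (m 0 0 h t)" if h: "h \<in> {-1..1}" for h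
  proof -
    have dt: "((\<lambda>t. m i j h t) has_vector_derivative m i (Suc j) h t) (at t within {t0..t1})" for i j
      unfolding m_def by (rule mixed_deriv_t[OF t01 sm h t])
    obtain C where C: "\<forall>t\<in>{t0..t1}. m 0 2 h t = cross3 (m 0 1 h t) (m 0 0 h t) + C"
      using lq[OF h] unfolding lie_quadratic_def m_def mixed_deriv_0 by (auto simp: nderiv_def[of _ 0])
    have "((\<lambda>t. cross3 (m 0 1 h t) (m 0 0 h t) + C) has_vector_derivative
        (cross3 (m 0 1 h t) (m 0 (Suc 0) h t) + cross3 (m 0 (Suc 1) h t) (m 0 0 h t)) + 0) (at t within {t0..t1})"
      by (intro has_vector_derivative_add has_vector_derivative_const has_vector_derivative_cross3 dt)
    then have 1: "(m 0 2 h has_vector_derivative cross3 (m 0 2 h t) (m 0 0 h t)) (at t within {t0..t1})"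
      using C by (intro has_vector_derivative_transform[OF t, of "m 0 2 h"])
        (auto simp: numeral_2_eq_2 cross_refl)
    show ?thesis using vderiv_eqI[OF t01 t 1] vderiv_eqI[OF t01 t dt[of 0 2]] by (simp add: numeral_3_eq_3)
  qed
  show "m 0 3 h t = cross3 (m 0 2 h t) (m 0 0 h t)" using 0 h .
  have 1: "m 1 3 h t = cross3 (m 0 2 h t) (m 1 0 h t) + cross3 (m 1 2 h t) (m 0 0 h t)"
    if h: "h \<in> {-1..1}" for h
  proof -
    have 2: "((\<lambda>h. m 0 3 h t) has_vector_derivative cross3 (m 0 2 h t) (m (Suc 0) 0 h t)
        + cross3 (m (Suc 0) 2 h t) (m 0 0 h t)) (at h within {-1..1})"
      by (rule has_vector_derivative_transform[OF h 0 has_vector_derivative_cross3[OF d[OF h] d[OF h]]])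
    show ?thesis
      using vderiv_eqI[OF _ h 2] vderiv_eqI[OF _ h d[OF h, of 0 3]] by simp
  qed
  then show "m 1 3 h t = cross3 (m 0 2 h t) (m 1 0 h t) + cross3 (m 1 2 h t) (m 0 0 h t)" using h .
  have 2: "((\<lambda>h. m 1 3 h t) has_vector_derivative
      (cross3 (m 0 2 h t) (m (Suc 1) 0 h t) + cross3 (m (Suc 0) 2 h t) (m 1 0 h t))
      + (cross3 (m 1 2 h t) (m (Suc 0) 0 h t) + cross3 (m (Suc 1) 2 h t) (m 0 0 h t))) (at h within {-1..1})"
    by (rule has_vector_derivative_transform[OF h 1 has_vector_derivative_add[OF
        has_vector_derivative_cross3[OF d[OF h] d[OF h]] has_vector_derivative_cross3[OF d[OF h] d[OF h]]]])
  have "m 2 3 h t = (cross3 (m 0 2 h t) (m (Suc 1) 0 h t) + cross3 (m (Suc 0) 2 h t) (m 1 0 h t))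
      + (cross3 (m 1 2 h t) (m (Suc 0) 0 h t) + cross3 (m (Suc 1) 2 h t) (m 0 0 h t))"
    using vderiv_eqI[OF _ h 2] vderiv_eqI[OF _ h d[OF h, of 1 3]] by (simp add: numeral_2_eq_2)
  then show "m 2 3 h t = cross3 (m 0 2 h t) (m 2 0 h t) + 2 *\<^sub>R cross3 (m 1 2 h t) (m 1 0 h t)
      + cross3 (m 2 2 h t) (m 0 0 h t)"
    by (simp add: numeral_2_eq_2 scaleR_2)
qed

section \<open>The Taylor remainders of a variation\<close>

text \<open>The numbers that do not carry an index are those on which the asymptotic constants may
  depend. \<open>A1\<close> and \<open>B\<close> appear only through their coordinates in the
  frame.\<close>

locale cubic_family = small_family F \<delta> t0 t1
  for F :: "'i filter" and \<delta> :: "'i \<Rightarrow> real" and t0 t1 :: real +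
  fixes V :: "'i \<Rightarrow> real \<Rightarrow> real \<Rightarrow> real^3" and D F0 F1 F2 A0 :: "'i \<Rightarrow> real^3"
    and c0 c1 \<gamma> :: "'i \<Rightarrow> real" and x :: "'i \<Rightarrow> real \<Rightarrow> real^3^3"
    and d c2 a11 a12 \<beta> M :: real
  assumes d_pos: "d > 0" and beta_pos: "\<beta> > 0"
    and variation: "\<forall>\<^sub>F i in F. lie_quadratic_variation t0 t1 (V i) (D i)"
    and bound: "\<forall>\<^sub>F i in F. variation_bound t0 t1 (V i) M"
    and d_eq: "\<forall>\<^sub>F i in F. d = norm (D i)"
    and frame: "\<forall>\<^sub>F i in F. adapted_frame (D i) (F0 i) (F1 i) (F2 i)"
    and first_order: "\<forall>\<^sub>F i in F. first_order_data t0 t1 (V i) d (F0 i) (c0 i) (c1 i) c2 (A0 i)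
        (a11 *\<^sub>R F1 i + a12 *\<^sub>R F2 i) (\<beta> *\<^sub>R (cos (\<gamma> i) *\<^sub>R F1 i + sin (\<gamma> i) *\<^sub>R F2 i))"
    and cubic: "\<forall>\<^sub>F i in F. riemannian_cubic t0 t1 (x i)"
    and reduction: "\<forall>\<^sub>F i in F. has_lie_quadratic t0 t1 (x i) (V i (\<delta> i))"
begin

abbreviation m :: "nat \<Rightarrow> nat \<Rightarrow> 'i \<Rightarrow> real \<Rightarrow> real^3" where
  "m a b \<equiv> \<lambda>i t. mixed_deriv t0 t1 a b (V i) 0 t"

abbreviation md :: "nat \<Rightarrow> 'i \<Rightarrow> real \<Rightarrow> real^3" where
  "md b \<equiv> \<lambda>i t. mixed_deriv t0 t1 0 b (V i) (\<delta> i) t"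

lemma regular: "\<forall>\<^sub>F i in F. smooth2_on ({-1..1} \<times> {t0..t1}) (V i) \<and> (\<forall>h\<in>{-1..1}. lie_quadratic t0 t1 (V i h))
    \<and> (\<forall>t\<in>{t0..t1}. V i 0 t = D i) \<and> 0 < \<delta> i \<and> \<delta> i < 1"
  using variation small[of 1, simplified]
  by eventually_elim (auto simp: lie_quadratic_variation_def)

lemma der_m: "der (m a b) (m a (Suc b))"
  using regular unfolding der_def
  by eventually_elim (use t01 in \<open>auto intro!: mixed_deriv_t\<close>)

lemma der_md: "der (md b) (md (Suc b))"
  using regular unfolding der_def
  by eventually_elim (use t01 in \<open>auto intro!: mixed_deriv_t\<close>)

lemma bnd_m: "a \<le> 3 \<Longrightarrow> b \<le> 2 \<Longrightarrow> bnd 0 (m a b)"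
  by (rule bndI[where C=M], use bound in eventually_elim) (auto simp: variation_bound_def)

lemma bnd_md: "b \<le> 2 \<Longrightarrow> bnd 0 (md b)"
  by (rule bndI[where C=M], use bound regular in eventually_elim) (auto simp: variation_bound_def)

lemma m00: "agree (m 0 0) (\<lambda>i t. D i)"
  using regular unfolding agree_def by eventually_elim (auto simp: mixed_deriv_00)

lemma m01: "agree (m 0 1) (\<lambda>i t. 0)"
  by (rule der_unique[OF der_m[of 0 0, folded One_nat_def] der_cong[OF agree_sym[OF m00] agree_refl der_const]])

lemma m02: "agree (m 0 2) (\<lambda>i t. 0)"
  using der_unique[OF der_m[of 0 1] der_cong[OF agree_sym[OF m01] agree_refl der_const]]
  by (simp add: numeral_2_eq_2)

lemma sm_D: "sm 0 (\<lambda>i t. D i)"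
  by (rule sm_const, rule bnd_cong[OF m00 bnd_m]) auto

lemma third_deriv_md: "agree (md 3) (\<lambda>i t. cross3 (md 2 i t) (md 0 i t))"
  unfolding agree_def using regular
  by eventually_elim (use t01 lie_quadratic_third_derivs(1) in auto)

lemma m13: "agree (m 1 3) (\<lambda>i t. cross3 (m 1 2 i t) (D i))"
  using regular m00 m02 unfolding agree_def
  by eventually_elim (use t01 lie_quadratic_third_derivs(2) in \<open>auto simp: cross_zero_left\<close>)

lemma m23: "agree (m 2 3) (\<lambda>i t. 2 *\<^sub>R cross3 (m 1 2 i t) (m 1 0 i t) + cross3 (m 2 2 i t) (D i))"
  using regular m00 m02 unfolding agree_def
  by eventually_elim (use t01 lie_quadratic_third_derivs(3) in \<open>auto simp: cross_zero_left\<close>)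

lemma der_md2: "der (md 2) (\<lambda>i t. cross3 (md 2 i t) (md 0 i t))"
  using der_cong[OF agree_refl third_deriv_md, of "md 2"] der_md[of 2] by (simp add: numeral_3_eq_3 numeral_2_eq_2)

text \<open>The three families form a closed first order system, because \<open>md 2\<close> has
  derivative \<open>cross3 (md 2) (md 0)\<close>. Bounds on two t-derivatives therefore control all
  of them.\<close>

lemma sm_md: "sm 0 (md 0)" "sm 0 (md 1)" "sm 0 (md 2)"
proof -
  have "ordk k 0 (md 0) \<and> ordk k 0 (md 1) \<and> ordk k 0 (md 2)" for k
  proof (induction k)
    case 0 then show ?case using bnd_md by simp
  next
    case (Suc k)
    then have "ordk k 0 (\<lambda>i t. cross3 (md 2 i t) (md 0 i t))"
      using ordk_bilinear[OF bounded_bilinear_cross3, of k 0 "md 2" 0 "md 0"] by simp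
    then show ?case
      using Suc bnd_md[of 0] bnd_md[of 1] bnd_md[of 2] der_md[of 0] der_md[of 1] der_md2
      by (auto simp: numeral_2_eq_2)
  qed
  then show "sm 0 (md 0)" "sm 0 (md 1)" "sm 0 (md 2)" by (auto simp: sm_def)
qed

lemma sm_m_down:
  assumes "a \<le> 3" "sm 0 (m a 2)" shows "sm 0 (m a 0)" "sm 0 (m a 1)"
proof -
  show 1: "sm 0 (m a 1)"
    by (rule smI[OF bnd_m der_m]) (use assms in \<open>auto simp: numeral_2_eq_2\<close>)
  show "sm 0 (m a 0)"
    by (rule smI[OF bnd_m der_m]) (use assms 1 in auto)
qed

lemma der_m12: "der (m 1 2) (\<lambda>i t. cross3 (m 1 2 i t) (D i))"
  using der_cong[OF agree_refl m13, of "m 1 2"] der_m[of 1 2] by (simp add: numeral_3_eq_3 numeral_2_eq_2)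

text \<open>At h = 0 the curve is the constant \<open>D\<close>, so \<open>m 1 2\<close> solves a
  linear equation with coefficients that do not depend on t.\<close>

lemma sm_m1: "sm 0 (m 1 2)" "sm 0 (m 1 0)" "sm 0 (m 1 1)"
proof -
  show 1: "sm 0 (m 1 2)"
    by (rule sm_ode[OF bnd_m der_m12]) (use ordk_cross_l sm_D in auto)
  show "sm 0 (m 1 0)" "sm 0 (m 1 1)" using sm_m_down[OF _ 1] by auto
qed

lemma der_m22: "der (m 2 2) (\<lambda>i t. 2 *\<^sub>R cross3 (m 1 2 i t) (m 1 0 i t) + cross3 (m 2 2 i t) (D i))"
  using der_cong[OF agree_refl m23, of "m 2 2"] der_m[of 2 2] by (simp add: numeral_3_eq_3 numeral_2_eq_2)

lemma sm_m2: "sm 0 (m 2 2)" "sm 0 (m 2 0)" "sm 0 (m 2 1)"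
proof -
  show 1: "sm 0 (m 2 2)"
  proof (rule sm_ode[OF bnd_m der_m22])
    fix k assume "ordk k 0 (m 2 2)"
    moreover have "sm 0 (\<lambda>i t. 2 *\<^sub>R cross3 (m 1 2 i t) (m 1 0 i t))"
      using sm_m1 by (intro sm_order0_intros)
    ultimately show "ordk k 0 (\<lambda>i t. 2 *\<^sub>R cross3 (m 1 2 i t) (m 1 0 i t) + cross3 (m 2 2 i t) (D i))"
      by (intro ordk_add ordk_cross_l[OF _ sm_D]) (auto simp: sm_def)
  qed auto
  show "sm 0 (m 2 0)" "sm 0 (m 2 1)" using sm_m_down[OF _ 1] by auto
qed

section \<open>Remainders of the Taylor expansion in h\<close>

definition rem :: "nat \<Rightarrow> 'i \<Rightarrow> real \<Rightarrow> real^3" where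
  "rem b = (\<lambda>i t. md b i t - m 0 b i t - \<delta> i *\<^sub>R m 1 b i t - ((\<delta> i)\<^sup>2 / 2) *\<^sub>R m 2 b i t)"

lemma bnd_rem: assumes "b \<le> 2" shows "bnd 3 (rem b)"
proof (rule bndI[where C=M], use bound regular in eventually_elim)
  case (elim i)
  show ?case
  proof
    fix t assume t: "t \<in> {t0..t1}"
    show "norm (rem b i t) \<le> M * \<delta> i ^ 3"
      unfolding rem_def
      by (rule taylor_bounds[where f = "\<lambda>h. mixed_deriv t0 t1 0 b (V i) h t"
            and ?f3.0 = "\<lambda>h. mixed_deriv t0 t1 3 b (V i) h t"])
        (use mixed_deriv_h[OF t01, of "V i" _ t] elim t assms in
          \<open>auto simp: variation_bound_def numeral_3_eq_3 numeral_2_eq_2\<close>)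
  qed
qed

lemma der_rem: "der (rem b) (rem (Suc b))"
  unfolding rem_def by (intro der_diff der_scale der_m der_md)

text \<open>Since \<open>m 0 2\<close> vanishes, \<open>\<delta> *\<^sub>R w_hat\<close> is the
  second t-derivative of \<open>V_hat2\<close>; removing the factor leaves a family of order
  0.\<close>

abbreviation w_hat :: "'i \<Rightarrow> real \<Rightarrow> real^3" where
  "w_hat \<equiv> \<lambda>i t. m 1 2 i t + (\<delta> i / 2) *\<^sub>R m 2 2 i t"

lemma sm_w_hat: "sm 0 w_hat"
  using sm_m1 sm_m2 sm_order0[OF sm_half_delta] by (intro sm_order0_intros)

text \<open>Write \<open>md 2\<close> and \<open>md 0\<close> in \<open>cross3 (md 2) (md 0)\<close>
  as Taylor polynomial plus remainder. The polynomial terms of degree one and two in \<delta> cancel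
  against \<open>m13\<close> and \<open>m23\<close>; the degree three and four terms form the
  inhomogeneity.\<close>

lemma der_rem2: "der (rem 2) (\<lambda>i t. cross3 (rem 2 i t) (md 0 i t) + \<delta> i *\<^sub>R cross3 (w_hat i t) (rem 0 i t)
    + \<delta> i ^ 3 *\<^sub>R ((1/2) *\<^sub>R cross3 (m 1 2 i t) (m 2 0 i t)
       + (1/2) *\<^sub>R cross3 (m 2 2 i t) (m 1 0 i t) + (\<delta> i / 4) *\<^sub>R cross3 (m 2 2 i t) (m 2 0 i t)))"
    (is "der _ ?R")
proof -
  have "agree (rem 3) ?R"
    using m00 m02 third_deriv_md m13 m23 der_unique[OF der_m[of 0 2] der_cong[OF agree_sym[OF m02] agree_refl der_const]]
    unfolding agree_def
  proof eventually_elim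
    case (elim i)
    \<comment> \<open>Separates the term \<open>cross3 (rem 2) (md 0)\<close> before anything is
      expanded in coordinates.\<close>
    have *: "r = s" if "r = a - b - c" "a = p + q" "q - b - c = s - p" for r s a b c p q :: "real^3"
      using that by (simp add: algebra_simps)
    have m03: "\<And>t. t \<in> {t0..t1} \<Longrightarrow> m 0 3 i t = 0" using elim(6) by (simp add: numeral_3_eq_3)
    show ?case
    proof
      fix t assume t: "t \<in> {t0..t1}"
      have X: "md 0 i t = rem 0 i t + D i + \<delta> i *\<^sub>R m 1 0 i t + ((\<delta> i)\<^sup>2 / 2) *\<^sub>R m 2 0 i t"
        using elim(1) t by (simp add: rem_def)
      have Z: "md 2 i t = rem 2 i t + \<delta> i *\<^sub>R m 1 2 i t + ((\<delta> i)\<^sup>2 / 2) *\<^sub>R m 2 2 i t"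
        using elim(2) t by (simp add: rem_def)
      have r3: "rem 3 i t = cross3 (md 2 i t) (md 0 i t) - \<delta> i *\<^sub>R cross3 (m 1 2 i t) (D i)
        - ((\<delta> i)\<^sup>2 / 2) *\<^sub>R (2 *\<^sub>R cross3 (m 1 2 i t) (m 1 0 i t) + cross3 (m 2 2 i t) (D i))"
        using elim(3,4,5) m03 t by (simp add: rem_def)
      have r1: "cross3 (md 2 i t) (md 0 i t) = cross3 (rem 2 i t) (md 0 i t)
          + cross3 (\<delta> i *\<^sub>R m 1 2 i t + ((\<delta> i)\<^sup>2 / 2) *\<^sub>R m 2 2 i t) (md 0 i t)"
        unfolding Z by (simp add: cross_add_left)
      have r2: "cross3 (\<delta> i *\<^sub>R m 1 2 i t + ((\<delta> i)\<^sup>2 / 2) *\<^sub>R m 2 2 i t) (md 0 i t)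
         - \<delta> i *\<^sub>R cross3 (m 1 2 i t) (D i)
        - ((\<delta> i)\<^sup>2 / 2) *\<^sub>R (2 *\<^sub>R cross3 (m 1 2 i t) (m 1 0 i t) + cross3 (m 2 2 i t) (D i))
        = ?R i t - cross3 (rem 2 i t) (md 0 i t)"
        unfolding X
        by (simp add: cross3_def vec_eq_iff forall_3 field_simps power2_eq_square power3_eq_cube)
      show "rem 3 i t = ?R i t" by (rule *[OF r3 r1 r2])
    qed
  qed
  then show ?thesis using der_cong[OF agree_refl _ der_rem[of 2]] by (simp add: numeral_3_eq_3 numeral_2_eq_2)
qed

text \<open>By Taylor's theorem in \<open>h\<close>, the remainders are pointwise \<open>O(\<delta>\<^sup>3)\<close> for \<open>b \<le> 2\<close>. Since they solve a
  linear system of differential equations with an inhomogeneity of that order, so are all their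
  \<open>t\<close>-derivatives.\<close>

lemma sm_rem: "sm 3 (rem 0)" "sm 3 (rem 1)" "sm 3 (rem 2)"
proof -
  let ?G = "\<lambda>i t. (1/2) *\<^sub>R cross3 (m 1 2 i t) (m 2 0 i t)
       + (1/2) *\<^sub>R cross3 (m 2 2 i t) (m 1 0 i t) + (\<delta> i / 4) *\<^sub>R cross3 (m 2 2 i t) (m 2 0 i t)"
  have "sm 0 (\<lambda>i t. \<delta> i / 4)"
    using sm_order0[OF sm_linear[OF bounded_linear_divide sm_delta, of 4]] by simp
  then have "sm 0 ?G" using sm_m1 sm_m2 by (intro sm_order0_intros)
  then have G: "sm 3 (\<lambda>i t. \<delta> i ^ 3 *\<^sub>R ?G i t)"
    using sm_scaleR[OF sm_scale, of 0 ?G 3] by simp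
  have W: "sm 0 (\<lambda>i t. \<delta> i *\<^sub>R w_hat i t)"
    using sm_scaleR[OF sm_order0[OF sm_delta] sm_w_hat] by simp
  have "ordk k 3 (rem 0) \<and> ordk k 3 (rem 1) \<and> ordk k 3 (rem 2)" for k
  proof (induction k)
    case 0 then show ?case using bnd_rem by simp
  next
    case (Suc k)
    then have "ordk k 3 (\<lambda>i t. cross3 (rem 2 i t) (md 0 i t) + cross3 (\<delta> i *\<^sub>R w_hat i t) (rem 0 i t) + \<delta> i ^ 3 *\<^sub>R ?G i t)"
      by (intro ordk_add ordk_cross_l ordk_cross_r W sm_md smD[OF G]) auto
    then show ?case
      using Suc bnd_rem[of 0] bnd_rem[of 1] bnd_rem[of 2] der_rem[of 0] der_rem[of 1] der_rem2
      by (auto simp: numeral_2_eq_2 cross_mult_left)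
  qed
  then show "sm 3 (rem 0)" "sm 3 (rem 1)" "sm 3 (rem 2)" by (auto simp: sm_def)
qed

text \<open>Both derivatives of \<open>V \<delta>\<close> vanish at \<delta> = 0, so the quotients
  \<open>w\<close> and \<open>v\<close> are again of order 0.\<close>

definition w :: "'i \<Rightarrow> real \<Rightarrow> real^3" where "w = (\<lambda>i t. md 2 i t /\<^sub>R \<delta> i)"
definition v :: "'i \<Rightarrow> real \<Rightarrow> real^3" where "v = (\<lambda>i t. md 1 i t /\<^sub>R \<delta> i)"

lemma close_w_hat: "close 2 w w_hat"
proof (rule closeI[OF sm_w_hat])
  have "agree (\<lambda>i t. rem 2 i t /\<^sub>R \<delta> i) (\<lambda>i t. w i t - w_hat i t)"
    using m02 pos unfolding agree_def
    by eventually_elim (auto simp: rem_def w_def field_simps power2_eq_square scaleR_diff_right vec_eq_iff)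
  moreover have "sm 2 (\<lambda>i t. rem 2 i t /\<^sub>R \<delta> i)"
    using sm_rem(3) by (intro sm_unscale) (simp add: numeral_3_eq_3 numeral_2_eq_2)
  ultimately show "sm 2 (\<lambda>i t. w i t - w_hat i t)" by (rule sm_cong)
qed

text \<open>Order one is enough here: the leading terms \<open>m 1 2\<close> and
  \<open>m 1 1\<close> serve only for lower bounds and for the rotation speed, which carries a
  further factor \<delta>.\<close>

lemma close_w: "close 1 w (m 1 2)"
proof (rule closeI[OF sm_m1(1)])
  have "sm 1 (\<lambda>i t. w i t - w_hat i t)" using closeD(3)[OF close_w_hat] by (rule sm_mono[rotated]) simp
  moreover have "sm 1 (\<lambda>i t. (\<delta> i / 2) *\<^sub>R m 2 2 i t)"
    using sm_scaleR[OF sm_half_delta sm_m2(1)] by simp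
  ultimately have "sm 1 (\<lambda>i t. (w i t - w_hat i t) + (\<delta> i / 2) *\<^sub>R m 2 2 i t)" by (rule sm_add)
  then show "sm 1 (\<lambda>i t. w i t - m 1 2 i t)" by (simp add: algebra_simps)
qed

lemma close_v: "close 1 v (m 1 1)"
proof (rule closeI[OF sm_m1(3)])
  have "agree (\<lambda>i t. rem 1 i t /\<^sub>R \<delta> i + (\<delta> i / 2) *\<^sub>R m 2 1 i t) (\<lambda>i t. v i t - m 1 1 i t)"
    using m01 pos unfolding agree_def
    by eventually_elim (auto simp: rem_def v_def field_simps power2_eq_square scaleR_diff_right vec_eq_iff)
  moreover have "sm 2 (\<lambda>i t. rem 1 i t /\<^sub>R \<delta> i)"
    using sm_rem(2) by (intro sm_unscale) (simp add: numeral_3_eq_3 numeral_2_eq_2)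
  then have "sm 1 (\<lambda>i t. rem 1 i t /\<^sub>R \<delta> i)" by (rule sm_mono[rotated]) simp
  then have "sm 1 (\<lambda>i t. rem 1 i t /\<^sub>R \<delta> i + (\<delta> i / 2) *\<^sub>R m 2 1 i t)"
    using sm_scaleR[OF sm_half_delta sm_m2(3)] by (intro sm_add) simp_all
  ultimately show "sm 1 (\<lambda>i t. v i t - m 1 1 i t)" by (rule sm_cong)
qed

lemma close_D: "close 1 (md 0) (\<lambda>i t. D i)"
proof (rule closeI[OF sm_D])
  have "agree (\<lambda>i t. rem 0 i t + \<delta> i *\<^sub>R m 1 0 i t + \<delta> i *\<^sub>R ((\<delta> i / 2) *\<^sub>R m 2 0 i t)) (\<lambda>i t. md 0 i t - D i)"
    using m00 unfolding agree_def
    by eventually_elim (auto simp: rem_def power2_eq_square)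
  moreover have "sm 1 (rem 0)" using sm_rem(1) by (rule sm_mono[rotated]) simp
  then have "sm 1 (\<lambda>i t. rem 0 i t + \<delta> i *\<^sub>R m 1 0 i t + \<delta> i *\<^sub>R ((\<delta> i / 2) *\<^sub>R m 2 0 i t))"
    using sm_scaleR[OF sm_delta sm_m1(2)] sm_scaleR[OF sm_delta, of 0 "\<lambda>i t. (\<delta> i / 2) *\<^sub>R m 2 0 i t"]
      sm_scaleR[OF sm_half_delta sm_m2(2)] sm_order0 by (intro sm_add) auto
  ultimately show "sm 1 (\<lambda>i t. md 0 i t - D i)" by (rule sm_cong)
qed

lemma der_w: "der w (\<lambda>i t. cross3 (w i t) (md 0 i t))"
  unfolding w_def using der_scale[OF der_md2, of "\<lambda>i. inverse (\<delta> i)"] by (simp add: cross_mult_left)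

lemma der_md0: "der (md 0) (\<lambda>i t. \<delta> i *\<^sub>R v i t)"
proof (rule der_cong[OF agree_refl _ der_md[of 0]])
  show "agree (md (Suc 0)) (\<lambda>i t. \<delta> i *\<^sub>R v i t)"
    using pos unfolding agree_def v_def by eventually_elim auto
qed

subsection \<open>The moving frame of a Lie quadratic\<close>

definition ang :: "'i \<Rightarrow> real \<Rightarrow> real" where "ang i t = \<gamma> i - d * (t - t0)"

lemma m10_eq: "agree (m 1 0) (\<lambda>i t. (c0 i + c1 i * (t - t0) + c2 * (t - t0)^2) *\<^sub>R F0 i + A0 i
    + (t - t0) *\<^sub>R (a11 *\<^sub>R F1 i + a12 *\<^sub>R F2 i) + (\<beta> * cos (ang i t)) *\<^sub>R F1 i + (\<beta> * sin (ang i t)) *\<^sub>R F2 i)"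
  using first_order frame unfolding agree_def
proof eventually_elim
  case (elim i)
  then show ?case
    using e_tilde_rotation[of "F0 i" "F1 i" "F2 i" t0 d _ \<beta> "\<gamma> i"]
    by (auto simp: first_order_data_def adapted_frame_def ang_def scaleR_add_right)
qed

lemma ang_deriv: "(ang i has_real_derivative - d) (at t within S)"
  unfolding ang_def by (auto intro!: derivative_eq_intros)

lemma m11_eq: "agree (m 1 1) (\<lambda>i t. (c1 i + 2 * c2 * (t - t0)) *\<^sub>R F0 i
    + (a11 *\<^sub>R F1 i + a12 *\<^sub>R F2 i) + (d * \<beta> * sin (ang i t)) *\<^sub>R F1 i - (d * \<beta> * cos (ang i t)) *\<^sub>R F2 i)"
    (is "agree _ ?R")
proof -
  have "der (\<lambda>i t. (c0 i + c1 i * (t - t0) + c2 * (t - t0)^2) *\<^sub>R F0 i + A0 i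
    + (t - t0) *\<^sub>R (a11 *\<^sub>R F1 i + a12 *\<^sub>R F2 i) + (\<beta> * cos (ang i t)) *\<^sub>R F1 i + (\<beta> * sin (ang i t)) *\<^sub>R F2 i) ?R"
    unfolding der_def
    by (intro always_eventually allI ballI)
      (auto intro!: derivative_eq_intros ang_deriv simp: algebra_simps)
  then show ?thesis
    using der_unique der_cong[OF m10_eq agree_refl der_m[of 1 0]] by simp
qed

lemma m12_eq: "agree (m 1 2) (\<lambda>i t. (2 * c2) *\<^sub>R F0 i
    - (d^2 * \<beta> * cos (ang i t)) *\<^sub>R F1 i - (d^2 * \<beta> * sin (ang i t)) *\<^sub>R F2 i)"
    (is "agree _ ?R")
proof -
  have "der (\<lambda>i t. (c1 i + 2 * c2 * (t - t0)) *\<^sub>R F0 i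
    + (a11 *\<^sub>R F1 i + a12 *\<^sub>R F2 i) + (d * \<beta> * sin (ang i t)) *\<^sub>R F1 i - (d * \<beta> * cos (ang i t)) *\<^sub>R F2 i) ?R"
    unfolding der_def
    by (intro always_eventually allI ballI)
      (auto intro!: derivative_eq_intros ang_deriv simp: algebra_simps power2_eq_square)
  then show ?thesis
    using der_unique der_cong[OF m11_eq agree_refl der_m[of 1 1]] by (simp add: numeral_2_eq_2)
qed

abbreviation p :: "'i \<Rightarrow> real \<Rightarrow> real^3" where
  "p \<equiv> \<lambda>i t. cross3 (w i t) (md 0 i t)"

abbreviation p0 :: "'i \<Rightarrow> real \<Rightarrow> real^3" where
  "p0 \<equiv> \<lambda>i t. cross3 (m 1 2 i t) (D i)"

text \<open>Coordinates in the orthonormal frame. \<open>p0\<close> lies in the plane of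
  \<open>F1\<close> and \<open>F2\<close>, so the coefficients \<open>c1\<close> and
  \<open>c2\<close> of \<open>m 1 1\<close> along \<open>F0\<close> drop out of the third
  product.\<close>

lemma leading_eq:
  "agree (\<lambda>i t. m 1 2 i t \<bullet> m 1 2 i t) (\<lambda>i t. 4 * c2^2 + d^4 * \<beta>^2)"
  "agree (\<lambda>i t. p0 i t \<bullet> p0 i t) (\<lambda>i t. d^6 * \<beta>^2)"
  "agree (\<lambda>i t. m 1 1 i t \<bullet> p0 i t)
    (\<lambda>i t. d^3 * \<beta> * (a12 * cos (ang i t) - a11 * sin (ang i t)) - d^4 * \<beta>^2)"
proof -
  have "\<forall>\<^sub>F i in F. \<forall>t\<in>{t0..t1}. m 1 2 i t \<bullet> m 1 2 i t = 4 * c2^2 + d^4 * \<beta>^2 \<and> p0 i t \<bullet> p0 i t = d^6 * \<beta>^2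
    \<and> m 1 1 i t \<bullet> p0 i t = d^3 * \<beta> * (a12 * cos (ang i t) - a11 * sin (ang i t)) - d^4 * \<beta>^2"
    using m12_eq m11_eq frame d_eq unfolding agree_def
  proof eventually_elim
    case (elim i)
    have n: "F0 i \<bullet> F0 i = 1" "F1 i \<bullet> F1 i = 1" "F2 i \<bullet> F2 i = 1" "F0 i \<bullet> F1 i = 0" "F0 i \<bullet> F2 i = 0" "F1 i \<bullet> F2 i = 0"
      "F1 i \<bullet> F0 i = 0" "F2 i \<bullet> F0 i = 0" "F2 i \<bullet> F1 i = 0"
      using elim(3) by (auto simp: adapted_frame_def norm_eq_1 inner_commute)
    have D: "D i = d *\<^sub>R F0 i" using elim(3,4) d_pos by (simp add: adapted_frame_def)
    have c: "cross3 (F1 i) (F0 i) = - F2 i" "cross3 (F2 i) (F0 i) = F1 i"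
      using elim(3) cross_skew[of "F1 i" "F0 i"] by (auto simp: adapted_frame_def)
    show ?case
    proof
      fix t assume t: "t \<in> {t0..t1}"
      define C S where "C = cos (ang i t)" and "S = sin (ang i t)"
      have cs: "C * C + S * S = 1" by (simp add: C_def S_def)
      have w: "m 1 2 i t = (2 * c2) *\<^sub>R F0 i - (d^2 * \<beta> * C) *\<^sub>R F1 i - (d^2 * \<beta> * S) *\<^sub>R F2 i"
        unfolding C_def S_def using elim(1) t by blast
      have p: "p0 i t = (d^3 * \<beta> * C) *\<^sub>R F2 i - (d^3 * \<beta> * S) *\<^sub>R F1 i"
        unfolding w D by (simp add: Cross3.left_diff_distrib cross_add_left cross_mult_left cross_mult_right c cross_refl
            power2_eq_square power3_eq_cube algebra_simps)
      have v: "m 1 1 i t = (c1 i + 2 * c2 * (t - t0)) *\<^sub>R F0 i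
        + (a11 *\<^sub>R F1 i + a12 *\<^sub>R F2 i) + (d * \<beta> * S) *\<^sub>R F1 i - (d * \<beta> * C) *\<^sub>R F2 i"
        unfolding C_def S_def using elim(2) t by blast
      have "m 1 2 i t \<bullet> m 1 2 i t = 4 * c2^2 + d^4 * \<beta>^2 * (C * C + S * S)"
        unfolding w by (simp add: inner_diff_left inner_diff_right n power2_eq_square power4_eq_xxxx algebra_simps)
      moreover have "p0 i t \<bullet> p0 i t = d^6 * \<beta>^2 * (C * C + S * S)"
        unfolding p by (simp add: inner_diff_left inner_diff_right n power2_eq_square eval_nat_numeral algebra_simps)
      moreover have "m 1 1 i t \<bullet> p0 i t = d^3 * \<beta> * (a12 * C - a11 * S) - d^4 * \<beta>^2 * (C * C + S * S)"
        unfolding p v by (simp add: inner_diff_left inner_diff_right inner_add_left n power2_eq_square eval_nat_numeral algebra_simps)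
      ultimately show "m 1 2 i t \<bullet> m 1 2 i t = 4 * c2^2 + d^4 * \<beta>^2 \<and> p0 i t \<bullet> p0 i t = d^6 * \<beta>^2
        \<and> m 1 1 i t \<bullet> p0 i t = d^3 * \<beta> * (a12 * cos (ang i t) - a11 * sin (ang i t)) - d^4 * \<beta>^2"
        unfolding cs by (simp add: C_def S_def)
    qed
  qed
  then show "agree (\<lambda>i t. m 1 2 i t \<bullet> m 1 2 i t) (\<lambda>i t. 4 * c2^2 + d^4 * \<beta>^2)"
    "agree (\<lambda>i t. p0 i t \<bullet> p0 i t) (\<lambda>i t. d^6 * \<beta>^2)"
    "agree (\<lambda>i t. m 1 1 i t \<bullet> p0 i t)
      (\<lambda>i t. d^3 * \<beta> * (a12 * cos (ang i t) - a11 * sin (ang i t)) - d^4 * \<beta>^2)"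
    unfolding agree_def by (auto elim!: eventually_mono)
qed

lemma close_p: "close 1 p p0"
  by (intro close_cross close_w close_D)

text \<open>At leading order the squared norms are constants, positive because \<open>d\<close> and
  \<open>\<beta>\<close> are; this is the use of B being nonzero. \<open>low_close\<close> transfers
  the bounds to \<open>w\<close> and \<open>p\<close>.\<close>

lemma low_w: "low (\<lambda>i t. w i t \<bullet> w i t)"
  and low_m12: "low (\<lambda>i t. m 1 2 i t \<bullet> m 1 2 i t)"
  and low_p0: "low (\<lambda>i t. p0 i t \<bullet> p0 i t)"
  and low_p: "low (\<lambda>i t. p i t \<bullet> p i t)"
proof -
  have "4 * c2^2 + d^4 * \<beta>^2 > 0" using d_pos beta_pos by (intro add_nonneg_pos) auto
  then show 1: "low (\<lambda>i t. m 1 2 i t \<bullet> m 1 2 i t)"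
    using low_agree[OF agree_sym[OF leading_eq(1)] low_const] by blast
  have "d^6 * \<beta>^2 > 0" using d_pos beta_pos by simp
  then show 2: "low (\<lambda>i t. p0 i t \<bullet> p0 i t)"
    using low_agree[OF agree_sym[OF leading_eq(2)] low_const] by blast
  show "low (\<lambda>i t. w i t \<bullet> w i t)"
    by (rule low_close[of 0 _ "\<lambda>i t. m 1 2 i t \<bullet> m 1 2 i t"]) (use 1 close_w in \<open>auto intro!: close_inner\<close>)
  show "low (\<lambda>i t. p i t \<bullet> p i t)"
    by (rule low_close[of 0 _ "\<lambda>i t. p0 i t \<bullet> p0 i t"]) (use 2 close_p in \<open>auto intro!: close_inner\<close>)
qed

text \<open>The rows of T for the second derivative of \<open>V \<delta>\<close>. As
  \<open>p\<close> is the derivative of \<open>w\<close> and orthogonal to it, the Gram-Schmidt step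
  in the first row reduces to normalising \<open>p\<close>.\<close>

abbreviation "r3 \<equiv> nrm w"
abbreviation "r1 \<equiv> nrm p"
abbreviation "r2 \<equiv> \<lambda>i t. cross3 (r3 i t) (r1 i t)"

text \<open>The speed, divided by \<open>\<delta>\<close>, at which \<open>r1\<close> and \<open>r2\<close> rotate relative to a parallel frame.\<close>

definition rate :: "real^3 \<Rightarrow> real^3 \<Rightarrow> real^3 \<Rightarrow> real" where
  "rate W U P = (W \<bullet> W) * rsqrt (W \<bullet> W) * (U \<bullet> P) * (rsqrt (P \<bullet> P) * rsqrt (P \<bullet> P))"

abbreviation "om \<equiv> \<lambda>i t. rate (w i t) (v i t) (p i t)"

lemma frame_orthonormal:
  "\<forall>\<^sub>F i in F. \<forall>t\<in>{t0..t1}. r3 i t \<bullet> r3 i t = 1 \<and> r1 i t \<bullet> r1 i t = 1 \<and> r3 i t \<bullet> r1 i t = 0"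
  using low_pos[OF low_w] low_pos[OF low_p]
proof eventually_elim
  case (elim i)
  then show ?case
    by (auto simp: nrm_def dot_cross_self rsqrt_sq mult.assoc[symmetric] simp del: inner_gt_zero_iff)
qed

lemma der_r3: "der r3 (\<lambda>i t. cross3 (r3 i t) (md 0 i t))"
  by (rule der_cong[OF agree_refl _ der_nrm[OF der_w low_w]], rule agreeI)
    (simp add: dot_cross_self nrm_def cross_mult_left)

lemma der_p: "der p (\<lambda>i t. \<delta> i *\<^sub>R cross3 (w i t) (v i t) + cross3 (p i t) (md 0 i t))"
  by (rule der_cong[OF agree_refl _ der_bilinear[OF bounded_bilinear_cross3 der_w der_md0]], rule agreeI)
    (simp add: cross_mult_right)

text \<open>By \<open>cross3_decomp\<close> the term \<open>cross3 w v\<close> in the derivative of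
  \<open>p\<close> has a part along \<open>p\<close>, which normalisation cancels, and a part along
  \<open>cross3 w p\<close>, which is the rotation towards \<open>r2\<close>.\<close>

lemma der_r1: "der r1 (\<lambda>i t. cross3 (r1 i t) (md 0 i t) + (\<delta> i * om i t) *\<^sub>R r2 i t)"
proof (rule der_cong[OF agree_refl _ der_nrm[OF der_p low_p]], unfold agree_def,
    use low_pos[OF low_w] low_pos[OF low_p] in eventually_elim)
  case (elim i)
  show ?case
  proof
    fix t assume t: "t \<in> {t0..t1}"
    define W P U X where "W = w i t" and "P = p i t" and "U = v i t" and "X = md 0 i t"
    define a b where "a = rsqrt (W \<bullet> W)" and "b = rsqrt (P \<bullet> P)"
    have a: "(W \<bullet> W) * a * a = 1" using rsqrt_sq[of "W \<bullet> W"] elim t by (simp add: W_def a_def mult_ac)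
    have b: "b * b * (P \<bullet> P) = 1" using rsqrt_sq[of "P \<bullet> P"] elim t by (simp add: P_def b_def)
    have wp: "W \<bullet> P = 0" by (simp add: W_def P_def dot_cross_self)
    have PX: "P \<bullet> cross3 P X = 0" by (simp add: dot_cross_self)
    have dec: "cross3 W U = (b * b) *\<^sub>R ((P \<bullet> cross3 W U) *\<^sub>R P + (U \<bullet> P) *\<^sub>R cross3 W P)"
      unfolding cross3_decomp[OF wp, of U, symmetric] using b by simp
    have rate: "rate W U P *\<^sub>R cross3 (a *\<^sub>R W) (b *\<^sub>R P) = b *\<^sub>R ((b * b * (U \<bullet> P)) *\<^sub>R cross3 W P)"
    proof -
      have "rate W U P *\<^sub>R cross3 (a *\<^sub>R W) (b *\<^sub>R P) = ((W \<bullet> W) * a * a * (U \<bullet> P) * b * b * b) *\<^sub>R cross3 W P"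
        by (simp add: rate_def a_def[symmetric] b_def[symmetric] cross_mult_left cross_mult_right mult_ac)
      then show ?thesis unfolding a by (simp add: mult_ac)
    qed
    have "b *\<^sub>R (\<delta> i *\<^sub>R cross3 W U + cross3 P X) - (b ^ 3 * (P \<bullet> (\<delta> i *\<^sub>R cross3 W U + cross3 P X))) *\<^sub>R P
      = b *\<^sub>R cross3 P X + (\<delta> i * b) *\<^sub>R (cross3 W U - (b * b) *\<^sub>R ((P \<bullet> cross3 W U) *\<^sub>R P))"
      by (simp add: PX inner_add_right power3_eq_cube algebra_simps)
    also have "cross3 W U - (b * b) *\<^sub>R ((P \<bullet> cross3 W U) *\<^sub>R P) = (b * b * (U \<bullet> P)) *\<^sub>R cross3 W P"
      using dec by (metis add_diff_cancel_left' scaleR_add_right scaleR_scaleR)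
    also have "b *\<^sub>R cross3 P X + (\<delta> i * b) *\<^sub>R (b * b * (U \<bullet> P)) *\<^sub>R cross3 W P
      = cross3 (b *\<^sub>R P) X + (\<delta> i * rate W U P) *\<^sub>R cross3 (a *\<^sub>R W) (b *\<^sub>R P)"
      using rate by (simp add: cross_mult_left flip: scaleR_scaleR)
    finally show "rsqrt (p i t \<bullet> p i t) *\<^sub>R (\<delta> i *\<^sub>R cross3 (w i t) (v i t) + cross3 (p i t) (md 0 i t))
        - (rsqrt (p i t \<bullet> p i t) ^ 3 * (p i t \<bullet> (\<delta> i *\<^sub>R cross3 (w i t) (v i t) + cross3 (p i t) (md 0 i t)))) *\<^sub>R p i t
      = cross3 (r1 i t) (md 0 i t) + (\<delta> i * om i t) *\<^sub>R r2 i t"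
      unfolding nrm_def W_def P_def U_def X_def a_def b_def .
  qed
qed

text \<open>\<open>cross3_derivation\<close> combines the two transport terms, and crossing
  \<open>r3\<close> with \<open>r2\<close> turns the extra rotation of \<open>r1\<close> into the
  term along \<open>r1\<close>.\<close>

lemma der_r2: "der r2 (\<lambda>i t. cross3 (r2 i t) (md 0 i t) - (\<delta> i * om i t) *\<^sub>R r1 i t)"
proof (rule der_cong[OF agree_refl _ der_bilinear[OF bounded_bilinear_cross3 der_r3 der_r1]],
    unfold agree_def, use frame_orthonormal in eventually_elim)
  case (elim i)
  then show ?case
    using cross3_derivation cross3_unit(1) by (auto simp: cross_add_right cross_mult_right algebra_simps)
qed

subsection \<open>Approximation of the cubic\<close>

definition ph :: "'i \<Rightarrow> real \<Rightarrow> real" where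
  "ph i t = phi_hat t0 d c2 a11 a12 \<beta> (\<gamma> i) (\<delta> i) t"

definition ph_rate :: "'i \<Rightarrow> real \<Rightarrow> real" where
  "ph_rate i t = sqrt ((- 2 * c2 / (d^2 * \<beta>))\<^sup>2 + 1) * (\<beta> + (a11 * sin (ang i t) - a12 * cos (ang i t)) / d)"

lemma der_ph: "der ph (\<lambda>i t. \<delta> i * ph_rate i t)"
  unfolding der_def
proof (intro always_eventually allI ballI)
  fix i t
  have "(ph i has_real_derivative \<delta> i * ph_rate i t) (at t within {t0..t1})"
    unfolding ph_def phi_hat_def Let_def ang_def[symmetric] ph_rate_def using d_pos
    by (auto intro!: derivative_eq_intros ang_deriv simp: field_simps power2_eq_square)
  then show "(ph i has_vector_derivative \<delta> i * ph_rate i t) (at t within {t0..t1})"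
    by (simp add: has_real_derivative_iff_has_vector_derivative)
qed

lemma sm_ph_rate: "sm 0 ph_rate"
proof -
  have "der ang (\<lambda>i t. - d)"
    unfolding der_def using ang_deriv by (simp add: has_real_derivative_iff_has_vector_derivative)
  note sm_cos_sin[OF this sm_const']
  then show ?thesis
    unfolding ph_rate_def divide_inverse by (intro sm_order0_intros)
qed

lemma sm_cos_sin_ph: "sm 0 (\<lambda>i t. cos (ph i t))" "sm 0 (\<lambda>i t. sin (ph i t))"
proof -
  have "sm 0 (\<lambda>i t. \<delta> i * ph_rate i t)"
    using sm_mult[OF sm_order0[OF sm_delta] sm_ph_rate] by simp
  from sm_cos_sin[OF der_ph this]
  show "sm 0 (\<lambda>i t. cos (ph i t))" "sm 0 (\<lambda>i t. sin (ph i t))" .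
qed

text \<open>The origin of the angle: \<open>sqrt (\<rho>^2 + 1)\<close> is the norm of
  \<open>m 1 2\<close> divided by \<open>d^2 * \<beta>\<close>, and the rest is the inner product of
  \<open>m 1 1\<close> with \<open>p0\<close> divided by the squared norm of
  \<open>p0\<close>.\<close>

lemma rate_leading: "agree (\<lambda>i t. rate (m 1 2 i t) (m 1 1 i t) (p0 i t)) (\<lambda>i t. - ph_rate i t)"
  using leading_eq unfolding agree_def
proof eventually_elim
  case (elim i)
  show ?case
  proof
    fix t assume t: "t \<in> {t0..t1}"
    let ?s = "4 * c2\<^sup>2 + d ^ 4 * \<beta>\<^sup>2"
    let ?n = "d ^ 3 * \<beta> * (a12 * cos (ang i t) - a11 * sin (ang i t)) - d ^ 4 * \<beta>\<^sup>2"
    have pos: "d ^ 6 * \<beta>\<^sup>2 > 0" "?s > 0" using d_pos beta_pos by (auto intro: add_nonneg_pos)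
    have inv: "rsqrt (d ^ 6 * \<beta>\<^sup>2) * rsqrt (d ^ 6 * \<beta>\<^sup>2) = 1 / (d ^ 6 * \<beta>\<^sup>2)"
      using rsqrt_sq[OF pos(1)] pos(1) by (metis less_irrefl nonzero_eq_divide_eq)
    have "(- 2 * c2 / (d^2 * \<beta>))\<^sup>2 + 1 = ?s / (d^2 * \<beta>)\<^sup>2"
      using d_pos beta_pos by (simp add: field_simps power2_eq_square power4_eq_xxxx)
    then have s: "sqrt ((- 2 * c2 / (d^2 * \<beta>))\<^sup>2 + 1) = sqrt ?s / (d^2 * \<beta>)"
      using d_pos beta_pos by (simp only: real_sqrt_divide real_sqrt_abs) simp
    have "rate (m 1 2 i t) (m 1 1 i t) (p0 i t) = sqrt ?s * ?n * (1 / (d ^ 6 * \<beta>\<^sup>2))"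
      using elim t sqrt_eq_rsqrt[of ?s] pos(2) unfolding rate_def by (simp add: inv)
    also have "\<dots> = - (sqrt ?s / (d^2 * \<beta>) * (\<beta> + (a11 * sin (ang i t) - a12 * cos (ang i t)) / d))"
      using d_pos beta_pos by (simp add: field_simps power2_eq_square eval_nat_numeral)
    finally show "rate (m 1 2 i t) (m 1 1 i t) (p0 i t) = - ph_rate i t"
      unfolding ph_rate_def s .
  qed
qed

abbreviation eps :: "'i \<Rightarrow> real \<Rightarrow> real" where "eps \<equiv> \<lambda>i t. \<delta> i * (ph_rate i t + om i t)"

text \<open>The leading terms of the two speeds cancel, leaving order one; the prefactor \<delta>
  supplies the second order.\<close>

lemma sm_eps: "sm 2 eps"
proof -
  have "close 1 om (\<lambda>i t. rate (m 1 2 i t) (m 1 1 i t) (p0 i t))"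
    unfolding rate_def
    by (intro close_mult close_inner close_rsqrt close_w close_v close_p low_w low_m12 low_p low_p0)
  then have "close 1 om (\<lambda>i t. - ph_rate i t)" by (rule close_cong[OF agree_refl rate_leading])
  then have "sm 1 (\<lambda>i t. ph_rate i t + om i t)" using closeD(3) by (fastforce simp: add.commute)
  then show ?thesis using sm_mult[OF sm_delta, of 1] by (simp add: numeral_2_eq_2)
qed

abbreviation "y1 \<equiv> \<lambda>i t. cos (ph i t) *\<^sub>R r1 i t + sin (ph i t) *\<^sub>R r2 i t"
abbreviation "y2 \<equiv> \<lambda>i t. cos (ph i t) *\<^sub>R r2 i t - sin (ph i t) *\<^sub>R r1 i t"

text \<open>An intermediate frame: the exact rows of T for \<open>V \<delta>\<close>, turned by the
  explicit approximate angle.\<close>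

definition yt :: "'i \<Rightarrow> real \<Rightarrow> real^3^3" where
  "yt = (\<lambda>i t. R_rot (ph i t) ** vector [r1 i t, r2 i t, r3 i t])"

lemma der_cos_ph: "der (\<lambda>i t. cos (ph i t)) (\<lambda>i t. - (\<delta> i * ph_rate i t * sin (ph i t)))"
  and der_sin_ph: "der (\<lambda>i t. sin (ph i t)) (\<lambda>i t. \<delta> i * ph_rate i t * cos (ph i t))"
  using der_ph unfolding der_def has_real_derivative_iff_has_vector_derivative[symmetric]
  by (auto elim!: eventually_mono intro!: derivative_eq_intros)

text \<open>Turning by \<open>ph\<close> adds its speed to that of the frame. Only the sum
  \<open>eps\<close> survives as a defect, confined to the first two rows.\<close>

lemma der_yt: "der yt (\<lambda>i t. yt i t ** ad (md 0 i t)
    + vector [eps i t *\<^sub>R y2 i t, (- eps i t) *\<^sub>R y1 i t, 0])"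
proof -
  have 1: "der y1 (\<lambda>i t. cross3 (y1 i t) (md 0 i t) + eps i t *\<^sub>R y2 i t)"
    by (rule der_cong[OF agree_refl _ der_add[OF der_bilinear[OF bounded_bilinear_scaleR der_cos_ph der_r1]
            der_bilinear[OF bounded_bilinear_scaleR der_sin_ph der_r2]]], rule agreeI)
      (simp add: cross_add_left cross_mult_left algebra_simps)
  have 2: "der y2 (\<lambda>i t. cross3 (y2 i t) (md 0 i t) + (- eps i t) *\<^sub>R y1 i t)"
    by (rule der_cong[OF agree_refl _ der_diff[OF der_bilinear[OF bounded_bilinear_scaleR der_cos_ph der_r2]
            der_bilinear[OF bounded_bilinear_scaleR der_sin_ph der_r1]]], rule agreeI)
      (simp add: Cross3.left_diff_distrib cross_mult_left algebra_simps)
  have 3: "der r3 (\<lambda>i t. cross3 (r3 i t) (md 0 i t) + 0)" using der_r3 by simp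
  show ?thesis
    unfolding yt_def R_rot_rows rows_mult_ad
    by (rule der_cong[OF agree_refl _ der_rows[OF 1 2 3]], rule agreeI) (simp add: vec_eq_iff forall_3)
qed

section \<open>The frame of the approximate quadratic\<close>

definition wd :: "'i \<Rightarrow> real \<Rightarrow> real^3" where
  "wd = (\<lambda>i t. m 1 3 i t + (\<delta> i / 2) *\<^sub>R m 2 3 i t)"

lemma der_w_hat: "der w_hat wd"
  using der_add[OF der_m[of 1 2] der_scale[OF der_m[of 2 2], of "\<lambda>i. \<delta> i / 2"]]
  by (simp add: wd_def numeral_3_eq_3 numeral_2_eq_2)

text \<open>\<open>wd\<close> need not be exactly orthogonal to \<open>w_hat\<close>, so the first
  row is obtained as a cross product of the other two instead of by normalising
  \<open>wd\<close>.\<close>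

abbreviation "q3 \<equiv> nrm w_hat"
abbreviation "q2 \<equiv> nrm (\<lambda>i t. cross3 (w_hat i t) (wd i t))"
abbreviation "q1 \<equiv> \<lambda>i t. cross3 (q2 i t) (q3 i t)"

definition yh :: "'i \<Rightarrow> real \<Rightarrow> real^3^3" where
  "yh = (\<lambda>i t. R_rot (ph i t) ** vector [q1 i t, q2 i t, q3 i t])"

lemma cross_w_p:
  "agree (\<lambda>i t. cross3 (w i t) (p i t) \<bullet> cross3 (w i t) (p i t)) (\<lambda>i t. (w i t \<bullet> w i t) * (p i t \<bullet> p i t))"
proof (rule agreeI)
  fix i t
  have "w i t \<bullet> p i t = 0" by (simp add: dot_cross_self)
  then show "cross3 (w i t) (p i t) \<bullet> cross3 (w i t) (p i t) = (w i t \<bullet> w i t) * (p i t \<bullet> p i t)"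
    using norm_cross[of "w i t" "p i t"] by (simp add: power2_norm_eq_inner)
qed

lemma low_cross_w_p: "low (\<lambda>i t. cross3 (w i t) (p i t) \<bullet> cross3 (w i t) (p i t))"
  by (rule low_agree[OF agree_sym[OF cross_w_p] low_mult[OF low_w low_p]])

text \<open>Brings \<open>r2\<close> into the shape of \<open>q2\<close>, so that closeness of
  normalised vectors applies directly.\<close>

lemma r2_eq: "agree (nrm (\<lambda>i t. cross3 (w i t) (p i t))) r2"
  using cross_w_p unfolding agree_def
  by eventually_elim (simp add: nrm_def rsqrt_mult cross_mult_left cross_mult_right mult.commute)

lemma close_wd: "close 2 p wd"
  by (rule close_der[OF close_w_hat der_w der_w_hat])

lemma low_w_hat: "low (\<lambda>i t. w_hat i t \<bullet> w_hat i t)"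
  and low_q: "low (\<lambda>i t. cross3 (w_hat i t) (wd i t) \<bullet> cross3 (w_hat i t) (wd i t))"
proof -
  have sym: "close n f g \<Longrightarrow> close n g f" for n and f g :: "'i \<Rightarrow> real \<Rightarrow> real"
    using sm_linear[OF bounded_linear_minus[OF bounded_linear_ident], of n "\<lambda>i t. f i t - g i t"]
    by (simp add: close_def)
  show "low (\<lambda>i t. w_hat i t \<bullet> w_hat i t)"
    by (rule low_close[of 1, OF sym low_w]) (use close_w_hat in \<open>auto intro!: close_inner simp: numeral_2_eq_2\<close>)
  show "low (\<lambda>i t. cross3 (w_hat i t) (wd i t) \<bullet> cross3 (w_hat i t) (wd i t))"
    by (rule low_close[of 1, OF sym low_cross_w_p])
      (use close_w_hat close_wd in \<open>auto intro!: close_inner close_cross simp: numeral_2_eq_2\<close>)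
qed

lemma close_frame: "close 2 r3 q3" "close 2 r2 q2" "close 2 r1 q1"
proof -
  show 3: "close 2 r3 q3" by (intro close_nrm close_w_hat low_w low_w_hat)
  have "close 2 (nrm (\<lambda>i t. cross3 (w i t) (p i t))) q2"
    by (intro close_nrm close_cross close_w_hat close_wd low_cross_w_p low_q)
  then show 2: "close 2 r2 q2" by (rule close_cong[OF r2_eq agree_refl])
  \<comment> \<open>Likewise \<open>r1\<close> is recovered in the form in which \<open>q1\<close>
    is defined.\<close>
  have "agree (\<lambda>i t. cross3 (r2 i t) (r3 i t)) r1"
    using frame_orthonormal unfolding agree_def by eventually_elim (use cross3_unit(2) in auto)
  then show "close 2 r1 q1" by (rule close_cong[OF _ agree_refl close_cross[OF 2 3]])
qed

lemma close_y: "close 2 yt yh"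
proof -
  have c: "close 2 (\<lambda>i t. cos (ph i t)) (\<lambda>i t. cos (ph i t))" "close 2 (\<lambda>i t. sin (ph i t)) (\<lambda>i t. sin (ph i t))"
    using sm_cos_sin_ph close_refl by auto
  have d: "close 2 f f' \<Longrightarrow> close 2 g g' \<Longrightarrow> close 2 (\<lambda>i t. f i t - g i t) (\<lambda>i t. f' i t - g' i t)"
    for f f' g g' :: "'i \<Rightarrow> real \<Rightarrow> real^3"
    using close_add[of 2 f f' "\<lambda>i t. - g i t" "\<lambda>i t. - g' i t"]
      close_linear[OF bounded_linear_minus[OF bounded_linear_ident], of 2 g g'] by simp
  show ?thesis
    unfolding yt_def yh_def R_rot_rows
    by (intro close_rows close_add d close_scaleR c close_frame)
qed

text \<open>\<open>close\<close> includes derivatives, so replacing \<open>yt\<close> by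
  \<open>yh\<close> in its differential equation changes both sides by order two, the size of the
  defect already present.\<close>

lemma yh_defect:
  obtains yh' where "der yh yh'" "sm 2 (\<lambda>i t. yh' i t - yh i t ** ad (md 0 i t))"
proof -
  obtain yh' where yh': "der yh yh'" using sm_obtain_der[OF closeD(2)[OF close_y]] .
  let ?E = "\<lambda>i t. vector [eps i t *\<^sub>R y2 i t, (- eps i t) *\<^sub>R y1 i t, 0] :: real^3^3"
  have ad: "sm 0 (\<lambda>i t. ad (md 0 i t))" by (rule sm_linear[OF bounded_linear_ad sm_md(1)])
  have sr: "sm 0 r1" "sm 0 r2" using close_frame closeD by auto
  then have y: "sm 0 y1" "sm 0 y2" using sm_cos_sin_ph by (auto intro!: sm_order0_intros)
  have ne: "sm 2 (\<lambda>i t. - eps i t)"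
    using sm_linear[OF bounded_linear_minus[OF bounded_linear_ident] sm_eps] by simp
  have E: "sm 2 ?E"
    by (rule sm_rows) (use sm_scaleR[OF sm_eps y(2)] sm_scaleR[OF ne y(1)] sm_zero in simp_all)
  have 1: "sm 2 (\<lambda>i t. (yt i t ** ad (md 0 i t) + ?E i t) - yh' i t)"
    using close_der[OF close_y der_yt yh'] closeD(3) by blast
  have 2: "sm 2 (\<lambda>i t. (yt i t - yh i t) ** ad (md 0 i t))"
    using sm_mat[OF closeD(3)[OF close_y] ad] by simp
  have "sm 2 (\<lambda>i t. ((yt i t - yh i t) ** ad (md 0 i t) + ?E i t) - ((yt i t ** ad (md 0 i t) + ?E i t) - yh' i t))"
    by (intro sm_diff sm_add 1 2 E)
  moreover have "(\<lambda>i t. ((yt i t - yh i t) ** ad (md 0 i t) + ?E i t) - ((yt i t ** ad (md 0 i t) + ?E i t) - yh' i t))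
      = (\<lambda>i t. yh' i t - yh i t ** ad (md 0 i t))"
    by (simp add: bounded_bilinear.diff_left[OF bounded_bilinear_matrix_mult3])
  ultimately have "sm 2 (\<lambda>i t. yh' i t - yh i t ** ad (md 0 i t))" by (simp only:)
  with yh' show ?thesis by (rule that)
qed

text \<open>Used at \<open>t0\<close>, where it makes the approximation start at the same point as
  the cubic. Both the turning matrix and the rows are orthonormal.\<close>

lemma yh_orthogonal: "\<forall>\<^sub>F i in F. \<forall>t\<in>{t0..t1}. transpose (yh i t) ** yh i t = mat 1"
  using low_pos[OF low_w_hat] low_pos[OF low_q]
proof eventually_elim
  case (elim i)
  show ?case
  proof
    fix t assume t: "t \<in> {t0..t1}"
    define a b c where "a = q1 i t" and "b = q2 i t" and "c = q3 i t"
    have cc: "c \<bullet> c = 1" and bb: "b \<bullet> b = 1" and bc: "b \<bullet> c = 0"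
      using elim t by (auto simp: b_def c_def nrm_def dot_cross_self rsqrt_sq mult.assoc[symmetric] simp del: inner_gt_zero_iff)
    have a: "a = cross3 b c" by (simp add: a_def b_def c_def)
    have ab: "a \<bullet> b = 0" "a \<bullet> c = 0" by (simp_all add: a dot_cross_self)
    have aa: "a \<bullet> a = 1"
      using norm_cross[of b c] by (simp add: a power2_norm_eq_inner bb cc bc)
    have R: "R_rot \<phi> ** transpose (R_rot \<phi>) = mat 1" for \<phi>
      by (simp add: R_rot_def vec_eq_iff forall_3 matrix_matrix_mult_def sum_3 transpose_def mat_def
          flip: power2_eq_square)
    have T: "vector [a, b, c] ** transpose (vector [a, b, c] :: real^3^3) = mat 1"
      using aa bb cc bc ab
      by (simp add: vec_eq_iff forall_3 matrix_matrix_mult_def sum_3 transpose_def mat_def inner_vec_def mult.commute)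
    have "yh i t ** transpose (yh i t)
      = R_rot (ph i t) ** (vector [a, b, c] ** transpose (vector [a, b, c])) ** transpose (R_rot (ph i t))"
      unfolding yh_def a_def b_def c_def by (simp only: matrix_transpose_mul matrix_mul_assoc)
    then have "yh i t ** transpose (yh i t) = mat 1" by (simp add: T R)
    then show "transpose (yh i t) ** yh i t = mat 1" by (simp add: matrix_left_right_inverse)
  qed
qed

section \<open>Comparison with the cubic\<close>

lemma x_facts:
  "\<forall>\<^sub>F i in F. \<forall>t\<in>{t0..t1}. rotation_matrix (x i t)"
  "der x (\<lambda>i t. x i t ** ad (md 0 i t))"
proof -
  show "\<forall>\<^sub>F i in F. \<forall>t\<in>{t0..t1}. rotation_matrix (x i t)"
    using cubic by eventually_elim (simp add: riemannian_cubic_def)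
  show "der x (\<lambda>i t. x i t ** ad (md 0 i t))"
    using cubic reduction unfolding der_def
  proof eventually_elim
    case (elim i)
    show ?case
    proof
      fix t assume t: "t \<in> {t0..t1}"
      have "x i differentiable (at t within {t0..t1})"
        using elim(1) t unfolding riemannian_cubic_def smooth_curve_on_def differentiable_on_def nderiv_def
        by (metis funpow_0)
      then have "(x i has_vector_derivative vderiv {t0..t1} (x i) t) (at t within {t0..t1})"
        by (simp add: vderiv_def vector_derivative_works)
      moreover have "vderiv {t0..t1} (x i) t = x i t ** ad (md 0 i t)"
      proof -
        have "rotation_matrix (x i t)" using elim(1) t by (simp add: riemannian_cubic_def)
        then have "invertible (x i t)"
          by (auto simp: invertible_def rotation_matrix_def orthogonal_matrix_def)
        moreover have "matrix_inv (x i t) ** vderiv {t0..t1} (x i) t = ad (md 0 i t)"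
          using elim(2) t by (simp add: has_lie_quadratic_def left_reduction_def mixed_deriv_00)
        ultimately show ?thesis
          by (metis invertible_matrix_inv matrix_mul_assoc matrix_mul_lid)
      qed
      ultimately show "(x i has_vector_derivative x i t ** ad (md 0 i t)) (at t within {t0..t1})" by simp
    qed
  qed
qed

text \<open>The smoothness in \<open>riemannian_cubic\<close> is not uniform over the family;
  uniform bounds come from the boundedness of rotations and the linear equation for
  \<open>x\<close>.\<close>

lemma sm_x: "sm 0 x"
proof (rule sm_ode[OF _ x_facts(2)])
  show "bnd 0 x"
    by (rule bndI[where C=2], use x_facts(1) in eventually_elim) (simp add: norm_rotation)
  fix k assume "ordk k 0 x"
  then show "ordk k 0 (\<lambda>i t. x i t ** ad (md 0 i t))"
    using ordk_bilinear[OF bounded_bilinear_matrix_mult3, of k 0 x 0] sm_linear[OF bounded_linear_ad sm_md(1)]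
    by (simp add: sm_def)
qed

definition xh :: "'i \<Rightarrow> real \<Rightarrow> real^3^3" where
  "xh = (\<lambda>i t. x i t0 ** transpose (yh i t0) ** yh i t)"

lemma sm_initial: assumes "sm 0 f" shows "sm 0 (\<lambda>i t. f i t0)"
proof (rule sm_const)
  obtain C where C: "\<forall>\<^sub>F i in F. \<forall>t\<in>{t0..t1}. norm (f i t) \<le> C * \<delta> i ^ 0"
    using bndE[OF sm_bnd[OF assms]] .
  then show "bnd 0 (\<lambda>i t. f i t0)"
    using t01 by (intro bndI[where C=C]) (auto elim!: eventually_mono)
qed

text \<open>The matrix \<open>z = xh x\<^sup>T - 1\<close> vanishes at \<open>t0\<close> and has derivative \<open>O(\<delta>\<^sup>2)\<close>, and \<open>xh - x = z x\<close>.\<close>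

lemma close_x: "close 2 x xh"
proof -
  let ?Q = "\<lambda>i. x i t0 ** transpose (yh i t0)"
  have syh: "sm 0 yh" using close_y closeD by blast
  have sQ: "sm 0 (\<lambda>i t. ?Q i)"
    using sm_mat[OF sm_initial[OF sm_x] sm_linear[OF bounded_linear_transpose3 sm_initial[OF syh]]] by simp
  have sxh: "sm 0 xh" unfolding xh_def using sm_mat[OF sQ syh] by simp
  have sxT: "sm 0 (\<lambda>i t. transpose (x i t))" by (rule sm_linear[OF bounded_linear_transpose3 sm_x])
  obtain yh' where yh': "der yh yh'" "sm 2 (\<lambda>i t. yh' i t - yh i t ** ad (md 0 i t))"
    using yh_defect .
  define z where "z = (\<lambda>i t. xh i t ** transpose (x i t) - mat 1)"
  let ?z' = "\<lambda>i t. ?Q i ** (yh' i t - yh i t ** ad (md 0 i t)) ** transpose (x i t)"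
  interpret mm: bounded_bilinear "(**) :: real^3^3 \<Rightarrow> real^3^3 \<Rightarrow> real^3^3"
    by (rule bounded_bilinear_matrix_mult3)
  have dxh: "der xh (\<lambda>i t. ?Q i ** yh' i t)"
    unfolding xh_def
    by (rule der_cong[OF agree_refl _ der_bilinear[OF bounded_bilinear_matrix_mult3 der_const yh'(1)]], rule agreeI)
      (simp add: mm.zero_left)
  have dz: "der z ?z'"
    unfolding z_def
  proof (rule der_cong[OF agree_refl _ der_diff[OF der_bilinear[OF bounded_bilinear_matrix_mult3 dxh
            der_linear[OF bounded_linear_transpose3 x_facts(2)]] der_const]], rule agreeI)
    fix i t
    \<comment> \<open>Skew-symmetry of \<open>ad\<close> gives the transposed equation a minus sign,
      so the two derivative terms combine to the defect of \<open>yh\<close>.\<close>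
    have "xh i t ** transpose (x i t ** ad (md 0 i t)) = - (?Q i ** (yh i t ** ad (md 0 i t)) ** transpose (x i t))"
      unfolding matrix_transpose_mul transpose_ad xh_def by (simp add: mm.minus_left mm.minus_right matrix_mul_assoc)
    then show "xh i t ** transpose (x i t ** ad (md 0 i t)) + ?Q i ** yh' i t ** transpose (x i t) - 0 = ?z' i t"
      by (simp add: mm.diff_left mm.diff_right)
  qed
  have "sm 2 ?z'" using sm_mat[OF sm_mat[OF sQ yh'(2)] sxT] by (simp only: add_0 add_0_right)
  moreover have "\<forall>\<^sub>F i in F. z i t0 = 0"
    using yh_orthogonal x_facts(1)
  proof eventually_elim
    case (elim i)
    have t: "t0 \<in> {t0..t1}" using t01 by simp
    have "xh i t0 ** transpose (x i t0) = x i t0 ** (transpose (yh i t0) ** yh i t0) ** transpose (x i t0)"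
      by (simp add: xh_def matrix_mul_assoc)
    then show ?case using elim t rotation_transpose(2)[of "x i t0"] by (simp add: z_def)
  qed
  ultimately have "sm 2 z" using sm_int[OF dz] by blast
  then have "sm 2 (\<lambda>i t. z i t ** x i t)" using sm_mat[OF _ sm_x] by fastforce
  moreover have "agree (\<lambda>i t. z i t ** x i t) (\<lambda>i t. xh i t - x i t)"
    using x_facts(1) unfolding agree_def
  proof eventually_elim
    case (elim i)
    then show ?case
      by (auto simp: z_def mm.diff_left matrix_mul_assoc[symmetric] rotation_transpose(1))
  qed
  ultimately have "sm 2 (\<lambda>i t. xh i t - x i t)" using sm_cong by blast
  then have "sm 2 (\<lambda>i t. - (xh i t - x i t))"
    by (rule sm_linear[OF bounded_linear_minus[OF bounded_linear_ident]])
  then show ?thesis using closeI[OF sxh] by simp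
qed

section \<open>Identification with the stated approximation\<close>

lemma V_hat2_second:
  "agree (\<lambda>i. nderiv {t0..t1} 2 (V_hat2 t0 t1 (V i) (\<delta> i))) (\<lambda>i t. \<delta> i *\<^sub>R w_hat i t)"
proof -
  let ?P = "\<lambda>b i t. m 0 b i t + \<delta> i *\<^sub>R m 1 b i t + ((\<delta> i)^2 / 2) *\<^sub>R m 2 b i t"
  have P: "der (?P b) (?P (Suc b))" for b
    by (intro der_add der_scale der_m)
  have 0: "agree (\<lambda>i. V_hat2 t0 t1 (V i) (\<delta> i)) (?P 0)"
    by (rule agreeI) (simp add: V_hat2_def mixed_deriv_00)
  have 1: "agree (\<lambda>i. vderiv {t0..t1} (V_hat2 t0 t1 (V i) (\<delta> i))) (?P 1)"
    using agree_trans[OF agree_vderiv[OF 0] vderiv_agree[OF P]] by simp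
  have 2: "agree (\<lambda>i. vderiv {t0..t1} (vderiv {t0..t1} (V_hat2 t0 t1 (V i) (\<delta> i)))) (?P 2)"
    using agree_trans[OF agree_vderiv[OF 1] vderiv_agree[OF P]] by (simp add: numeral_2_eq_2)
  have "agree (?P 2) (\<lambda>i t. \<delta> i *\<^sub>R w_hat i t)"
    using m02 unfolding agree_def
    by eventually_elim (simp add: scaleR_add_right power2_eq_square)
  from agree_trans[OF 2 this] show ?thesis
    by (simp add: numeral_2_eq_2 nderiv_def)
qed

text \<open>The positive factor \<delta> drops out by \<open>S_mat_scale\<close>, and
  \<open>low_q\<close> ensures that the two vectors are eventually linearly independent, as
  \<open>S_mat_eq\<close> requires.\<close>

lemma y_hat_eq: "agree (\<lambda>i. y_hat t0 t1 (V i) d c2 a11 a12 \<beta> (\<gamma> i) (\<delta> i)) yh"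
proof -
  let ?W = "\<lambda>i. nderiv {t0..t1} 2 (V_hat2 t0 t1 (V i) (\<delta> i))"
  have 1: "agree (\<lambda>i. vderiv {t0..t1} (?W i)) (\<lambda>i t. \<delta> i *\<^sub>R wd i t)"
    by (rule agree_trans[OF agree_vderiv[OF V_hat2_second] vderiv_agree[OF der_scale[OF der_w_hat]]])
  show ?thesis
    using V_hat2_second 1 pos low_pos[OF low_q] unfolding agree_def
  proof eventually_elim
    case (elim i)
    show ?case
    proof
      fix t assume t: "t \<in> {t0..t1}"
      have "T_curve t0 t1 (?W i) t = S_mat (w_hat i t) (wd i t)"
        using elim t by (simp add: T_curve_def S_mat_scale)
      also have "\<dots> = vector [q1 i t, q2 i t, q3 i t]"
        unfolding nrm_eq by (rule S_mat_eq) (use elim(4) t in simp)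
      finally show "y_hat t0 t1 (V i) d c2 a11 a12 \<beta> (\<gamma> i) (\<delta> i) t = yh i t"
        by (simp add: y_hat_def yh_def ph_def)
    qed
  qed
qed

lemma x_hat_eq: "agree (\<lambda>i. x_hat t0 t1 (V i) d c2 a11 a12 \<beta> (\<gamma> i) (\<delta> i) (x i t0)) xh"
  using y_hat_eq unfolding agree_def
  by eventually_elim (use t01 in \<open>auto simp: x_hat_def xh_def\<close>)

lemma cubic_approximation:
  obtains K where "\<forall>\<^sub>F i in F. \<forall>t\<in>{t0..t1}. norm (nderiv {t0..t1} j (x i) t
    - nderiv {t0..t1} j (x_hat t0 t1 (V i) d c2 a11 a12 \<beta> (\<gamma> i) (\<delta> i) (x i t0)) t) \<le> K * (\<delta> i)\<^sup>2"
proof (rule nderiv_close[OF close_cong[OF agree_refl agree_sym[OF x_hat_eq] close_x], of j])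
qed (rule that)

end

theorem theorem4:
  fixes t0 t1 d c2 a11 a12 \<beta> M :: real and j :: nat
  assumes "t0 < t1" and "0 < \<beta>"
  shows "\<exists>K \<delta>0. 0 < \<delta>0 \<and>
    (\<forall>V D F0 F1 F2 c0 c1 A0 A1 B \<gamma> \<delta> x.
      lie_quadratic_variation t0 t1 V D \<longrightarrow> variation_bound t0 t1 V M \<longrightarrow>
      d = norm D \<longrightarrow> adapted_frame D F0 F1 F2 \<longrightarrow>
      first_order_data t0 t1 V d F0 c0 c1 c2 A0 A1 B \<longrightarrow>
      A1 = a11 *\<^sub>R F1 + a12 *\<^sub>R F2 \<longrightarrow>
      B \<noteq> 0 \<longrightarrow> B = \<beta> *\<^sub>R (cos \<gamma> *\<^sub>R F1 + sin \<gamma> *\<^sub>R F2) \<longrightarrow> 0 \<le> \<gamma> \<longrightarrow> \<gamma> < 2 * pi \<longrightarrow>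
      0 < \<delta> \<longrightarrow> \<delta> < 1 \<longrightarrow> \<delta> < \<delta>0 \<longrightarrow>
      riemannian_cubic t0 t1 x \<longrightarrow> has_lie_quadratic t0 t1 x (V \<delta>) \<longrightarrow>
      (\<forall>t\<in>{t0..t1}.
         norm (nderiv {t0..t1} j x t
               - nderiv {t0..t1} j (x_hat t0 t1 V d c2 a11 a12 \<beta> \<gamma> \<delta> (x t0)) t) \<le> K * \<delta>^2))"
proof (cases "d > 0")
  case False
  \<comment> \<open>A variation has nonzero \<open>D\<close>, so \<open>d = norm D\<close> fails and
    the claim is vacuous.\<close>
  then have "\<not> lie_quadratic_variation t0 t1 V D \<or> d \<noteq> norm D" for V and D :: "real^3"
    by (auto simp: lie_quadratic_variation_def)
  then show ?thesis by (intro exI[of _ 1] conjI) (simp, blast)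
next
  case True
  \<comment> \<open>The tuple collects everything over which the estimate must be uniform;
    \<open>A1\<close> and \<open>B\<close> are replaced by their expressions in the frame.\<close>
  define H where "H = (\<lambda>(V, D, F0, F1, F2, c0, c1, A0, \<gamma>, \<delta>, x).
      lie_quadratic_variation t0 t1 V D \<and> variation_bound t0 t1 V M \<and>
      d = norm D \<and> adapted_frame D F0 F1 F2 \<and>
      first_order_data t0 t1 V d F0 c0 c1 c2 A0 (a11 *\<^sub>R F1 + a12 *\<^sub>R F2) (\<beta> *\<^sub>R (cos \<gamma> *\<^sub>R F1 + sin \<gamma> *\<^sub>R F2)) \<and>
      riemannian_cubic t0 t1 x \<and> has_lie_quadratic t0 t1 x (V \<delta>))"
  define del where "del = (\<lambda>(V :: real \<Rightarrow> real \<Rightarrow> real^3, D :: real^3, F0 :: real^3, F1 :: real^3, F2 :: real^3,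
      c0 :: real, c1 :: real, A0 :: real^3, \<gamma> :: real, \<delta> :: real, x :: real \<Rightarrow> real^3^3). \<delta>)"
  \<comment> \<open>\<open>\<delta>\<close> tends to 0 through admissible data; an eventual bound is then uniform in the data\<close>
  define F where "F = inf (filtercomap del (at_right 0)) (principal {i. H i})"
  have H: "eventually H F"
    unfolding F_def eventually_inf_principal by simp
  have "filterlim del (at_right 0) F"
    unfolding F_def by (rule filterlim_mono[OF filterlim_filtercomap order_refl inf_le1])
  then interpret cubic_family F del t0 t1
    "\<lambda>(V, D, F0, F1, F2, c0, c1, A0, \<gamma>, \<delta>, x). V" "\<lambda>(V, D, F0, F1, F2, c0, c1, A0, \<gamma>, \<delta>, x). D"
    "\<lambda>(V, D, F0, F1, F2, c0, c1, A0, \<gamma>, \<delta>, x). F0" "\<lambda>(V, D, F0, F1, F2, c0, c1, A0, \<gamma>, \<delta>, x). F1"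
    "\<lambda>(V, D, F0, F1, F2, c0, c1, A0, \<gamma>, \<delta>, x). F2" "\<lambda>(V, D, F0, F1, F2, c0, c1, A0, \<gamma>, \<delta>, x). A0"
    "\<lambda>(V, D, F0, F1, F2, c0, c1, A0, \<gamma>, \<delta>, x). c0" "\<lambda>(V, D, F0, F1, F2, c0, c1, A0, \<gamma>, \<delta>, x). c1"
    "\<lambda>(V, D, F0, F1, F2, c0, c1, A0, \<gamma>, \<delta>, x). \<gamma>" "\<lambda>(V, D, F0, F1, F2, c0, c1, A0, \<gamma>, \<delta>, x). x"
    d c2 a11 a12 \<beta> M
    by unfold_locales
      (use assms True in simp_all, (rule eventually_mono[OF H], auto simp: H_def del_def)+)
  obtain K where "\<forall>\<^sub>F (V, D, F0, F1, F2, c0, c1, A0, \<gamma>, \<delta>, x) in F. \<forall>t\<in>{t0..t1}. norm (nderiv {t0..t1} j x t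
    - nderiv {t0..t1} j (x_hat t0 t1 V d c2 a11 a12 \<beta> \<gamma> \<delta> (x t0)) t) \<le> K * \<delta>\<^sup>2"
    using cubic_approximation[of j] by (auto simp: del_def case_prod_unfold)
  \<comment> \<open>Unfolding \<open>F\<close> turns the eventual bound into one threshold on
    \<delta>, valid for every tuple that satisfies \<open>H\<close>.\<close>
  then obtain \<delta>0 where "\<delta>0 > 0" and K: "\<And>V D F0 F1 F2 c0 c1 A0 \<gamma> \<delta> x.
      0 < \<delta> \<Longrightarrow> \<delta> < \<delta>0 \<Longrightarrow> H (V, D, F0, F1, F2, c0, c1, A0, \<gamma>, \<delta>, x) \<Longrightarrow> \<forall>t\<in>{t0..t1}. norm (nderiv {t0..t1} j x t
    - nderiv {t0..t1} j (x_hat t0 t1 V d c2 a11 a12 \<beta> \<gamma> \<delta> (x t0)) t) \<le> K * \<delta>\<^sup>2"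
    unfolding F_def eventually_inf_principal eventually_filtercomap eventually_at_right_field del_def
    by fastforce
  then show ?thesis
    by (intro exI[of _ K] exI[of _ \<delta>0]) (auto simp: H_def)
qed

end
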